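(* Let $X=\{x_k\}_{k=1}^\infty\subset\mathbb{R}$ be an increasing sequence such that, with $d_k:=x_{k+1}-x_k$, one has $\inf_{k\ge 1}d_k>0$ and $\sup_{k\ge 1}d_k<\infty$, and put $d_0^{-1}:=0$. Let $\alpha=\{\alpha_k\}_{k=1}^\infty\subset\mathbb{R}$ and let $L_{X,\alpha}$ be the self-adjoint operator in $L^2(\mathbb{R})$ with $\delta$-interactions of strengths $\alpha_k$ at the points $x_k$. Let $m\in\mathbb{N}$ and let $K=\{k_i\}_{i=1}^m\subset\mathbb{N}$ be a set of $m$ distinct indices such that $$\alpha_{k_i}<-2\bigl(d_{k_i-1}^{-1}+d_{k_i}^{-1}\bigr)\quad\text{for all }k_i\in K.$$ Then $\kappa_-(L_{X,\alpha})\ge m$. If, in addition, $\alpha_i>0$ for all $i\in\mathbb{N}\setminus K$, then $\kappa_-(L_{X,\alpha})=m$.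
   Context: $W_2^2(\mathbb{R}\setminus X):=\{f\in L^2(\mathbb{R}): f,f'\in AC_{loc}(\mathbb{R}\setminus X),\ f''\in L^2(\mathbb{R})\}$. The operator $L_{X,\alpha}$ acts in $L^2(\mathbb{R})$ by $f\mapsto -f''$ (on $\mathbb{R}\setminus X$) on the domain $$\{f\in W_2^2(\mathbb{R}\setminus X): f(x_k+)=f(x_k-),\ f'(x_k+)-f'(x_k-)=\alpha_k f(x_k)\ \text{for all }x_k\in X\};$$ it is known to be self-adjoint. For a self-adjoint operator $T$ in a Hilbert space $\mathfrak{H}$ with spectral measure $E_T$, the number of negative squares is $\kappa_-(T):=\dim E_T(-\infty,0)\mathfrak{H}\in\{0,1,2,\dots\}\cup\{\infty\}$. *)

theory Defs
  imports "HOL-Analysis.Analysis" "HOL-Library.Extended_Nat"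
begin

section \<open>The complex Hilbert space of square integrable functions on the line\<close>

definition square_integrable :: "(real \<Rightarrow> complex) \<Rightarrow> bool" where
  "square_integrable f \<longleftrightarrow>
     f \<in> borel_measurable lebesgue \<and> integrable lebesgue (\<lambda>t. (cmod (f t))\<^sup>2)"

definition L2_eq :: "(real \<Rightarrow> complex) \<Rightarrow> (real \<Rightarrow> complex) \<Rightarrow> bool" where
  "L2_eq f g \<longleftrightarrow> square_integrable f \<and> square_integrable g \<and> (AE t in lebesgue. f t = g t)"

lemma measurable_cnj [measurable (raw)]:
  "f \<in> borel_measurable M \<Longrightarrow> (\<lambda>t. cnj (f t)) \<in> borel_measurable M"
  by (rule borel_measurable_continuous_on[where f = cnj]) (auto intro: continuous_intros)

lemma square_integrable_zero: "square_integrable (\<lambda>_. 0)"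
  by (simp add: square_integrable_def)

lemma square_integrable_add:
  assumes "square_integrable f" "square_integrable g"
  shows "square_integrable (\<lambda>t. f t + g t)"
proof -
  have m[measurable]: "f \<in> borel_measurable lebesgue" "g \<in> borel_measurable lebesgue"
    using assms by (auto simp: square_integrable_def)
  have i: "integrable lebesgue (\<lambda>t. 2 * (cmod (f t))\<^sup>2 + 2 * (cmod (g t))\<^sup>2)"
    using assms by (auto simp: square_integrable_def)
  have b: "(cmod (a + b))\<^sup>2 \<le> 2 * (cmod a)\<^sup>2 + 2 * (cmod b)\<^sup>2" for a b :: complex
  proof -
    have "(cmod (a + b))\<^sup>2 \<le> (cmod a + cmod b)\<^sup>2"
      by (intro power_mono norm_triangle_ineq) auto
    also have "\<dots> \<le> 2 * (cmod a)\<^sup>2 + 2 * (cmod b)\<^sup>2"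
      using zero_le_power2[of "cmod a - cmod b"] by (simp add: power2_eq_square algebra_simps)
    finally show ?thesis .
  qed
  have "integrable lebesgue (\<lambda>t. (cmod (f t + g t))\<^sup>2)"
    by (rule Bochner_Integration.integrable_bound[OF i]) (auto intro!: AE_I2 order_trans[OF b])
  then show ?thesis by (simp add: square_integrable_def)
qed

lemma square_integrable_scale:
  assumes "square_integrable f"
  shows "square_integrable (\<lambda>t. c * f t)"
  using assms by (auto simp: square_integrable_def norm_mult power_mult_distrib)

lemma square_integrable_uminus:
  "square_integrable f \<Longrightarrow> square_integrable (\<lambda>t. - f t)"
  using square_integrable_scale[of f "-1"] by simp

lemma integrable_mult_cnj:
  assumes "square_integrable f" "square_integrable g"
  shows "integrable lebesgue (\<lambda>t. f t * cnj (g t))"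
proof -
  have m[measurable]: "f \<in> borel_measurable lebesgue" "g \<in> borel_measurable lebesgue"
    using assms by (auto simp: square_integrable_def)
  have i: "integrable lebesgue (\<lambda>t. (cmod (f t))\<^sup>2 + (cmod (g t))\<^sup>2)"
    using assms by (auto simp: square_integrable_def)
  have b: "cmod a * cmod b \<le> (cmod a)\<^sup>2 + (cmod b)\<^sup>2" for a b :: complex
  proof -
    have "cmod a * cmod b \<le> 2 * (cmod a * cmod b)"
      by simp
    also have "\<dots> \<le> (cmod a)\<^sup>2 + (cmod b)\<^sup>2"
      using zero_le_power2[of "cmod a - cmod b"] by (simp add: power2_eq_square algebra_simps)
    finally show ?thesis .
  qed
  show ?thesis
    by (rule Bochner_Integration.integrable_bound[OF i])
       (measurable, auto intro!: AE_I2 order_trans[OF b] simp: norm_mult)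
qed

lemma integral_mult_cnj_self:
  "(LINT t|lebesgue. f t * cnj (f t)) = of_real (LINT t|lebesgue. (cmod (f t))\<^sup>2)"
proof -
  have "(\<lambda>t. f t * cnj (f t)) = (\<lambda>t. complex_of_real ((cmod (f t))\<^sup>2))"
    by (simp add: complex_norm_square[symmetric])
  then show ?thesis by (simp only: integral_complex_of_real)
qed

quotient_type L2 = "real \<Rightarrow> complex" / partial: L2_eq
proof (rule part_equivpI)
  show "\<exists>f. L2_eq f f"
    using square_integrable_zero by (auto simp: L2_eq_def)
  show "symp L2_eq"
    by (auto simp: symp_def L2_eq_def elim: AE_mp)
  show "transp L2_eq"
  proof (rule transpI)
    fix f g h assume a: "L2_eq f g" "L2_eq g h"
    then have "AE t in lebesgue. f t = g t" "AE t in lebesgue. g t = h t"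
      by (auto simp: L2_eq_def)
    then have "AE t in lebesgue. f t = h t" by eventually_elim simp
    with a show "L2_eq f h" by (auto simp: L2_eq_def)
  qed
qed

lift_definition scaleC :: "complex \<Rightarrow> L2 \<Rightarrow> L2" is "\<lambda>c f t. c * f t"
  by (auto simp: L2_eq_def square_integrable_scale elim: AE_mp)

text \<open>The inner product is linear in the first and antilinear in the second argument.\<close>

lift_definition cinner :: "L2 \<Rightarrow> L2 \<Rightarrow> complex" is
  "\<lambda>f g. LINT t|lebesgue. f t * cnj (g t)"
proof -
  fix f f' g g' assume a: "L2_eq f f'" "L2_eq g g'"
  have [measurable]: "f \<in> borel_measurable lebesgue" "f' \<in> borel_measurable lebesgue"
      "g \<in> borel_measurable lebesgue" "g' \<in> borel_measurable lebesgue"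
    using a by (auto simp: L2_eq_def square_integrable_def)
  have "AE t in lebesgue. f t = f' t" "AE t in lebesgue. g t = g' t"
    using a by (auto simp: L2_eq_def)
  then have "AE t in lebesgue. f t * cnj (g t) = f' t * cnj (g' t)"
    by eventually_elim simp
  then show "(LINT t|lebesgue. f t * cnj (g t)) = (LINT t|lebesgue. f' t * cnj (g' t))"
    by (intro integral_cong_AE) measurable
qed

instantiation L2 :: ab_group_add
begin

lift_definition zero_L2 :: L2 is "\<lambda>_. 0"
  by (simp add: L2_eq_def square_integrable_zero)

lift_definition plus_L2 :: "L2 \<Rightarrow> L2 \<Rightarrow> L2" is "\<lambda>f g t. f t + g t"
proof -
  fix f f' g g' assume a: "L2_eq f f'" "L2_eq g g'"
  then have "AE t in lebesgue. f t = f' t" "AE t in lebesgue. g t = g' t"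
    by (auto simp: L2_eq_def)
  then have "AE t in lebesgue. f t + g t = f' t + g' t" by eventually_elim simp
  with a show "L2_eq (\<lambda>t. f t + g t) (\<lambda>t. f' t + g' t)"
    by (auto simp: L2_eq_def square_integrable_add)
qed

lift_definition uminus_L2 :: "L2 \<Rightarrow> L2" is "\<lambda>f t. - f t"
  by (auto simp: L2_eq_def square_integrable_uminus elim: AE_mp)

definition minus_L2 :: "L2 \<Rightarrow> L2 \<Rightarrow> L2" where
  "minus_L2 f g = f + - g"

instance
proof
  fix f g h :: L2
  show "f + g + h = f + (g + h)"
    by transfer (auto simp: L2_eq_def algebra_simps square_integrable_add)
  show "f + g = g + f"
    by transfer (auto simp: L2_eq_def algebra_simps square_integrable_add)
  show "0 + f = f"
    by transfer (auto simp: L2_eq_def)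
  show "- f + f = 0"
    by transfer (auto simp: L2_eq_def square_integrable_zero)
  show "f - g = f + - g"
    by (simp add: minus_L2_def)
qed

end

lemma scaleC_add_right: "scaleC c (f + g) = scaleC c f + scaleC c g"
  by transfer (auto simp: L2_eq_def algebra_simps intro!: square_integrable_add square_integrable_scale)

lemma scaleC_add_left: "scaleC (c + d) f = scaleC c f + scaleC d f"
  by transfer (use square_integrable_add[OF square_integrable_scale square_integrable_scale]
      in \<open>auto simp: L2_eq_def algebra_simps\<close>)

lemma scaleC_scaleC: "scaleC c (scaleC d f) = scaleC (c * d) f"
  by transfer (use square_integrable_scale in \<open>auto simp: L2_eq_def algebra_simps\<close>)

lemma scaleC_one: "scaleC 1 f = f"
  by transfer (auto simp: L2_eq_def)

lemma cinner_add_left: "cinner (f + g) h = cinner f h + cinner g h"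
  by transfer (auto simp: L2_eq_def distrib_right integrable_mult_cnj)

lemma cinner_scaleC_left: "cinner (scaleC c f) g = c * cinner f g"
  by transfer (simp add: mult.assoc)

lemma cinner_commute: "cinner f g = cnj (cinner g f)"
proof transfer
  fix f g :: "real \<Rightarrow> complex"
  have "(\<lambda>t. f t * cnj (g t)) = (\<lambda>t. cnj (g t * cnj (f t)))" by (simp add: mult.commute)
  then show "(LINT t|lebesgue. f t * cnj (g t)) = cnj (LINT t|lebesgue. g t * cnj (f t))"
    by (simp only: Bochner_Integration.integral_cnj)
qed

lemma cinner_self_ge_zero: "0 \<le> Re (cinner f f)"
  by transfer (simp add: integral_mult_cnj_self)

lemma cinner_self_eq_zero: "Re (cinner f f) = 0 \<longleftrightarrow> f = 0"
proof transfer
  fix f assume "L2_eq f f"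
  then have f: "square_integrable f" by (simp add: L2_eq_def)
  then have "integrable lebesgue (\<lambda>t. (cmod (f t))\<^sup>2)" by (simp add: square_integrable_def)
  then have "(LINT t|lebesgue. (cmod (f t))\<^sup>2) = 0 \<longleftrightarrow> (AE t in lebesgue. (cmod (f t))\<^sup>2 = 0)"
    by (intro integral_nonneg_eq_0_iff_AE) auto
  then show "(Re (LINT t|lebesgue. f t * cnj (f t)) = 0) = L2_eq f (\<lambda>_. 0)"
    using f by (simp add: integral_mult_cnj_self L2_eq_def square_integrable_zero)
qed

text \<open>The real structure below only serves to make the norm, the metric and the notion of
  convergent series of the library available.  All linear algebra in the sequel is over the
  complex numbers.\<close>

instantiation L2 :: real_inner
begin

definition scaleR_L2 :: "real \<Rightarrow> L2 \<Rightarrow> L2" where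
  "scaleR_L2 r f = scaleC (of_real r) f"

definition inner_L2 :: "L2 \<Rightarrow> L2 \<Rightarrow> real" where
  "inner_L2 f g = Re (cinner f g)"

definition norm_L2 :: "L2 \<Rightarrow> real" where
  "norm_L2 f = sqrt (Re (cinner f f))"

definition sgn_L2 :: "L2 \<Rightarrow> L2" where
  "sgn_L2 f = inverse (norm f) *\<^sub>R f"

definition dist_L2 :: "L2 \<Rightarrow> L2 \<Rightarrow> real" where
  "dist_L2 f g = norm (f - g)"

definition uniformity_L2 :: "(L2 \<times> L2) filter" where
  "uniformity_L2 = (INF e\<in>{0<..}. principal {(f, g). dist f g < e})"

definition open_L2 :: "L2 set \<Rightarrow> bool" where
  "open_L2 U \<longleftrightarrow> (\<forall>f\<in>U. eventually (\<lambda>(f', g). f' = f \<longrightarrow> g \<in> U) uniformity)"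

instance
proof
  fix f g h :: L2 and r s :: real and U :: "L2 set"
  show "r *\<^sub>R (f + g) = r *\<^sub>R f + r *\<^sub>R g"
    by (simp add: scaleR_L2_def scaleC_add_right)
  show "(r + s) *\<^sub>R f = r *\<^sub>R f + s *\<^sub>R f"
    by (simp add: scaleR_L2_def scaleC_add_left)
  show "r *\<^sub>R s *\<^sub>R f = (r * s) *\<^sub>R f"
    by (simp add: scaleR_L2_def scaleC_scaleC)
  show "1 *\<^sub>R f = f"
    by (simp add: scaleR_L2_def scaleC_one)
  show "sgn f = inverse (norm f) *\<^sub>R f"
    by (simp add: sgn_L2_def)
  show "dist f g = norm (f - g)"
    by (simp add: dist_L2_def)
  show "uniformity = (INF e\<in>{0<..}. principal {(f :: L2, g). dist f g < e})"
    by (simp add: uniformity_L2_def)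
  show "open U = (\<forall>f\<in>U. \<forall>\<^sub>F (f', g) in uniformity. f' = f \<longrightarrow> g \<in> U)"
    by (simp add: open_L2_def)
  show "inner f g = inner g f"
    unfolding inner_L2_def by (subst cinner_commute) simp
  show "inner (f + g) h = inner f h + inner g h"
    by (simp add: inner_L2_def cinner_add_left)
  show "inner (r *\<^sub>R f) g = r * inner f g"
    by (simp add: inner_L2_def scaleR_L2_def cinner_scaleC_left)
  show "0 \<le> inner f f"
    by (simp add: inner_L2_def cinner_self_ge_zero)
  show "inner f f = 0 \<longleftrightarrow> f = 0"
    by (simp add: inner_L2_def cinner_self_eq_zero)
  show "norm f = sqrt (inner f f)"
    by (simp add: norm_L2_def inner_L2_def)
qed

end

interpretation L2_complex: vector_space scaleC
  by unfold_locales (simp_all add: scaleC_add_right scaleC_add_left scaleC_scaleC scaleC_one)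

text \<open>The library dimension is \<open>0\<close> for spaces without a finite basis, hence the case distinction.\<close>

definition complex_dim :: "L2 set \<Rightarrow> enat" where
  "complex_dim V =
     (if \<exists>B. finite B \<and> V \<subseteq> L2_complex.span B then enat (L2_complex.dim V) else \<infinity>)"

section \<open>Spectral measures and the number of negative squares\<close>

text \<open>An unbounded operator is represented by its graph, a subset of \<open>L2 \<times> L2\<close>; its domain is
  the \<open>Domain\<close> of this relation.  The values of \<open>E\<close> on non-Borel sets are irrelevant.\<close>

definition orthogonal_projection :: "(L2 \<Rightarrow> L2) \<Rightarrow> bool" where
  "orthogonal_projection P \<longleftrightarrow>
     (\<forall>f g. P (f + g) = P f + P g) \<and> (\<forall>c f. P (scaleC c f) = scaleC c (P f)) \<and>
     (\<forall>f. P (P f) = P f) \<and> (\<forall>f g. cinner (P f) g = cinner f (P g))"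

definition projection_valued_measure :: "(real set \<Rightarrow> L2 \<Rightarrow> L2) \<Rightarrow> bool" where
  "projection_valued_measure E \<longleftrightarrow>
     (\<forall>B\<in>sets borel. orthogonal_projection (E B)) \<and>
     E UNIV = id \<and>
     (\<forall>A :: nat \<Rightarrow> real set. range A \<subseteq> sets borel \<longrightarrow> disjoint_family A \<longrightarrow>
        (\<forall>f. (\<lambda>n. E (A n) f) sums E (\<Union>n. A n) f))"

definition scalar_measure :: "(real set \<Rightarrow> L2 \<Rightarrow> L2) \<Rightarrow> L2 \<Rightarrow> real measure" where
  "scalar_measure E f = measure_of UNIV (sets borel) (\<lambda>B. ennreal (Re (cinner (E B f) f)))"

text \<open>The graph of the operator \<open>\<integral> s dE(s)\<close>: its domain consists of all \<open>f\<close> with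
  \<open>\<integral> s\<^sup>2 d\<langle>E(s)f,f\<rangle> < \<infinity>\<close>, and on it the operator is given by the sesquilinear form
  \<open>\<integral> s d\<langle>E(s)f,h\<rangle>\<close>, where the complex measure \<open>\<langle>E(\<cdot>)f,h\<rangle>\<close> is expressed through positive
  measures by polarization (\<open>h\<close> ranges over the domain, which is dense).\<close>

definition spectral_domain :: "(real set \<Rightarrow> L2 \<Rightarrow> L2) \<Rightarrow> L2 set" where
  "spectral_domain E = {f. integrable (scalar_measure E f) (\<lambda>s. s\<^sup>2)}"

definition spectral_form :: "(real set \<Rightarrow> L2 \<Rightarrow> L2) \<Rightarrow> L2 \<Rightarrow> L2 \<Rightarrow> complex" where
  "spectral_form E f h =
     (\<Sum>k<4. \<i> ^ k * of_real (LINT s|scalar_measure E (f + scaleC (\<i> ^ k) h). s)) / 4"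

definition spectral_integral :: "(real set \<Rightarrow> L2 \<Rightarrow> L2) \<Rightarrow> (L2 \<times> L2) set" where
  "spectral_integral E =
     {(f, g). f \<in> spectral_domain E \<and> (\<forall>h\<in>spectral_domain E. cinner g h = spectral_form E f h)}"

definition is_spectral_measure_of :: "(real set \<Rightarrow> L2 \<Rightarrow> L2) \<Rightarrow> (L2 \<times> L2) set \<Rightarrow> bool" where
  "is_spectral_measure_of E T \<longleftrightarrow> projection_valued_measure E \<and> T = spectral_integral E"

text \<open>The number \<open>\<kappa>\<^sub>-(T)\<close> in terms of the spectral measure \<open>E\<close> of \<open>T\<close>.\<close>

definition negative_squares :: "(real set \<Rightarrow> L2 \<Rightarrow> L2) \<Rightarrow> enat" where
  "negative_squares E = complex_dim (range (E {..<0}))"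

section \<open>The Schroedinger operator with delta-interactions\<close>

definition absolutely_continuous_on :: "real \<Rightarrow> real \<Rightarrow> (real \<Rightarrow> complex) \<Rightarrow> bool" where
  "absolutely_continuous_on a b f \<longleftrightarrow>
     (\<forall>\<epsilon>>0. \<exists>\<delta>>0. \<forall>n (u :: nat \<Rightarrow> real) v.
        (\<forall>i<n. a \<le> u i \<and> u i \<le> v i \<and> v i \<le> b) \<longrightarrow>
        disjoint_family_on (\<lambda>i. {u i<..<v i}) {..<n} \<longrightarrow>
        (\<Sum>i<n. v i - u i) < \<delta> \<longrightarrow> (\<Sum>i<n. cmod (f (v i) - f (u i))) < \<epsilon>)"

definition AC_loc :: "real set \<Rightarrow> (real \<Rightarrow> complex) \<Rightarrow> bool" where
  "AC_loc U f \<longleftrightarrow> (\<forall>a b. {a..b} \<subseteq> U \<longrightarrow> absolutely_continuous_on a b f)"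

abbreviation derivative :: "(real \<Rightarrow> complex) \<Rightarrow> real \<Rightarrow> complex" where
  "derivative f \<equiv> (\<lambda>t. vector_derivative f (at t))"

text \<open>The function \<open>f'\<close> exists everywhere off \<open>X\<close> (it is required to be locally absolutely
  continuous there), whereas \<open>f''\<close> exists almost everywhere only; the almost everywhere
  differentiability of \<open>f'\<close> is a consequence of its local absolute continuity and is listed for
  definiteness, since \<^const>\<open>vector_derivative\<close> is a total function.\<close>

definition W22 :: "real set \<Rightarrow> (real \<Rightarrow> complex) set" where
  "W22 X = {f. square_integrable f \<and> AC_loc (- X) f \<and>
     (\<forall>t\<in>- X. f differentiable (at t)) \<and> AC_loc (- X) (derivative f) \<and>
     (AE t in lebesgue. derivative f differentiable (at t)) \<and>
     square_integrable (derivative (derivative f))}"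

text \<open>Sequences are indexed by \<open>k \<ge> 1\<close>; the values at \<open>0\<close> are ignored.\<close>

definition delta_jump_conditions ::
  "(nat \<Rightarrow> real) \<Rightarrow> (nat \<Rightarrow> real) \<Rightarrow> (real \<Rightarrow> complex) \<Rightarrow> bool" where
  "delta_jump_conditions x \<alpha> f \<longleftrightarrow> (\<forall>k\<ge>1. \<exists>c p q.
     (f \<longlongrightarrow> c) (at_right (x k)) \<and> (f \<longlongrightarrow> c) (at_left (x k)) \<and>
     (derivative f \<longlongrightarrow> p) (at_right (x k)) \<and> (derivative f \<longlongrightarrow> q) (at_left (x k)) \<and>
     p - q = of_real (\<alpha> k) * c)"

text \<open>The graph of \<open>L\<^bsub>X,\<alpha>\<^esub>\<close>; \<^const>\<open>abs_L2\<close> maps a square integrable function to its class.\<close>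

definition delta_operator :: "(nat \<Rightarrow> real) \<Rightarrow> (nat \<Rightarrow> real) \<Rightarrow> (L2 \<times> L2) set" where
  "delta_operator x \<alpha> =
     {(abs_L2 f, abs_L2 (\<lambda>t. - derivative (derivative f) t)) | f.
        f \<in> W22 (x ` {1..}) \<and> delta_jump_conditions x \<alpha> f}"

definition gap :: "(nat \<Rightarrow> real) \<Rightarrow> nat \<Rightarrow> real" where
  "gap x k = x (k + 1) - x k"

definition inverse_gap :: "(nat \<Rightarrow> real) \<Rightarrow> nat \<Rightarrow> real" where
  "inverse_gap x k = (if k = 0 then 0 else 1 / gap x k)"

end

theory Submission
  imports Defs
begin

text \<open>
  Let \<open>W = Re (f' cnj f) = (|f|\<^sup>2)' / 2\<close> for \<open>f\<close> in the domain of the operator \<open>L\<close>.  Off \<open>X\<close> it grows at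
  the rate \<open>Re (f'' cnj f) + |f'|\<^sup>2\<close>, and at \<open>x\<^sub>k\<close> it jumps by \<open>\<alpha>\<^sub>k |f(x\<^sub>k)|\<^sup>2\<close>; so \<open>\<langle>L f, f\<rangle>\<close> is
  \<open>\<integral>|f'|\<^sup>2 + \<Sum>\<^sub>k \<alpha>\<^sub>k |f(x\<^sub>k)|\<^sup>2\<close> for compactly supported \<open>f\<close>, and it is nonnegative for all \<open>f\<close> whose
  jumps are nonnegative, because the integrable function \<open>|f|\<^sup>2\<close> cannot grow towards either end of the line.

  Lower bound: for \<open>k \<in> K\<close> take a bump in the domain with value \<open>1\<close> at \<open>x\<^sub>k\<close>, supported between the
  neighbours of \<open>x\<^sub>k\<close>, whose energy is close to the minimum \<open>1/d\<^sub>k\<^sub>-\<^sub>1 + 1/d\<^sub>k\<close>.  At most two bumps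
  overlap at any point, so the form of \<open>\<Sum>\<^sub>k c\<^sub>k u\<^sub>k\<close> is at most
  \<open>\<Sum>\<^sub>k |c\<^sub>k|\<^sup>2 (2 \<integral>|u\<^sub>k'|\<^sup>2 + \<alpha>\<^sub>k) < 0\<close>, and no nontrivial combination is annihilated by
  \<open>E (-\<infinity>, 0)\<close>.

  Upper bound: on the range of \<open>E [-n, -1/n]\<close>, which lies in the domain, the form is negative definite;
  if all \<open>\<alpha>\<^sub>i\<close> off \<open>K\<close> are positive, then \<open>m + 1\<close> independent vectors there would have a nontrivial
  combination that vanishes at all \<open>x\<^sub>k\<close> with \<open>k \<in> K\<close> and so has a nonnegative form.
\<close>

section \<open>The fundamental theorem of calculus for absolutely continuous functions\<close>

text \<open>The factor 2 in the hypothesis is the price of overlap: bumps of neighbouring indices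
  share an interval, where |a + b|^2 is only bounded by 2|a|^2 + 2|b|^2. The minimal energy belongs
  to the piecewise linear hat, which violates the jump conditions and so lies outside the domain;
  the strict inequality pays for bending it. At k = 1 the convention 1/d_0 = 0 reflects that a bump
  may decay arbitrarily slowly to the left.

  The operator is given only as the integral of s against \<open>E\<close>, so the spectral facts
  are read off the scalar measures of \<open>E\<close>. A vector in the range of
  \<open>E {..<0}\<close> need not lie in the domain, and the form need not be bounded away from
  zero there; this is why the upper bound works in windows that avoid both ends of the negative
  half-line.

  For a general element of the domain neither f' in L^2 nor convergence of the sum of the jumps is
  at hand, so nothing is integrated by parts over the whole line. Instead each estimate is the
  monotonicity of one auxiliary function on a compact interval, where only finitely many jumps
  occur.\<close>

lemma fundamental_theorem_of_calculus_AC: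
  fixes F F' :: "real \<Rightarrow> complex"
  assumes ab: "a \<le> b" and ac: "absolutely_continuous_on a b F" and N: "negligible N"
    and der: "\<And>t. t \<in> {a..b} - N \<Longrightarrow> (F has_vector_derivative F' t) (at t within {a..b})"
  shows "(F' has_integral (F b - F a)) {a..b}"
proof (cases "a = b")
  case True
  then show ?thesis using has_integral_refl(2)[of F' b] by simp
next
  case False
  with ab have "a < b" by simp
  \<comment> \<open>Zero on \<open>N\<close>: tags in \<open>N\<close> then contribute only
    increments of \<open>F\<close> to the error, which absolute continuity controls. The other tags
    are handled by differentiability, and each kind of tag gets half of \<open>e\<close>.\<close>
  define g where "g t = (if t \<in> N then 0 else F' t)" for t
  have "(g has_integral (F b - F a)) {a..b}"
    unfolding has_integral_factor_content_real
  proof safe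
    fix e :: real assume "e > 0"
    define e' where "e' = e / 2"
    have e': "e' > 0" using \<open>e > 0\<close> by (simp add: e'_def)
    have "\<forall>t. \<exists>d>0. t \<in> {a..b} - N \<longrightarrow>
         (\<forall>y\<in>{a..b}. norm (y-t) < d \<longrightarrow> norm (F y - F t - (y-t) *\<^sub>R F' t) \<le> e' * norm (y-t))"
      using der[unfolded has_vector_derivative_def has_derivative_within_alt] e'
      by (metis zero_less_one)
    then obtain d where d: "\<And>t. 0 < d t"
         "\<And>t y. \<lbrakk>t \<in> {a..b} - N; y \<in> {a..b}; norm (y-t) < d t\<rbrakk>
                        \<Longrightarrow> norm (F y - F t - (y-t) *\<^sub>R F' t) \<le> e' * norm (y-t)"
      by metis
    have "e' * (b - a) > 0" using e' \<open>a < b\<close> by simp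
    then obtain \<delta> where \<delta>: "\<delta> > 0" and ac': "\<And>n (u :: nat \<Rightarrow> real) v.
        (\<forall>i<n. a \<le> u i \<and> u i \<le> v i \<and> v i \<le> b) \<Longrightarrow>
        disjoint_family_on (\<lambda>i. {u i<..<v i}) {..<n} \<Longrightarrow>
        (\<Sum>i<n. v i - u i) < \<delta> \<Longrightarrow> (\<Sum>i<n. cmod (F (v i) - F (u i))) < e' * (b - a)"
      using ac unfolding absolutely_continuous_on_def by blast
    have Ns: "N \<in> null_sets lebesgue" using N negligible_iff_null_sets by blast
    then obtain U where U: "open U" "N \<subseteq> U" "U - N \<in> lmeasurable" "emeasure lebesgue (U - N) < ennreal \<delta>"
      using sets_lebesgue_outer_open[of N \<delta>] \<delta> by (metis null_setsD2)
    have Um: "U \<in> lmeasurable"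
    proof -
      have "U = (U - N) \<union> N" using U by auto
      moreover have "N \<in> lmeasurable" using N negligible_imp_measurable by blast
      ultimately show ?thesis using U(3) by (metis fmeasurable.Un)
    qed
    have "emeasure lebesgue (U - N) = emeasure lebesgue U"
      by (rule emeasure_Diff_null_set[OF Ns]) (use Um in auto)
    then have mU: "measure lebesgue U < \<delta>"
      using U(4) Um \<delta> by (metis emeasure_eq_measure2 ennreal_less_iff measure_nonneg)
    \<comment> \<open>At tags in \<open>N\<close> the gauge is one open neighbourhood of
      \<open>N\<close> of measure below \<delta>, so all cells with such tags together have length
      below \<delta>.\<close>
    define G where "G t = (if t \<in> N then U else ball t (d t))" for t
    show "\<exists>\<gamma>. gauge \<gamma> \<and> (\<forall>p. p tagged_division_of {a..b} \<and> \<gamma> fine p \<longrightarrow>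
            cmod ((\<Sum>(x, k)\<in>p. measure lborel k *\<^sub>R g x) - (F b - F a)) \<le> e * measure lborel {a..b})"
    proof (intro exI conjI allI impI)
      show "gauge G" using U d(1) by (auto simp: gauge_def G_def)
    next
      fix p assume "p tagged_division_of {a..b} \<and> G fine p"
      then have p: "p tagged_division_of {a..b}" and fine: "G fine p" by auto
      have fin: "finite p" using p by blast
      have K: "x \<in> K \<and> K = {Inf K..Sup K} \<and> a \<le> Inf K \<and> Inf K \<le> x \<and> x \<le> Sup K \<and> Sup K \<le> b
           \<and> measure lborel K = Sup K - Inf K \<and> K \<subseteq> G x"
        if xK: "(x, K) \<in> p" for x K
      proof -
        obtain u v where uv: "K = cbox u v" using p xK by blast
        have "x \<in> K" "K \<subseteq> {a..b}" using p xK by blast+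
        moreover have "K \<subseteq> G x" using fine xK by (auto simp: fine_def)
        ultimately show ?thesis using uv by auto
      qed
      define p1 where "p1 = {z \<in> p. fst z \<in> N}"
      define T where "T z = measure lborel (snd z) *\<^sub>R g (fst z) - (F (Sup (snd z)) - F (Inf (snd z)))" for z :: "real \<times> real set"
      have "F b - F a = (\<Sum>(x,K)\<in>p. F (Sup K) - F (Inf K))" "b - a = (\<Sum>(x,K)\<in>p. Sup K - Inf K)"
        using additive_tagged_division_1[OF ab p, of F] additive_tagged_division_1[OF ab p, of "\<lambda>x. x"] by auto
      then have eq: "(\<Sum>(x, k)\<in>p. measure lborel k *\<^sub>R g x) - (F b - F a) = sum T p"
          and ba: "b - a = (\<Sum>z\<in>p. Sup (snd z) - Inf (snd z))"
        by (simp_all add: T_def sum_subtractf case_prod_beta)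
      have split: "sum T p = sum T (p - p1) + sum T p1"
        by (rule sum.subset_diff) (auto simp: p1_def fin)
      have b1: "norm (sum T (p - p1)) \<le> e' * (b - a)"
      proof -
        have "norm (sum T (p - p1)) \<le> (\<Sum>z\<in>p - p1. e' * (Sup (snd z) - Inf (snd z)))"
        proof (rule sum_norm_le)
          fix z assume z: "z \<in> p - p1"
          obtain x K where zz: "z = (x, K)" by force
          have xK: "(x, K) \<in> p" "x \<notin> N" using z by (auto simp: zz p1_def)
          note k = K[OF xK(1)]
          have Gx: "G x = ball x (d x)" using xK by (simp add: G_def)
          let ?u = "Inf K" and ?v = "Sup K"
          have in_K: "?u \<in> K" "?v \<in> K" using k by (metis atLeastAtMost_iff order.trans order_refl)+
          then have nb: "norm (?u - x) < d x" "norm (?v - x) < d x"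
            using k Gx by (auto simp: dist_real_def abs_minus_commute)
          have xab: "x \<in> {a..b} - N" using k xK by auto
          have "norm (T z) = norm ((?v - ?u) *\<^sub>R F' x - (F ?v - F ?u))"
            using k xK by (simp add: T_def zz g_def)
          also have "\<dots> = norm ((F ?u - F x - (?u - x) *\<^sub>R F' x) - (F ?v - F x - (?v - x) *\<^sub>R F' x))"
            by (simp add: algebra_simps)
          also have "\<dots> \<le> norm (F ?u - F x - (?u - x) *\<^sub>R F' x) + norm (F ?v - F x - (?v - x) *\<^sub>R F' x)"
            by (rule norm_triangle_ineq4)
          also have "\<dots> \<le> e' * norm (?u - x) + e' * norm (?v - x)"
            using k nb by (intro add_mono d(2) xab) auto
          also have "\<dots> = e' * (?v - ?u)"
            using k by (simp add: algebra_simps)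
          finally show "norm (T z) \<le> e' * (Sup (snd z) - Inf (snd z))" by (simp add: zz)
        qed
        also have "\<dots> \<le> (\<Sum>z\<in>p. e' * (Sup (snd z) - Inf (snd z)))"
          using fin e' by (intro sum_mono2) (auto intro!: mult_nonneg_nonneg dest: K)
        also have "\<dots> = e' * (b - a)" by (simp add: ba sum_distrib_left)
        finally show ?thesis .
      qed
      have b2: "norm (sum T p1) \<le> e' * (b - a)"
      proof -
        have fin1: "finite p1" using fin by (simp add: p1_def)
        \<comment> \<open>The definition of absolute continuity speaks of families indexed by an
          initial segment of the naturals, so the cells with tags in \<open>N\<close> are
          enumerated.\<close>
        obtain h where h: "bij_betw h {0..<card p1} p1" using ex_bij_betw_nat_finite[OF fin1] by blast
        define n where "n = card p1"
        have h: "bij_betw h {..<n} p1" using h by (simp add: n_def atLeast0LessThan)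
        have hin: "h i \<in> p" "fst (h i) \<in> N" if "i < n" for i
          using that h by (auto simp: bij_betw_def p1_def)
        define u v where "u i = Inf (snd (h i))" and "v i = Sup (snd (h i))" for i
        have uv: "a \<le> u i \<and> u i \<le> v i \<and> v i \<le> b" if "i < n" for i
          using K[of "fst (h i)" "snd (h i)"] hin[OF that] by (auto simp: u_def v_def)
        have snd_h: "snd (h i) = {u i..v i}" if "i < n" for i
          using K[of "fst (h i)" "snd (h i)"] hin[OF that] by (auto simp: u_def v_def)
        have disj: "disjoint_family_on (\<lambda>i. {u i<..<v i}) {..<n}"
          unfolding disjoint_family_on_def
        proof (intro ballI impI)
          fix i j assume ij: "i \<in> {..<n}" "j \<in> {..<n}" "i \<noteq> j"
          then have "h i \<noteq> h j" using h by (auto simp: bij_betw_def inj_on_def)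
          then have "interior (snd (h i)) \<inter> interior (snd (h j)) = {}"
            using tagged_division_ofD(5)[OF p, of "fst (h i)" "snd (h i)" "fst (h j)" "snd (h j)"] hin ij
            by auto
          then show "{u i<..<v i} \<inter> {u j<..<v j} = {}"
            using snd_h ij by simp
        qed
        have "(\<Sum>i<n. v i - u i) = (\<Sum>i<n. measure lebesgue {u i<..<v i})"
          using uv by (intro sum.cong) auto
        also have "\<dots> = measure lebesgue (\<Union>i<n. {u i<..<v i})"
          by (rule measure_finite_Union[symmetric]) (use disj in \<open>auto simp: uv\<close>)
        also have "\<dots> \<le> measure lebesgue U"
        proof (rule measure_mono_fmeasurable[OF _ _ Um])
          show "(\<Union>i<n. {u i<..<v i}) \<subseteq> U"
          proof safe
            fix i t assume i: "i < n" and t: "t \<in> {u i<..<v i}"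
            have "snd (h i) \<subseteq> U"
              using K[of "fst (h i)" "snd (h i)"] hin[OF i] by (auto simp: G_def)
            then show "t \<in> U" using t snd_h[OF i] by auto
          qed
        qed auto
        also have "\<dots> < \<delta>" by (rule mU)
        finally have "(\<Sum>i<n. cmod (F (v i) - F (u i))) < e' * (b - a)"
          using ac'[of n u v] uv disj by blast
        moreover have "norm (sum T p1) \<le> (\<Sum>i<n. cmod (F (v i) - F (u i)))"
        proof -
          have "sum T p1 = (\<Sum>i<n. T (h i))"
            by (rule sum.reindex_bij_betw[OF h, symmetric])
          also have "norm \<dots> \<le> (\<Sum>i<n. cmod (F (v i) - F (u i)))"
            using hin by (intro sum_norm_le) (auto simp: T_def g_def u_def v_def norm_minus_commute)
          finally show ?thesis .
        qed
        ultimately show ?thesis by simp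
      qed
      have "norm (sum T p) \<le> e' * (b - a) + e' * (b - a)"
        unfolding split using b1 b2 norm_triangle_ineq[of "sum T (p - p1)" "sum T p1"] by linarith
      also have "\<dots> = e * measure lborel {a..b}" using ab by (simp add: e'_def algebra_simps)
      finally show "cmod ((\<Sum>(x, k)\<in>p. measure lborel k *\<^sub>R g x) - (F b - F a)) \<le> e * measure lborel {a..b}"
        by (simp only: eq)
    qed
  qed
  then show ?thesis
    by (rule has_integral_spike[OF N, rotated]) (auto simp: g_def)
qed

section \<open>Completeness of the space of square integrable functions\<close>

lemma L2_eq_refl: "square_integrable f \<Longrightarrow> L2_eq f f"
  by (simp add: L2_eq_def)

lemma L2_cases:
  obtains f where "square_integrable f" "v = abs_L2 f"
  using Quotient3_rep_reflp[OF Quotient3_L2, of v] Quotient3_abs_rep[OF Quotient3_L2, of v]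
  by (metis L2_eq_def)

lemma plus_abs_L2:
  "square_integrable f \<Longrightarrow> square_integrable g \<Longrightarrow> abs_L2 f + abs_L2 g = abs_L2 (\<lambda>t. f t + g t)"
  by (simp add: plus_L2.abs_eq L2_eq_refl)

lemma scaleC_abs_L2: "square_integrable f \<Longrightarrow> scaleC c (abs_L2 f) = abs_L2 (\<lambda>t. c * f t)"
  by (simp add: scaleC.abs_eq L2_eq_refl)

lemma cinner_abs_L2:
  "square_integrable f \<Longrightarrow> square_integrable g \<Longrightarrow>
     cinner (abs_L2 f) (abs_L2 g) = (LINT t|lebesgue. f t * cnj (g t))"
  by (simp add: cinner.abs_eq L2_eq_refl)

lemma square_integrable_diff:
  "square_integrable f \<Longrightarrow> square_integrable g \<Longrightarrow> square_integrable (\<lambda>t. f t - g t)"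
  using square_integrable_add[OF _ square_integrable_uminus, of f g] by simp

lemma diff_abs_L2:
  assumes "square_integrable f" "square_integrable g"
  shows "abs_L2 f - abs_L2 g = abs_L2 (\<lambda>t. f t - g t)"
proof -
  have "abs_L2 f - abs_L2 g + abs_L2 g = abs_L2 (\<lambda>t. f t - g t) + abs_L2 g"
    using assms by (subst plus_abs_L2) (auto simp: square_integrable_diff)
  then show ?thesis by simp
qed

lemma power2_norm_L2: "(norm f)\<^sup>2 = Re (cinner f f)"
  by (simp add: power2_norm_eq_inner inner_L2_def)

lemma power2_norm_abs_L2:
  "square_integrable f \<Longrightarrow> (norm (abs_L2 f))\<^sup>2 = (LINT t|lebesgue. (cmod (f t))\<^sup>2)"
  by (simp add: power2_norm_L2 cinner_abs_L2 integral_mult_cnj_self)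

lemma nn_integral_square_integrable:
  assumes "square_integrable f"
  shows "(\<integral>\<^sup>+t. ennreal ((cmod (f t))\<^sup>2) \<partial>lebesgue) = ennreal ((norm (abs_L2 f))\<^sup>2)"
  using assms by (simp add: power2_norm_abs_L2 square_integrable_def nn_integral_eq_integral)

text \<open>The Riesz--Fischer theorem.  A rapidly convergent subsequence converges almost everywhere
  because \<open>\<Sum>\<^sub>k 4 ^ k |f\<^sub>k\<^sub>+\<^sub>1 - f\<^sub>k|\<^sup>2\<close> has finite integral; Fatou's lemma identifies the
  pointwise limit as the limit in the mean.\<close>

lemma L2_Cauchy_convergent:
  fixes X :: "nat \<Rightarrow> L2"
  assumes "Cauchy X"
  shows "convergent X"
proof -
  have "\<forall>k. \<exists>M. \<forall>m\<ge>M. \<forall>n\<ge>M. norm (X m - X n) < (1/4) ^ k"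
    using assms unfolding Cauchy_def dist_norm by simp
  then obtain M where M: "\<And>k m n. m \<ge> M k \<Longrightarrow> n \<ge> M k \<Longrightarrow> norm (X m - X n) < (1/4) ^ k"
    by metis
  \<comment> \<open>The partial sums dominate \<open>M k\<close> and increase with \<open>k\<close>;
    the summand \<open>k\<close> makes the indices unbounded.\<close>
  define r where "r k = (\<Sum>j\<le>k. M j) + k" for k
  have r_mono: "r k \<le> r l" if "k \<le> l" for k l
    unfolding r_def using that by (intro add_mono sum_mono2) auto
  have rM: "M k \<le> r k" for k
    unfolding r_def by (rule trans_le_add1, rule member_le_sum) auto
  have near: "norm (X (r l) - X (r k)) < (1/4) ^ k" if "k \<le> l" for k l
    using M[of k] rM r_mono[OF that] by (meson order_trans)
  have "\<forall>k. \<exists>f. square_integrable f \<and> X (r k) = abs_L2 f"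
    by (metis L2_cases)
  then obtain f where f: "\<And>k. square_integrable (f k)" and Xf: "\<And>k. X (r k) = abs_L2 (f k)"
    by metis
  have [measurable]: "f k \<in> borel_measurable lebesgue" for k
    using f by (simp add: square_integrable_def)
  have dist_le: "(\<integral>\<^sup>+t. ennreal ((cmod (f l t - f k t))\<^sup>2) \<partial>lebesgue) \<le> ennreal ((1/16) ^ k)"
    if "k \<le> l" for k l
  proof -
    have "(norm (X (r l) - X (r k)))\<^sup>2 \<le> ((1/4) ^ k)\<^sup>2"
      using near[OF that] by (intro power_mono) auto
    also have "\<dots> = (1/16) ^ k"
      by (simp add: power2_eq_square flip: power_mult_distrib)
    finally show ?thesis
      by (subst nn_integral_square_integrable)
         (auto simp: f Xf diff_abs_L2 square_integrable_diff intro!: ennreal_leI)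
  qed
  \<comment> \<open>The squared distances are at most 16^-k. A weight of 4^k leaves the summable
    4^-k for the integrals and still forces the pointwise differences below 2^-k eventually.\<close>
  define d where "d k t = ennreal (4 ^ k * (cmod (f (Suc k) t - f k t))\<^sup>2)" for k t
  have "(\<integral>\<^sup>+t. (\<Sum>k. d k t) \<partial>lebesgue) = (\<Sum>k. \<integral>\<^sup>+t. d k t \<partial>lebesgue)"
    unfolding d_def by (rule nn_integral_suminf) measurable
  also have "\<dots> \<le> (\<Sum>k. ennreal ((1/4) ^ k))"
  proof (intro suminf_le allI)
    fix k
    have "(\<integral>\<^sup>+t. d k t \<partial>lebesgue) = ennreal (4 ^ k) * (\<integral>\<^sup>+t. ennreal ((cmod (f (Suc k) t - f k t))\<^sup>2) \<partial>lebesgue)"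
      unfolding d_def by (subst nn_integral_cmult[symmetric]) (auto simp: ennreal_mult)
    also have "\<dots> \<le> ennreal (4 ^ k) * ennreal ((1/16) ^ k)"
      by (intro mult_left_mono dist_le) auto
    also have "\<dots> = ennreal ((1/4) ^ k)"
      by (simp add: ennreal_mult[symmetric] power_mult_distrib[symmetric])
    finally show "(\<integral>\<^sup>+t. d k t \<partial>lebesgue) \<le> ennreal ((1/4) ^ k)" .
  qed auto
  also have "\<dots> = ennreal (\<Sum>k. (1/4) ^ k)"
    by (intro suminf_ennreal2) (auto intro: summable_geometric)
  also have "\<dots> < \<infinity>" by simp
  finally have "AE t in lebesgue. (\<Sum>k. d k t) \<noteq> \<infinity>"
    by (intro nn_integral_PInf_AE) (auto simp: d_def)
  then have conv: "AE t in lebesgue. convergent (\<lambda>k. f k t)"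
  proof eventually_elim
    case (elim t)
    have "summable (\<lambda>k. 4 ^ k * (cmod (f (Suc k) t - f k t))\<^sup>2)"
      using elim unfolding d_def by (intro summable_suminf_not_top) auto
    then have "(\<lambda>k. 4 ^ k * (cmod (f (Suc k) t - f k t))\<^sup>2) \<longlonglongrightarrow> 0"
      by (rule summable_LIMSEQ_zero)
    then have "\<forall>\<^sub>F k in sequentially. 4 ^ k * (cmod (f (Suc k) t - f k t))\<^sup>2 < 1"
      by (rule order_tendstoD) simp
    then have "\<forall>\<^sub>F k in sequentially. norm (f (Suc k) t - f k t) \<le> (1/2) ^ k"
    proof eventually_elim
      case (elim k)
      have pow4: "((2::real) ^ k)\<^sup>2 = 4 ^ k"
        by (simp add: power2_eq_square flip: power_mult_distrib)
      from elim have "(2 ^ k * cmod (f (Suc k) t - f k t))\<^sup>2 < 1\<^sup>2"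
        using pow4 by (simp add: power_mult_distrib)
      then have "2 ^ k * cmod (f (Suc k) t - f k t) < 1"
        by (rule power_less_imp_less_base) simp
      then show ?case by (simp add: power_divide field_simps)
    qed
    then have "summable (\<lambda>k. f (Suc k) t - f k t)"
      by (rule summable_comparison_test_ev) (simp add: summable_geometric)
    then have "convergent (\<lambda>n. \<Sum>k<n. f (Suc k) t - f k t)"
      by (simp add: summable_iff_convergent)
    then have "convergent (\<lambda>n. f n t - f 0 t)"
      by (simp only: sum_lessThan_telescope[of "\<lambda>k. f k t"])
    then show ?case
      using convergent_add[OF _ convergent_const, of "\<lambda>n. f n t - f 0 t" "f 0 t"] by simp
  qed
  define F where "F t = lim (\<lambda>k. f k t)" for t
  have [measurable]: "F \<in> borel_measurable lebesgue"
    unfolding F_def by (rule borel_measurable_lim_metric) measurable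
  have F_le: "(\<integral>\<^sup>+t. ennreal ((cmod (F t - f k t))\<^sup>2) \<partial>lebesgue) \<le> ennreal ((1/16) ^ k)" for k
  proof -
    have "(\<integral>\<^sup>+t. ennreal ((cmod (F t - f k t))\<^sup>2) \<partial>lebesgue)
        = (\<integral>\<^sup>+t. liminf (\<lambda>l. ennreal ((cmod (f l t - f k t))\<^sup>2)) \<partial>lebesgue)"
    proof (rule nn_integral_cong_AE)
      show "AE t in lebesgue. ennreal ((cmod (F t - f k t))\<^sup>2) = liminf (\<lambda>l. ennreal ((cmod (f l t - f k t))\<^sup>2))"
        using conv
      proof eventually_elim
        case (elim t)
        then have "(\<lambda>l. f l t) \<longlonglongrightarrow> F t" unfolding F_def by (simp add: convergent_LIMSEQ_iff)
        then have "(\<lambda>l. ennreal ((cmod (f l t - f k t))\<^sup>2)) \<longlonglongrightarrow> ennreal ((cmod (F t - f k t))\<^sup>2)"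
          by (intro tendsto_ennrealI tendsto_intros)
        then show ?case by (metis lim_imp_Liminf trivial_limit_sequentially)
      qed
    qed
    also have "\<dots> \<le> liminf (\<lambda>l. \<integral>\<^sup>+t. ennreal ((cmod (f l t - f k t))\<^sup>2) \<partial>lebesgue)"
      by (rule nn_integral_liminf) measurable
    also have "\<dots> \<le> ennreal ((1/16) ^ k)"
    proof (rule Liminf_le)
      show "\<forall>\<^sub>F l in sequentially. (\<integral>\<^sup>+t. ennreal ((cmod (f l t - f k t))\<^sup>2) \<partial>lebesgue) \<le> ennreal ((1/16) ^ k)"
        using eventually_ge_at_top[of k] by eventually_elim (rule dist_le)
    qed simp
    finally show ?thesis .
  qed
  have sd: "square_integrable (\<lambda>t. F t - f k t)" for k
    unfolding square_integrable_def
  proof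
    have "(\<integral>\<^sup>+t. ennreal (norm ((cmod (F t - f k t))\<^sup>2)) \<partial>lebesgue) < \<infinity>"
      using F_le[of k] by (simp add: le_less_trans)
    then show "integrable lebesgue (\<lambda>t. (cmod (F t - f k t))\<^sup>2)"
      by (intro integrableI_bounded) auto
  qed measurable
  have F: "square_integrable F"
    using square_integrable_add[OF sd f, of 0 0] by simp
  have "norm (abs_L2 F - X (r k)) \<le> (1/4) ^ k" for k
  proof -
    have "ennreal ((norm (abs_L2 F - X (r k)))\<^sup>2) \<le> ennreal ((1/16) ^ k)"
      using F_le[of k] nn_integral_square_integrable[OF sd] by (simp add: Xf diff_abs_L2 F f)
    then have "(norm (abs_L2 F - X (r k)))\<^sup>2 \<le> ((1/4) ^ k)\<^sup>2"
      by (simp add: power2_eq_square flip: power_mult_distrib)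
    then show ?thesis by (rule power2_le_imp_le) simp
  qed
  then have "(\<lambda>k. X (r k) - abs_L2 F) \<longlonglongrightarrow> 0"
    by (intro Lim_null_comparison[OF always_eventually LIMSEQ_power_zero[of "1/4::real"]] allI)
       (simp_all add: norm_minus_commute[of _ "abs_L2 F"])
  then have Xr: "(\<lambda>k. X (r k)) \<longlonglongrightarrow> abs_L2 F" by (simp add: LIM_zero_iff)
  have "X \<longlonglongrightarrow> abs_L2 F"
  proof (rule LIMSEQ_I)
    fix e :: real assume "e > 0"
    then obtain N where N: "\<And>m n. m \<ge> N \<Longrightarrow> n \<ge> N \<Longrightarrow> norm (X m - X n) < e / 2"
      using assms unfolding Cauchy_def dist_norm by (meson half_gt_zero)
    obtain k0 where k0: "\<And>k. k \<ge> k0 \<Longrightarrow> norm (X (r k) - abs_L2 F) < e / 2"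
      using LIMSEQ_D[OF Xr, of "e/2"] \<open>e > 0\<close> by auto
    define k where "k = max k0 N"
    have "r k \<ge> N" unfolding r_def k_def by simp
    have "norm (X n - abs_L2 F) < e" if "n \<ge> N" for n
      using N[OF that \<open>r k \<ge> N\<close>] k0[of k] norm_triangle_ineq[of "X n - X (r k)" "X (r k) - abs_L2 F"]
      by (simp add: k_def)
    then show "\<exists>N. \<forall>n\<ge>N. norm (X n - abs_L2 F) < e" by blast
  qed
  then show ?thesis by (auto simp: convergent_def)
qed

section \<open>Projection-valued measures\<close>

lemma scaleC_zero_right [simp]: "scaleC c 0 = 0"
  by (rule L2_complex.scale_zero_right)

lemma cinner_add_right: "cinner h (f + g) = cinner h f + cinner h g"
  unfolding cinner_commute[of h] by (simp add: cinner_add_left)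

lemma cinner_scaleC_right: "cinner f (scaleC c g) = cnj c * cinner f g"
  using cinner_scaleC_left[of c g f] cinner_commute[of f g] cinner_commute[of f "scaleC c g"] by simp

lemma cinner_zero_left [simp]: "cinner 0 h = 0"
  using cinner_add_left[of 0 0 h] by simp

lemma cinner_zero_right [simp]: "cinner h 0 = 0"
  using cinner_add_right[of h 0 0] by simp

lemma cinner_diff_left: "cinner (f - g) h = cinner f h - cinner g h"
  using cinner_add_left[of "f - g" g h] by simp

lemma cinner_sum_left: "cinner (\<Sum>i\<in>I. f i) h = (\<Sum>i\<in>I. cinner (f i) h)"
  by (induction I rule: infinite_finite_induct) (auto simp: cinner_add_left)

lemma cinner_sum_right: "cinner h (\<Sum>i\<in>I. f i) = (\<Sum>i\<in>I. cinner h (f i))"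
  by (induction I rule: infinite_finite_induct) (auto simp: cinner_add_right)

lemma norm_scaleC: "norm (scaleC c f) = cmod c * norm f"
proof -
  have "(norm (scaleC c f))\<^sup>2 = (cmod c * norm f)\<^sup>2"
    unfolding power_mult_distrib power2_norm_L2 cinner_scaleC_left cinner_scaleC_right
    by (simp add: cmod_power2 algebra_simps power2_eq_square[of "Re c"] power2_eq_square[of "Im c"])
  then show ?thesis by (simp add: power2_eq_iff_nonneg)
qed

lemma cinner_eq_inner: "cinner f g = Complex (inner f g) (inner f (scaleC \<i> g))"
  by (simp add: inner_L2_def cinner_scaleC_right complex_eq_iff)

lemma tendsto_cinner_left:
  assumes "X \<longlonglongrightarrow> f"
  shows "(\<lambda>n. cinner (X n) g) \<longlonglongrightarrow> cinner f g"
  unfolding cinner_eq_inner by (intro tendsto_intros assms)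

text \<open>A symmetric map has a real quadratic form, so the real parts lose nothing. They are
  taken to match \<open>spectral_form\<close>, which is assembled from real integrals.\<close>

lemma cinner_polarization:
  assumes add: "\<And>f g. S (f + g) = S f + S g" and scale: "\<And>c f. S (scaleC c f) = scaleC c (S f)"
    and sym: "\<And>f g. cinner (S f) g = cinner f (S g)"
  shows "cinner (S f) h =
    (\<Sum>k<4. \<i> ^ k * of_real (Re (cinner (S (f + scaleC (\<i> ^ k) h)) (f + scaleC (\<i> ^ k) h)))) / 4"
proof -
  have "cinner (S h) f = cnj (cinner (S f) h)"
    by (metis cinner_commute sym)
  then show ?thesis
    by (simp add: eval_nat_numeral lessThan_Suc add scale cinner_add_left cinner_add_right
        cinner_scaleC_left cinner_scaleC_right complex_eq_iff algebra_simps)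
qed

section \<open>Multiplicativity of projection-valued measures\<close>

locale projection_measure =
  fixes E :: "real set \<Rightarrow> L2 \<Rightarrow> L2"
  assumes pvm: "projection_valued_measure E"
begin

lemma
  assumes "B \<in> sets borel"
  shows E_add: "E B (f + g) = E B f + E B g"
    and E_scaleC: "E B (scaleC c f) = scaleC c (E B f)"
    and E_idem: "E B (E B f) = E B f"
    and E_sym: "cinner (E B f) g = cinner f (E B g)"
proof -
  have "orthogonal_projection (E B)"
    using pvm assms by (simp add: projection_valued_measure_def)
  then show "E B (f + g) = E B f + E B g" "E B (scaleC c f) = scaleC c (E B f)"
      "E B (E B f) = E B f" "cinner (E B f) g = cinner f (E B g)"
    by (simp_all add: orthogonal_projection_def)
qed

lemma E_UNIV: "E UNIV f = f"
  using pvm by (simp add: projection_valued_measure_def)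

lemma E_sums:
  "range A \<subseteq> sets borel \<Longrightarrow> disjoint_family A \<Longrightarrow> (\<lambda>n. E (A n) f) sums E (\<Union>n. A n) f"
  for A :: "nat \<Rightarrow> real set"
  using pvm by (simp add: projection_valued_measure_def)

lemma E_zero: "B \<in> sets borel \<Longrightarrow> E B 0 = 0"
  using E_add[of B 0 0] by simp

lemma E_diff: "B \<in> sets borel \<Longrightarrow> E B (f - g) = E B f - E B g"
  using E_add[of B "f - g" g] by simp

lemma E_sum: "B \<in> sets borel \<Longrightarrow> E B (\<Sum>i\<in>I. f i) = (\<Sum>i\<in>I. E B (f i))"
  by (induction I rule: infinite_finite_induct) (auto simp: E_add E_zero)

lemma E_empty: "E {} f = 0"
proof -
  have "(\<lambda>n::nat. E {} f) sums E (\<Union>n::nat. {}) f"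
    by (rule E_sums) (auto simp: disjoint_family_on_def)
  then have "(\<lambda>n::nat. E {} f) \<longlonglongrightarrow> 0"
    by (intro summable_LIMSEQ_zero sums_summable)
  then show ?thesis by (simp add: LIMSEQ_const_iff)
qed

lemma E_disjoint_Un:
  assumes [measurable]: "A \<in> sets borel" "B \<in> sets borel" and "A \<inter> B = {}"
  shows "E (A \<union> B) f = E A f + E B f"
proof -
  have "(\<lambda>n. E (binaryset A B n) f) sums E (\<Union>n. binaryset A B n) f"
  proof (rule E_sums)
    show "range (binaryset A B) \<subseteq> sets borel"
      by (auto simp: range_binaryset_eq)
    show "disjoint_family (binaryset A B)"
      using assms by (auto simp: disjoint_family_on_def binaryset_def)
  qed
  moreover have "(\<lambda>n. E (binaryset A B n) f) sums (E A f + E B f)"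
    by (rule binaryset_sums) (rule E_empty)
  ultimately show ?thesis
    using sums_unique2 by (metis UN_binaryset_eq)
qed

text \<open>Orthogonality is hidden in additivity: the sum of the two projections is again
  idempotent. Evaluated at a vector \<open>g\<close> fixed by \<open>E B\<close>, this gives
  \<open>E B (E A g) = - E A g\<close>; a second application of \<open>E B\<close> flips the sign,
  so \<open>E A g\<close> equals its own negative.\<close>

lemma E_orthogonal:
  assumes AB: "A \<in> sets borel" "B \<in> sets borel" and "A \<inter> B = {}"
  shows "E A (E B f) = 0"
proof -
  have ABm: "A \<union> B \<in> sets borel" using AB by auto
  have un: "E (A \<union> B) v = E A v + E B v" for v
    by (rule E_disjoint_Un) (use assms in auto)
  define g where "g = E B f"
  have Bg: "E B g = g" using AB by (simp add: g_def E_idem)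
  have "E (A \<union> B) (E (A \<union> B) g) = E (A \<union> B) g" by (rule E_idem[OF ABm])
  then have eq: "E B (E A g) = - E A g"
    by (simp add: un E_add AB E_idem Bg eq_neg_iff_add_eq_0 algebra_simps)
  have "E B (- E A g) = - E A g"
    using E_idem[OF AB(2), of "E A g"] by (simp add: eq)
  moreover have "E B (- E A g) = - E B (E A g)"
    using E_diff[OF AB(2), of 0 "E A g"] by (simp add: E_zero AB)
  ultimately have "E A g = - E A g" by (simp add: eq)
  then have "(2::real) *\<^sub>R E A g = 0" by (simp add: scaleR_2 eq_neg_iff_add_eq_0)
  then show ?thesis by (simp add: g_def)
qed

lemma E_Int:
  assumes AB: "A \<in> sets borel" "B \<in> sets borel"
  shows "E A (E B f) = E (A \<inter> B) f"
proof -
  have "E ((A \<inter> B) \<union> (B - A)) f = E (A \<inter> B) f + E (B - A) f"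
    by (rule E_disjoint_Un) (use AB in auto)
  then have B: "E B f = E (A \<inter> B) f + E (B - A) f"
    by (simp add: Int_commute[of A] Int_Diff_Un)
  have "E A (E B f) = E ((A \<inter> B) \<union> (A - B)) (E B f)" by (simp add: Int_Diff_Un)
  also have "\<dots> = E (A \<inter> B) (E B f)"
    by (subst E_disjoint_Un) (use AB E_orthogonal[of "A - B" B] in auto)
  also have "\<dots> = E (A \<inter> B) f"
    unfolding B using AB E_orthogonal[of "A \<inter> B" "B - A"]
    by (subst E_add) (auto simp: E_idem)
  finally show ?thesis .
qed

lemma cinner_E_eq_norm: "B \<in> sets borel \<Longrightarrow> Re (cinner (E B f) f) = (norm (E B f))\<^sup>2"
  using E_sym[of B f "E B f"] E_sym[of B f f] E_idem[of B f] by (simp add: power2_norm_L2)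

section \<open>Scalar measures of vectors\<close>

abbreviation \<mu> :: "L2 \<Rightarrow> real measure" where "\<mu> \<equiv> scalar_measure E"

lemma sets_scalar_measure [simp, measurable_cong]: "sets (\<mu> f) = sets borel"
proof -
  have "sets (\<mu> f) = sigma_sets UNIV (sets borel)"
    unfolding scalar_measure_def by (rule sets_measure_of) blast
  also have "\<dots> = sets borel"
    using sets.sigma_sets_eq[of borel] unfolding space_borel .
  finally show ?thesis .
qed

lemma space_scalar_measure [simp]: "space (\<mu> f) = UNIV"
  by (simp add: scalar_measure_def)

text \<open>\<open>measure_of\<close> returns the prescribed values only for a countably additive
  set function; additivity comes from pairing the convergent vector series with
  \<open>f\<close>.\<close>

lemma emeasure_scalar_measure:
  assumes "B \<in> sets borel"
  shows "emeasure (\<mu> f) B = ennreal ((norm (E B f))\<^sup>2)"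
proof -
  have "emeasure (\<mu> f) B = ennreal (Re (cinner (E B f) f))"
  proof (rule emeasure_measure_of[OF scalar_measure_def])
    show "positive (sets (\<mu> f)) (\<lambda>B. ennreal (Re (cinner (E B f) f)))"
      by (simp add: positive_def E_empty)
    show "countably_additive (sets (\<mu> f)) (\<lambda>B. ennreal (Re (cinner (E B f) f)))"
      unfolding countably_additive_def
    proof (intro allI impI)
      fix A :: "nat \<Rightarrow> real set"
      assume A: "range A \<subseteq> sets (\<mu> f)" "disjoint_family A"
      then have "(\<lambda>n. E (A n) f) sums E (\<Union>n. A n) f" by (intro E_sums) auto
      then have "(\<lambda>n. inner (E (A n) f) f) sums inner (E (\<Union>n. A n) f) f"
        by (rule bounded_linear.sums[OF bounded_linear_inner_left])
      then show "(\<Sum>n. ennreal (Re (cinner (E (A n) f) f))) = ennreal (Re (cinner (E (\<Union>n. A n) f) f))"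
        using A by (intro suminf_ennreal_eq) (auto simp: inner_L2_def cinner_E_eq_norm)
    qed
  qed (use assms in auto)
  then show ?thesis using assms by (simp add: cinner_E_eq_norm)
qed

lemma finite_measure_scalar_measure: "finite_measure (\<mu> f)"
  by (rule finite_measureI) (simp add: emeasure_scalar_measure)

lemma measure_scalar_measure: "B \<in> sets borel \<Longrightarrow> measure (\<mu> f) B = (norm (E B f))\<^sup>2"
  by (simp add: Sigma_Algebra.measure_def emeasure_scalar_measure)

lemma scalar_measure_scaleC:
  assumes "cmod c = 1"
  shows "\<mu> (scaleC c f) = \<mu> f"
  by (rule measure_eqI) (auto simp: emeasure_scalar_measure E_scaleC norm_scaleC assms)

text \<open>Projecting the vector by \<open>E C\<close> restricts its measure to \<open>C\<close>.
  The density form turns this at once into rules for integrals and integrability.\<close>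

lemma scalar_measure_E:
  assumes C: "C \<in> sets borel"
  shows "\<mu> (E C f) = density (\<mu> f) (\<lambda>s. ennreal (indicat_real C s))"
proof (rule measure_eqI)
  fix A assume "A \<in> sets (\<mu> (E C f))"
  then have A: "A \<in> sets borel" by simp
  have "emeasure (density (\<mu> f) (\<lambda>s. ennreal (indicat_real C s))) A
      = (\<integral>\<^sup>+s. ennreal (indicat_real C s) * indicator A s \<partial>\<mu> f)"
    by (rule emeasure_density) (use A C in auto)
  also have "\<dots> = (\<integral>\<^sup>+s. indicator (A \<inter> C) s \<partial>\<mu> f)"
    by (rule nn_integral_cong) (auto split: split_indicator)
  also have "\<dots> = emeasure (\<mu> f) (A \<inter> C)"
    by (rule nn_integral_indicator) (use A C in auto)
  also have "\<dots> = emeasure (\<mu> (E C f)) A"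
    using A C by (simp add: emeasure_scalar_measure E_Int)
  finally show "emeasure (\<mu> (E C f)) A = emeasure (density (\<mu> f) (\<lambda>s. ennreal (indicat_real C s))) A" ..
qed simp

lemma integral_scalar_measure_E:
  fixes g :: "real \<Rightarrow> real"
  assumes "C \<in> sets borel" "g \<in> borel_measurable borel"
  shows "(LINT s|\<mu> (E C f). g s) = (LINT s|\<mu> f. indicator C s * g s)"
  using assms by (simp add: scalar_measure_E integral_density)

lemma integrable_scalar_measure_E:
  fixes g :: "real \<Rightarrow> real"
  assumes "C \<in> sets borel" "g \<in> borel_measurable borel"
  shows "integrable (\<mu> (E C f)) g \<longleftrightarrow> integrable (\<mu> f) (\<lambda>s. indicator C s * g s)"
  using assms by (simp add: scalar_measure_E integrable_density)

section \<open>The sign of the quadratic form of a spectral integral\<close>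

lemma integral_scalar_measure_0: "(LINT s|\<mu> 0. g s) = (0::real)"
proof -
  have "AE s in \<mu> 0. g s = 0"
    by (rule AE_I[of _ _ UNIV]) (auto simp: emeasure_scalar_measure E_zero)
  then show ?thesis by (rule integral_eq_zero_AE)
qed

text \<open>For \<open>h = f\<close> the four polarization vectors are 2f, f + if, 0 and f - if. The
  third has the zero measure and the second and fourth contribute imaginary numbers, so the real
  part sees only the first.\<close>

lemma spectral_integral_form:
  assumes "(f, g) \<in> spectral_integral E"
  shows "Re (cinner g f) = (LINT s|\<mu> (f + f). s) / 4"
proof -
  have "cinner g f = spectral_form E f f"
    using assms by (auto simp: spectral_integral_def)
  moreover have "f + scaleC (- 1) f = 0"
    using scaleC_add_left[of 1 "-1" f] by (simp add: scaleC_one)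
  ultimately have "cinner g f * 4 = \<i> * complex_of_real (LINT s|\<mu> (f + scaleC \<i> f). s) +
     complex_of_real (LINT s|\<mu> (f + f). s) - \<i> * complex_of_real (LINT s|\<mu> (f + scaleC (- \<i>) f). s)"
    by (simp add: spectral_form_def eval_nat_numeral lessThan_Suc scaleC_one integral_scalar_measure_0)
  from arg_cong[OF this, of Re] show ?thesis by simp
qed

lemma E_double_zero: "B \<in> sets borel \<Longrightarrow> E B f = 0 \<Longrightarrow> E B (f + f) = 0"
  by (simp add: E_add)

text \<open>The scalar measure of such a vector has no mass on the negative half-line. This is what
  makes a combination of bumps annihilated by \<open>E {..<0}\<close> contradictory.\<close>

lemma spectral_integral_nonneg:
  assumes "(f, g) \<in> spectral_integral E" "E {..<0} f = 0"
  shows "0 \<le> Re (cinner g f)"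
proof -
  have "emeasure (\<mu> (f + f)) {..<0} = 0"
    using assms(2) by (simp add: emeasure_scalar_measure E_double_zero)
  then have "AE s in \<mu> (f + f). 0 \<le> s"
    by (intro AE_I[of _ _ "{..<0}"]) auto
  then show ?thesis
    unfolding spectral_integral_form[OF assms(1)] by (simp add: integral_nonneg_AE)
qed

text \<open>The measure is concentrated on \<open>C\<close>: the bound \<open>-r\<close> makes s
  integrable, and the bound \<open>-e\<close> makes the form negative definite. The total mass of
  the measure of \<open>f + f\<close> is four times the squared norm of \<open>f\<close>, which
  cancels the division by 4 in \<open>spectral_integral_form\<close>.\<close>

lemma spectral_integral_negative:
  assumes "(f, g) \<in> spectral_integral E" and C: "C \<in> sets borel" "C \<subseteq> {-r..-e}" and f: "E C f = f"
  shows "Re (cinner g f) \<le> - e * (norm f)\<^sup>2"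
proof -
  interpret finite_measure "\<mu> (f + f)" by (rule finite_measure_scalar_measure)
  have "E (- C) f = 0"
    using E_orthogonal[of "- C" C f] C f by auto
  then have "emeasure (\<mu> (f + f)) (- C) = 0"
    using C by (simp add: emeasure_scalar_measure E_double_zero)
  then have AE: "AE s in \<mu> (f + f). s \<in> C"
    using C by (intro AE_I[of _ _ "- C"]) auto
  have "(LINT s|\<mu> (f + f). s) \<le> (LINT s|\<mu> (f + f). - e)"
  proof (rule integral_mono_AE)
    have "AE s in \<mu> (f + f). norm s \<le> \<bar>r\<bar> + \<bar>e\<bar>"
      using AE
    proof eventually_elim
      case (elim s)
      then have "s \<in> {-r..-e}" using C(2) by blast
      then show ?case by (auto simp: abs_le_iff)
    qed
    then show "integrable (\<mu> (f + f)) (\<lambda>s. s)"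
      by (rule integrable_const_bound) simp
    show "AE s in \<mu> (f + f). s \<le> - e"
      using AE C(2) by (auto elim!: eventually_mono)
  qed simp
  also have "\<dots> = - e * (4 * (norm f)\<^sup>2)"
    by (simp add: measure_scalar_measure E_UNIV power2_eq_square flip: scaleR_2)
  finally show ?thesis
    unfolding spectral_integral_form[OF assms(1)] by simp
qed

text \<open>The vectors in the range of \<open>E C\<close> with \<open>C\<close> bounded belong to the domain of \<open>\<integral> s dE(s)\<close>.
  The value there is the limit of the Riemann sums
  \<open>\<Sum>\<^sub>i (i/N) E({s \<in> C. \<lfloor>sN\<rfloor> = i}) f\<close>; the estimate of the quadratic forms of their differences
  by \<open>1/N\<close> yields both the Cauchy property and, by polarization, the form of the limit.\<close>

context
  fixes C :: "real set" and r :: real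
  assumes C: "C \<in> sets borel" and Cr: "C \<subseteq> {-r..r}"
begin

definition cell :: "nat \<Rightarrow> int \<Rightarrow> real set" where
  "cell N i = {s \<in> C. \<lfloor>s * real (Suc N)\<rfloor> = i}"

text \<open>The margin of 1 at both ends makes sure that the floor of s(N+1) lies in this finite
  range whenever |s| is at most \<open>r\<close>, whatever the rounding of r(N+1).\<close>

definition cells :: "nat \<Rightarrow> int set" where
  "cells N = {- \<lceil>r * real (Suc N)\<rceil> - 1..\<lceil>r * real (Suc N)\<rceil> + 1}"

definition riemann_sum :: "nat \<Rightarrow> L2 \<Rightarrow> L2" where
  "riemann_sum N v = (\<Sum>i\<in>cells N. scaleC (of_real (of_int i / real (Suc N))) (E (cell N i) v))"

lemma cell_borel: "cell N i \<in> sets borel"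
proof -
  have "{s \<in> space borel. \<lfloor>s * real (Suc N)\<rfloor> = i} \<in> sets borel" by measurable
  then have "C \<inter> {s. \<lfloor>s * real (Suc N)\<rfloor> = i} \<in> sets borel" using C by auto
  then show ?thesis by (simp add: cell_def Collect_conj_eq)
qed

lemma riemann_sum_add: "riemann_sum N (f + g) = riemann_sum N f + riemann_sum N g"
  by (simp add: riemann_sum_def E_add cell_borel scaleC_add_right sum.distrib)

lemma riemann_sum_scaleC: "riemann_sum N (scaleC c f) = scaleC c (riemann_sum N f)"
  by (simp add: riemann_sum_def E_scaleC cell_borel scaleC_scaleC L2_complex.scale_sum_right mult.commute)

lemma riemann_sum_sym: "cinner (riemann_sum N f) g = cinner f (riemann_sum N g)"
  by (simp add: riemann_sum_def cinner_sum_left cinner_sum_right cinner_scaleC_left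
      cinner_scaleC_right E_sym cell_borel)

lemma sum_cells:
  "\<bar>(\<Sum>i\<in>cells N. of_int i / real (Suc N) * indicat_real (cell N i) s) - indicat_real C s * s\<bar> \<le> 1 / real (Suc N)"
proof (cases "s \<in> C")
  case False
  then show ?thesis by (simp add: cell_def)
next
  case True
  define n where "n = real (Suc N)"
  let ?n = n and ?j = "\<lfloor>s * n\<rfloor>"
  have "n > 0" by (simp add: n_def)
  have "- r \<le> s" "s \<le> r" using True Cr by auto
  then have "- (r * ?n) \<le> s * ?n" "s * ?n \<le> r * ?n"
    using mult_right_mono[of "-r" s ?n] mult_right_mono[of s r ?n] \<open>n > 0\<close> by simp_all
  then have "- \<lceil>r * n\<rceil> - 1 \<le> ?j" "?j \<le> \<lceil>r * n\<rceil> + 1" by linarith+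
  then have j: "?j \<in> cells N" by (simp add: cells_def n_def)
  have "(\<Sum>i\<in>cells N. of_int i / ?n * indicat_real (cell N i) s)
      = (\<Sum>i\<in>cells N. if i = ?j then of_int i / ?n else 0)"
    using True by (intro sum.cong) (auto simp: cell_def n_def)
  also have "\<dots> = of_int ?j / ?n"
    using j by (subst sum.delta) (auto simp: cells_def)
  finally have eq: "(\<Sum>i\<in>cells N. of_int i / ?n * indicat_real (cell N i) s) = of_int ?j / ?n" .
  have "of_int ?j / ?n - s = (of_int ?j - s * ?n) / ?n"
    using \<open>n > 0\<close> by (simp add: diff_divide_distrib)
  moreover have "\<bar>of_int ?j - s * ?n\<bar> \<le> 1" by linarith
  ultimately have "\<bar>of_int ?j / ?n - s\<bar> \<le> 1 / ?n"
    using \<open>n > 0\<close> by (simp add: divide_right_mono)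
  then show ?thesis using True eq by (simp add: n_def)
qed

lemma integrable_bounded_part: "integrable (\<mu> v) (\<lambda>s. indicat_real C s * s)"
proof -
  interpret finite_measure "\<mu> v" by (rule finite_measure_scalar_measure)
  show ?thesis
    by (rule integrable_const_bound[of _ "\<bar>r\<bar>"])
       (use C Cr in \<open>auto intro!: AE_I2 simp: abs_le_iff split: split_indicator\<close>)
qed

lemma riemann_sum_form:
  "\<bar>Re (cinner (riemann_sum N v) v) - (LINT s|\<mu> v. indicat_real C s * s)\<bar> \<le> (norm v)\<^sup>2 / real (Suc N)"
proof -
  interpret finite_measure "\<mu> v" by (rule finite_measure_scalar_measure)
  let ?S = "\<lambda>s. \<Sum>i\<in>cells N. of_int i / real (Suc N) * indicat_real (cell N i) s"
  have int_cell: "integrable (\<mu> v) (indicat_real (cell N i))" for i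
    using cell_borel by (intro integrable_real_indicator) (auto simp: emeasure_scalar_measure)
  have int_S: "integrable (\<mu> v) ?S"
    by (intro Bochner_Integration.integrable_sum integrable_mult_right int_cell)
  have "Re (cinner (riemann_sum N v) v) = (\<Sum>i\<in>cells N. of_int i / real (Suc N) * measure (\<mu> v) (cell N i))"
    by (simp add: riemann_sum_def cinner_sum_left cinner_scaleC_left cinner_E_eq_norm cell_borel
        measure_scalar_measure del: of_real_divide of_nat_Suc)
  also have "\<dots> = (LINT s|\<mu> v. ?S s)"
    using int_cell by (subst Bochner_Integration.integral_sum) (auto simp: cell_borel)
  finally have "Re (cinner (riemann_sum N v) v) - (LINT s|\<mu> v. indicat_real C s * s)
      = (LINT s|\<mu> v. ?S s - indicat_real C s * s)"
    using int_S integrable_bounded_part by (simp add: Bochner_Integration.integral_diff)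
  also have "\<bar>\<dots>\<bar> \<le> (LINT s|\<mu> v. \<bar>?S s - indicat_real C s * s\<bar>)"
    by (rule integral_abs_bound)
  also have "\<dots> \<le> (LINT s|\<mu> v. 1 / real (Suc N))"
    by (intro integral_mono sum_cells integrable_abs Bochner_Integration.integrable_diff int_S integrable_bounded_part) simp
  also have "\<dots> = (norm v)\<^sup>2 / real (Suc N)"
    by (simp add: measure_scalar_measure E_UNIV)
  finally show ?thesis .
qed

text \<open>This is \<open>spectral_form\<close> with the integrand cut off outside
  \<open>C\<close>. It makes sense for every \<open>h\<close>, not only for those in the domain, and
  so can be tested against arbitrary vectors in the Cauchy estimate.\<close>

definition bounded_form :: "L2 \<Rightarrow> L2 \<Rightarrow> complex" where
  "bounded_form f h =
    (\<Sum>k<4. \<i> ^ k * of_real (LINT s|\<mu> (f + scaleC (\<i> ^ k) h). indicat_real C s * s)) / 4"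

text \<open>Polarization carries the estimate from quadratic forms to pairs: each of the four
  vectors has norm at most \<open>norm f + norm h\<close>, and the division by 4 absorbs the number
  of terms.\<close>

lemma riemann_sum_bounded_form:
  "cmod (cinner (riemann_sum N f) h - bounded_form f h) \<le> (norm f + norm h)\<^sup>2 / real (Suc N)"
proof -
  let ?v = "\<lambda>k::nat. f + scaleC (\<i> ^ k) h"
  have pol: "cinner (riemann_sum N f) h =
      (\<Sum>k<4. \<i> ^ k * of_real (Re (cinner (riemann_sum N (?v k)) (?v k)))) / 4"
    by (rule cinner_polarization) (rule riemann_sum_add riemann_sum_scaleC riemann_sum_sym)+
  have "cinner (riemann_sum N f) h - bounded_form f h =
      (\<Sum>k<4. \<i> ^ k * of_real (Re (cinner (riemann_sum N (?v k)) (?v k)) -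
         (LINT s|\<mu> (?v k). indicat_real C s * s))) / 4"
    unfolding bounded_form_def pol
    by (simp add: diff_divide_distrib sum_subtractf right_diff_distrib)
  also have "cmod \<dots> \<le> (\<Sum>k<4::nat. (norm f + norm h)\<^sup>2 / real (Suc N)) / 4"
  proof -
    have "cmod (\<Sum>k<4. \<i> ^ k * of_real (Re (cinner (riemann_sum N (?v k)) (?v k)) -
         (LINT s|\<mu> (?v k). indicat_real C s * s))) \<le> (\<Sum>k<4::nat. (norm f + norm h)\<^sup>2 / real (Suc N))"
    proof (rule sum_norm_le)
      fix k :: nat
      have "cmod (\<i> ^ k * of_real (Re (cinner (riemann_sum N (?v k)) (?v k)) -
         (LINT s|\<mu> (?v k). indicat_real C s * s))) \<le> (norm (?v k))\<^sup>2 / real (Suc N)"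
        unfolding norm_mult norm_power norm_of_real using riemann_sum_form[of N "?v k"] by simp
      also have "\<dots> \<le> (norm f + norm h)\<^sup>2 / real (Suc N)"
        using norm_triangle_ineq[of f "scaleC (\<i> ^ k) h"]
        by (intro divide_right_mono power_mono) (auto simp: norm_scaleC norm_power)
      finally show "cmod (\<i> ^ k * of_real (Re (cinner (riemann_sum N (?v k)) (?v k)) -
         (LINT s|\<mu> (?v k). indicat_real C s * s))) \<le> (norm f + norm h)\<^sup>2 / real (Suc N)" .
    qed
    then show ?thesis unfolding norm_divide norm_numeral by (rule divide_right_mono) simp
  qed
  also have "\<dots> = (norm f + norm h)\<^sup>2 / real (Suc N)"
    by (simp del: of_nat_Suc)
  finally show ?thesis .
qed

lemma riemann_sum_converges: "convergent (\<lambda>N. riemann_sum N f)"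
proof (rule L2_Cauchy_convergent, rule metric_CauchyI)
  define K where "K = (norm f + 1)\<^sup>2"
  have K: "K > 0" unfolding K_def by (intro zero_less_power add_nonneg_pos) simp_all
  have le: "norm (riemann_sum M f - riemann_sum N f) \<le> K / real (Suc M) + K / real (Suc N)" for M N
  proof (cases "riemann_sum M f = riemann_sum N f")
    case True
    then show ?thesis using K by simp
  next
    case False
    define w where "w = riemann_sum M f - riemann_sum N f"
    \<comment> \<open>Duality: the norm of the difference \<open>w\<close> is its inner product with
      the unit vector \<open>h\<close> along \<open>w\<close>. On unit vectors the distance to
      \<open>bounded_form\<close> is at most \<open>K / real (Suc N)\<close>, uniformly.\<close>
    define h where "h = scaleC (of_real (1 / norm w)) w"
    have w: "norm w > 0" using False by (simp add: w_def)
    have h: "norm h = 1" using w by (simp add: h_def norm_scaleC norm_divide)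
    have "Im (cinner w w) = 0"
      using arg_cong[OF cinner_commute[of w w], of Im] by simp
    then have "cinner w w = of_real ((norm w)\<^sup>2)"
      by (simp add: power2_norm_L2 complex_eq_iff)
    then have "cinner w h = of_real (norm w)"
      using w by (simp add: h_def cinner_scaleC_right power2_eq_square)
    then have "norm w = cmod (cinner w h)" by simp
    also have "cinner w h = (cinner (riemann_sum M f) h - bounded_form f h) - (cinner (riemann_sum N f) h - bounded_form f h)"
      by (simp add: w_def cinner_diff_left)
    also have "cmod \<dots> \<le> cmod (cinner (riemann_sum M f) h - bounded_form f h) + cmod (cinner (riemann_sum N f) h - bounded_form f h)"
      by (rule norm_triangle_ineq4)
    also have "\<dots> \<le> K / real (Suc M) + K / real (Suc N)"
      using riemann_sum_bounded_form[of M f h] riemann_sum_bounded_form[of N f h] by (simp add: h K_def)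
    finally show ?thesis by (simp add: w_def)
  qed
  fix e :: real assume "e > 0"
  obtain n0 :: nat where n0: "real n0 > 2 * K / e" using reals_Archimedean2 by blast
  have small: "K / real (Suc n) < e / 2" if "n \<ge> n0" for n
  proof -
    have "2 * K / e < real (Suc n)" using n0 that by linarith
    then show ?thesis using \<open>e > 0\<close> by (simp add: field_simps)
  qed
  show "\<exists>M. \<forall>m\<ge>M. \<forall>n\<ge>M. dist (riemann_sum m f) (riemann_sum n f) < e"
  proof (intro exI[of _ n0] allI impI)
    fix m n assume "m \<ge> n0" "n \<ge> n0"
    then show "dist (riemann_sum m f) (riemann_sum n f) < e"
      unfolding dist_norm using le[of m n] small[of m] small[of n] by linarith
  qed
qed

text \<open>Outside \<open>C\<close> the vector f + i^k h is just i^k h, so its measure there is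
  that of \<open>h\<close> and the part of the integral lost by the cut-off is a constant
  independent of k. It cancels because the four powers of i sum to 0.\<close>

lemma bounded_form_eq_spectral_form:
  assumes f: "E C f = f" and h: "h \<in> spectral_domain E"
  shows "bounded_form f h = spectral_form E f h"
proof -
  have mC: "- C \<in> sets borel" using C by auto
  have f': "E (- C) f = 0"
    using E_orthogonal[of "- C" C f] C f by auto
  interpret finite_measure "\<mu> h" by (rule finite_measure_scalar_measure)
  have "integrable (\<mu> h) (\<lambda>s. 1 + s\<^sup>2)"
    using h by (simp add: spectral_domain_def)
  then have "integrable (\<mu> h) (\<lambda>s. s)"
  proof (rule Bochner_Integration.integrable_bound)
    have "\<bar>s\<bar> \<le> 1 + s\<^sup>2" for s :: real
      using zero_le_power2[of "\<bar>s\<bar> - 1"] by (simp add: power2_diff)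
    then show "AE s in \<mu> h. norm s \<le> norm (1 + s\<^sup>2)" by simp
  qed simp
  then have "integrable (\<mu> h) (\<lambda>s. indicat_real (- C) s *\<^sub>R s)"
    by (rule integrable_mult_indicator[rotated]) (use C in auto)
  then have ih: "integrable (\<mu> (E (- C) h)) (\<lambda>s. s)"
    by (subst integrable_scalar_measure_E[OF mC]) auto
  have id_meas: "(\<lambda>s::real. s) \<in> borel_measurable borel" by simp
  define c where "c = (LINT s|\<mu> (E (- C) h). s)"
  have "(LINT s|\<mu> (f + scaleC (\<i> ^ k) h). s) = (LINT s|\<mu> (f + scaleC (\<i> ^ k) h). indicat_real C s * s) + c" for k
  proof -
    let ?v = "f + scaleC (\<i> ^ k) h"
    have eq: "\<mu> (E (- C) ?v) = \<mu> (E (- C) h)"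
      using mC by (simp add: E_add E_scaleC f' scalar_measure_scaleC norm_power)
    have i2: "integrable (\<mu> ?v) (\<lambda>s. indicat_real (- C) s * s)"
      using ih integrable_scalar_measure_E[OF mC id_meas, of ?v] unfolding eq by (rule iffD1[rotated])
    have c: "(LINT s|\<mu> ?v. indicat_real (- C) s * s) = c"
      using integral_scalar_measure_E[OF mC id_meas, of ?v] unfolding eq c_def by (rule sym)
    have "(LINT s|\<mu> ?v. s) = (LINT s|\<mu> ?v. indicat_real C s * s + indicat_real (- C) s * s)"
      by (intro Bochner_Integration.integral_cong) (auto split: split_indicator)
    also have "\<dots> = (LINT s|\<mu> ?v. indicat_real C s * s) + c"
      using i2 integrable_bounded_part c by (simp add: Bochner_Integration.integral_add)
    finally show ?thesis .
  qed
  then have "spectral_form E f h = bounded_form f h + (\<Sum>k<4. \<i> ^ k * of_real c) / 4"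
    unfolding spectral_form_def bounded_form_def
    by (simp only: of_real_add distrib_left sum.distrib add_divide_distrib)
  also have "(\<Sum>k<4. \<i> ^ k * of_real c) = 0"
    by (simp add: eval_nat_numeral lessThan_Suc)
  finally show ?thesis by simp
qed

lemma E_bounded_in_domain:
  assumes f: "E C f = f"
  shows "\<exists>g. (f, g) \<in> spectral_integral E"
proof -
  obtain g where g: "(\<lambda>N. riemann_sum N f) \<longlonglongrightarrow> g"
    using riemann_sum_converges by (auto simp: convergent_def)
  have "f \<in> spectral_domain E"
  proof -
    interpret finite_measure "\<mu> f" by (rule finite_measure_scalar_measure)
    have "integrable (\<mu> f) (\<lambda>s. indicat_real C s * s\<^sup>2)"
    proof (rule integrable_const_bound[of _ "r\<^sup>2"])
      show "AE s in \<mu> f. norm (indicat_real C s * s\<^sup>2) \<le> r\<^sup>2"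
      proof (rule AE_I2)
        fix s
        have "s\<^sup>2 \<le> r\<^sup>2" if "s \<in> C"
          using Cr that by (intro power2_le_iff_abs_le[THEN iffD2]) (auto simp: abs_le_iff)
        then show "norm (indicat_real C s * s\<^sup>2) \<le> r\<^sup>2" by (simp split: split_indicator)
      qed
    qed (use C in simp)
    then have "integrable (\<mu> (E C f)) (\<lambda>s. s\<^sup>2)"
      using C by (simp add: integrable_scalar_measure_E)
    then show ?thesis by (simp add: f spectral_domain_def)
  qed
  moreover have "cinner g h = spectral_form E f h" if h: "h \<in> spectral_domain E" for h
  proof -
    have "(\<lambda>N. cinner (riemann_sum N f) h - bounded_form f h) \<longlonglongrightarrow> 0"
    proof (rule Lim_null_comparison)
      show "\<forall>\<^sub>F N in sequentially. cmod (cinner (riemann_sum N f) h - bounded_form f h)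
          \<le> (norm f + norm h)\<^sup>2 * inverse (real (Suc N))"
        using riemann_sum_bounded_form[of _ f h] by (simp add: divide_inverse)
      show "(\<lambda>N. (norm f + norm h)\<^sup>2 * inverse (real (Suc N))) \<longlonglongrightarrow> 0"
        by (rule tendsto_mult_right_zero[OF LIMSEQ_inverse_real_of_nat])
    qed
    then have "(\<lambda>N. cinner (riemann_sum N f) h) \<longlonglongrightarrow> bounded_form f h"
      by (simp add: LIM_zero_iff)
    with tendsto_cinner_left[OF g] have "cinner g h = bounded_form f h"
      by (rule LIMSEQ_unique)
    then show ?thesis using bounded_form_eq_spectral_form[OF f h] by simp
  qed
  ultimately show ?thesis by (auto simp: spectral_integral_def)
qed

end

end

section \<open>Linear algebra\<close>

text \<open>Gaussian elimination, one equation at a time. It serves both bounds with exchanged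
  roles: in the lower bound \<open>K\<close> indexes the unknowns, in the upper bound the
  equations.\<close>

lemma homogeneous_system_nontrivial:
  fixes a :: "'i \<Rightarrow> 'k \<Rightarrow> 'f::field"
  assumes "finite K" "finite B" "card K < card B"
  shows "\<exists>c. (\<exists>i\<in>B. c i \<noteq> 0) \<and> (\<forall>k\<in>K. (\<Sum>i\<in>B. c i * a i k) = 0)"
  using assms
proof (induction K arbitrary: B a rule: finite_induct)
  case empty
  then have "B \<noteq> {}" by auto
  then show ?case by (intro exI[of _ "\<lambda>_. 1"]) auto
next
  case (insert k K)
  show ?case
  proof (cases "\<forall>i\<in>B. a i k = 0")
    case True
    obtain c where "\<exists>i\<in>B. c i \<noteq> 0" "\<forall>k\<in>K. (\<Sum>i\<in>B. c i * a i k) = 0"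
      using insert.IH[of B a] insert.prems insert.hyps by auto
    then show ?thesis using True by (intro exI[of _ c]) auto
  next
    case False
    then obtain j where j: "j \<in> B" "a j k \<noteq> 0" by blast
    define B' where "B' = B - {j}"
    have fin: "finite B'" and B: "B = insert j B'" and jB': "j \<notin> B'"
      using insert.prems j by (auto simp: B'_def)
    have "card K < card B'"
      using insert.prems insert.hyps fin jB' by (simp add: B)
    then obtain c where c: "\<exists>i\<in>B'. c i \<noteq> 0"
        "\<forall>l\<in>K. (\<Sum>i\<in>B'. c i * (a i l - a i k / a j k * a j l)) = 0"
      using insert.IH[of B' "\<lambda>i l. a i l - a i k / a j k * a j l"] fin by blast
    \<comment> \<open>The pivot unknown is solved from equation \<open>k\<close>; the induction
      hypothesis was applied to the coefficients that remain after this substitution.\<close>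
    define d where "d i = (if i = j then - (\<Sum>i\<in>B'. c i * a i k) / a j k else c i)" for i
    have split: "(\<Sum>i\<in>B. d i * a i l) = - (\<Sum>i\<in>B'. c i * a i k) / a j k * a j l + (\<Sum>i\<in>B'. c i * a i l)" for l
    proof -
      have "(\<Sum>i\<in>B'. d i * a i l) = (\<Sum>i\<in>B'. c i * a i l)"
        using jB' by (intro sum.cong) (auto simp: d_def)
      then show ?thesis using fin jB' by (simp add: B d_def)
    qed
    show ?thesis
    proof (intro exI[of _ d] conjI ballI)
      show "\<exists>i\<in>B. d i \<noteq> 0"
        using c(1) jB' by (auto simp: B d_def)
    next
      fix l assume l: "l \<in> insert k K"
      show "(\<Sum>i\<in>B. d i * a i l) = 0"
      proof (cases "l = k")
        case True
        then show ?thesis using j by (simp add: split)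
      next
        case False
        from False have "(\<Sum>i\<in>B'. c i * (a i l - a i k / a j k * a j l)) = 0"
          using l c(2) by blast
        moreover have "(\<Sum>i\<in>B'. c i * (a i k / a j k * a j l)) = (\<Sum>i\<in>B'. c i * a i k) / a j k * a j l"
          unfolding sum_divide_distrib sum_distrib_right by (intro sum.cong) (simp_all add: mult_ac)
        ultimately show ?thesis
          unfolding split by (simp add: right_diff_distrib sum_subtractf)
      qed
    qed
  qed
qed

text \<open>Refuting small spanning sets spares a proof that the projected bumps are independent,
  and for a space without finite spanning set the value is infinite anyway.\<close>

lemma complex_dim_ge:
  assumes V: "L2_complex.subspace V"
    and dep: "\<And>b. finite b \<Longrightarrow> card b < m \<Longrightarrow> V \<subseteq> L2_complex.span b \<Longrightarrow> False"
  shows "enat m \<le> complex_dim V"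
proof (cases "\<exists>B. finite B \<and> V \<subseteq> L2_complex.span B")
  case True
  then obtain B where B: "finite B" "V \<subseteq> L2_complex.span B" by blast
  obtain b where b: "b \<subseteq> V" "L2_complex.independent b" "V \<subseteq> L2_complex.span b" "card b = L2_complex.dim V"
    using L2_complex.basis_exists by blast
  have "finite b"
    using L2_complex.independent_span_bound[OF B(1) b(2)] b(1) B(2) by blast
  then have "m \<le> L2_complex.dim V"
    using dep[of b] b by fastforce
  then show ?thesis using True by (simp add: complex_dim_def)
next
  case False
  then show ?thesis unfolding complex_dim_def by (subst if_not_P) auto
qed

text \<open>The basis might be infinite a priori, and the hypothesis speaks of finite families; but
  \<open>m + 1\<close> of its elements would already contradict it.\<close>

lemma complex_dim_le:
  assumes "\<And>b. finite b \<Longrightarrow> b \<subseteq> V \<Longrightarrow> L2_complex.independent b \<Longrightarrow> card b \<le> m"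
  shows "complex_dim V \<le> enat m"
proof -
  obtain b where b: "b \<subseteq> V" "L2_complex.independent b" "V \<subseteq> L2_complex.span b" "card b = L2_complex.dim V"
    using L2_complex.basis_exists by blast
  have "finite b"
  proof (rule ccontr)
    assume "infinite b"
    then obtain b' where b': "b' \<subseteq> b" "finite b'" "card b' = Suc m"
      using infinite_arbitrarily_large by blast
    then have "card b' \<le> m"
      using assms[of b'] b L2_complex.independent_mono by blast
    then show False using b' by simp
  qed
  then have "L2_complex.dim V \<le> m"
    using assms[of b] b by simp
  then show ?thesis using \<open>finite b\<close> b(3) by (auto simp: complex_dim_def)
qed

lemma independent_sum_eq_0:
  assumes "L2_complex.independent b" "finite b" "(\<Sum>v\<in>b. scaleC (c v) v) = 0" "v \<in> b"
  shows "c v = 0"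
  using L2_complex.independentD[OF assms(1,2) order_refl assms(3,4)] .

section \<open>The quadratic form of the operator with delta-interactions\<close>

lemma square_integrable_cong_AE:
  assumes "square_integrable f" "AE t in lebesgue. f t = g t"
  shows "square_integrable g"
proof -
  have f[measurable]: "f \<in> borel_measurable lebesgue"
    using assms by (simp add: square_integrable_def)
  have g[measurable]: "g \<in> borel_measurable lebesgue"
    by (rule borel_measurable_AE[OF f assms(2)])
  have "integrable lebesgue (\<lambda>t. (cmod (g t))\<^sup>2)"
  proof (rule integrable_cong_AE_imp)
    show "integrable lebesgue (\<lambda>t. (cmod (f t))\<^sup>2)"
      using assms by (simp add: square_integrable_def)
    show "AE t in lebesgue. (cmod (f t))\<^sup>2 = (cmod (g t))\<^sup>2"
      using assms(2) by eventually_elim simp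
  qed measurable
  then show ?thesis by (simp add: square_integrable_def)
qed

section \<open>Closure properties of absolute continuity\<close>

lemma absolutely_continuous_on_add:
  assumes "absolutely_continuous_on a b f" "absolutely_continuous_on a b g"
  shows "absolutely_continuous_on a b (\<lambda>t. f t + g t)"
  unfolding absolutely_continuous_on_def
proof (intro allI impI)
  fix e :: real assume "e > 0"
  then have e: "e / 2 > 0" by simp
  obtain d1 where d1: "d1 > 0" "\<And>n (u :: nat \<Rightarrow> real) v. \<forall>i<n. a \<le> u i \<and> u i \<le> v i \<and> v i \<le> b \<Longrightarrow>
        disjoint_family_on (\<lambda>i. {u i<..<v i}) {..<n} \<Longrightarrow>
        (\<Sum>i<n. v i - u i) < d1 \<Longrightarrow> (\<Sum>i<n. cmod (f (v i) - f (u i))) < e / 2"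
    using assms(1)[unfolded absolutely_continuous_on_def, rule_format, OF e] by blast
  obtain d2 where d2: "d2 > 0" "\<And>n (u :: nat \<Rightarrow> real) v. \<forall>i<n. a \<le> u i \<and> u i \<le> v i \<and> v i \<le> b \<Longrightarrow>
        disjoint_family_on (\<lambda>i. {u i<..<v i}) {..<n} \<Longrightarrow>
        (\<Sum>i<n. v i - u i) < d2 \<Longrightarrow> (\<Sum>i<n. cmod (g (v i) - g (u i))) < e / 2"
    using assms(2)[unfolded absolutely_continuous_on_def, rule_format, OF e] by blast
  show "\<exists>d>0. \<forall>n (u :: nat \<Rightarrow> real) v. (\<forall>i<n. a \<le> u i \<and> u i \<le> v i \<and> v i \<le> b) \<longrightarrow>
        disjoint_family_on (\<lambda>i. {u i<..<v i}) {..<n} \<longrightarrow>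
        (\<Sum>i<n. v i - u i) < d \<longrightarrow> (\<Sum>i<n. cmod (f (v i) + g (v i) - (f (u i) + g (u i)))) < e"
  proof (intro exI[of _ "min d1 d2"] conjI allI impI)
    fix n and u v :: "nat \<Rightarrow> real"
    assume uv: "\<forall>i<n. a \<le> u i \<and> u i \<le> v i \<and> v i \<le> b"
      and disj: "disjoint_family_on (\<lambda>i. {u i<..<v i}) {..<n}"
      and small: "(\<Sum>i<n. v i - u i) < min d1 d2"
    have "(\<Sum>i<n. cmod (f (v i) + g (v i) - (f (u i) + g (u i))))
        \<le> (\<Sum>i<n. cmod (f (v i) - f (u i)) + cmod (g (v i) - g (u i)))"
      by (intro sum_mono) (simp add: add_diff_add norm_triangle_ineq)
    also have "\<dots> < e"
      using d1(2)[OF uv disj] d2(2)[OF uv disj] small by (simp add: sum.distrib)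
    finally show "(\<Sum>i<n. cmod (f (v i) + g (v i) - (f (u i) + g (u i)))) < e" .
  qed (use d1 d2 in auto)
qed

text \<open>One comparison of increments covers scalar multiples, conjugation, Lipschitz functions,
  and functions that agree with an absolutely continuous one on the interval.\<close>

lemma absolutely_continuous_on_bound:
  assumes ac: "absolutely_continuous_on a b f" and M: "M > 0"
    and le: "\<And>s t. s \<in> {a..b} \<Longrightarrow> t \<in> {a..b} \<Longrightarrow> cmod (g s - g t) \<le> M * cmod (f s - f t)"
  shows "absolutely_continuous_on a b g"
  unfolding absolutely_continuous_on_def
proof (intro allI impI)
  fix e :: real assume "e > 0"
  then have e: "e / M > 0" using M by simp
  obtain d where d: "d > 0" "\<And>n (u :: nat \<Rightarrow> real) v. \<forall>i<n. a \<le> u i \<and> u i \<le> v i \<and> v i \<le> b \<Longrightarrow>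
        disjoint_family_on (\<lambda>i. {u i<..<v i}) {..<n} \<Longrightarrow>
        (\<Sum>i<n. v i - u i) < d \<Longrightarrow> (\<Sum>i<n. cmod (f (v i) - f (u i))) < e / M"
    using ac[unfolded absolutely_continuous_on_def, rule_format, OF e] by blast
  show "\<exists>d>0. \<forall>n (u :: nat \<Rightarrow> real) v. (\<forall>i<n. a \<le> u i \<and> u i \<le> v i \<and> v i \<le> b) \<longrightarrow>
        disjoint_family_on (\<lambda>i. {u i<..<v i}) {..<n} \<longrightarrow>
        (\<Sum>i<n. v i - u i) < d \<longrightarrow> (\<Sum>i<n. cmod (g (v i) - g (u i))) < e"
  proof (intro exI[of _ d] conjI allI impI d)
    fix n and u v :: "nat \<Rightarrow> real"
    assume uv: "\<forall>i<n. a \<le> u i \<and> u i \<le> v i \<and> v i \<le> b"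
      and disj: "disjoint_family_on (\<lambda>i. {u i<..<v i}) {..<n}"
      and small: "(\<Sum>i<n. v i - u i) < d"
    have "(\<Sum>i<n. cmod (g (v i) - g (u i))) \<le> (\<Sum>i<n. M * cmod (f (v i) - f (u i)))"
      using uv by (intro sum_mono le) force+
    also have "\<dots> < e"
      using d(2)[OF uv disj small] M by (simp add: sum_distrib_left[symmetric] field_simps)
    finally show "(\<Sum>i<n. cmod (g (v i) - g (u i))) < e" .
  qed
qed

lemma absolutely_continuous_on_Lipschitz:
  assumes "M > 0" "\<And>s t. s \<in> {a..b} \<Longrightarrow> t \<in> {a..b} \<Longrightarrow> cmod (g s - g t) \<le> M * \<bar>s - t\<bar>"
  shows "absolutely_continuous_on a b g"
proof (rule absolutely_continuous_on_bound[OF _ assms(1)])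
  show "absolutely_continuous_on a b complex_of_real"
    unfolding absolutely_continuous_on_def
  proof (intro allI impI)
    fix e :: real assume "e > 0"
    then show "\<exists>d>0. \<forall>n (u :: nat \<Rightarrow> real) v. (\<forall>i<n. a \<le> u i \<and> u i \<le> v i \<and> v i \<le> b) \<longrightarrow>
        disjoint_family_on (\<lambda>i. {u i<..<v i}) {..<n} \<longrightarrow>
        (\<Sum>i<n. v i - u i) < d \<longrightarrow> (\<Sum>i<n. cmod (complex_of_real (v i) - complex_of_real (u i))) < e"
      by (intro exI[of _ e]) (auto simp flip: of_real_diff)
  qed
  show "cmod (g s - g t) \<le> M * cmod (complex_of_real s - complex_of_real t)"
    if "s \<in> {a..b}" "t \<in> {a..b}" for s t
    using assms(2)[OF that] by (simp flip: of_real_diff)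
qed

lemma absolutely_continuous_on_continuous:
  assumes "absolutely_continuous_on a b f"
  shows "continuous_on {a..b} f"
  unfolding continuous_on_iff
proof (intro ballI allI impI)
  fix s and e :: real assume s: "s \<in> {a..b}" and e: "e > 0"
  then obtain d where d: "d > 0" "\<And>n (u :: nat \<Rightarrow> real) v. \<forall>i<n. a \<le> u i \<and> u i \<le> v i \<and> v i \<le> b \<Longrightarrow>
        disjoint_family_on (\<lambda>i. {u i<..<v i}) {..<n} \<Longrightarrow>
        (\<Sum>i<n. v i - u i) < d \<Longrightarrow> (\<Sum>i<n. cmod (f (v i) - f (u i))) < e"
    using assms unfolding absolutely_continuous_on_def by blast
  have "dist (f t) (f s) < e" if t: "t \<in> {a..b}" "dist t s < d" for t
    using d(2)[of 1 "\<lambda>_. min s t" "\<lambda>_. max s t"] s t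
    by (cases "s \<le> t") (auto simp: dist_norm norm_minus_commute min_def max_def disjoint_family_on_def)
  then show "\<exists>d>0. \<forall>t\<in>{a..b}. dist t s < d \<longrightarrow> dist (f t) (f s) < e"
    using d(1) by blast
qed

lemma absolutely_continuous_on_mult:
  assumes f: "absolutely_continuous_on a b f" and g: "absolutely_continuous_on a b g"
  shows "absolutely_continuous_on a b (\<lambda>t. f t * g t)"
  unfolding absolutely_continuous_on_def
proof (intro allI impI)
  have "bounded (f ` {a..b})" "bounded (g ` {a..b})"
    using f g by (auto intro!: compact_imp_bounded compact_continuous_image absolutely_continuous_on_continuous)
  then obtain M1 M2 where M1: "\<And>t. t \<in> {a..b} \<Longrightarrow> cmod (f t) \<le> M1" and M2: "\<And>t. t \<in> {a..b} \<Longrightarrow> cmod (g t) \<le> M2"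
    unfolding bounded_iff by blast
  define M where "M = \<bar>M1\<bar> + \<bar>M2\<bar> + 1"
  have M: "M > 0" unfolding M_def by linarith
  have fM: "cmod (f t) \<le> M" and gM: "cmod (g t) \<le> M" if "t \<in> {a..b}" for t
    using M1[OF that] M2[OF that] unfolding M_def by linarith+
  fix e :: real assume "e > 0"
  then have e: "e / (2 * M) > 0" using M by simp
  obtain d1 where d1: "d1 > 0" "\<And>n (u :: nat \<Rightarrow> real) v. \<forall>i<n. a \<le> u i \<and> u i \<le> v i \<and> v i \<le> b \<Longrightarrow>
        disjoint_family_on (\<lambda>i. {u i<..<v i}) {..<n} \<Longrightarrow>
        (\<Sum>i<n. v i - u i) < d1 \<Longrightarrow> (\<Sum>i<n. cmod (f (v i) - f (u i))) < e / (2 * M)"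
    using f[unfolded absolutely_continuous_on_def, rule_format, OF e] by blast
  obtain d2 where d2: "d2 > 0" "\<And>n (u :: nat \<Rightarrow> real) v. \<forall>i<n. a \<le> u i \<and> u i \<le> v i \<and> v i \<le> b \<Longrightarrow>
        disjoint_family_on (\<lambda>i. {u i<..<v i}) {..<n} \<Longrightarrow>
        (\<Sum>i<n. v i - u i) < d2 \<Longrightarrow> (\<Sum>i<n. cmod (g (v i) - g (u i))) < e / (2 * M)"
    using g[unfolded absolutely_continuous_on_def, rule_format, OF e] by blast
  show "\<exists>d>0. \<forall>n (u :: nat \<Rightarrow> real) v. (\<forall>i<n. a \<le> u i \<and> u i \<le> v i \<and> v i \<le> b) \<longrightarrow>
        disjoint_family_on (\<lambda>i. {u i<..<v i}) {..<n} \<longrightarrow>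
        (\<Sum>i<n. v i - u i) < d \<longrightarrow> (\<Sum>i<n. cmod (f (v i) * g (v i) - f (u i) * g (u i))) < e"
  proof (intro exI[of _ "min d1 d2"] conjI allI impI)
    fix n and u v :: "nat \<Rightarrow> real"
    assume uv: "\<forall>i<n. a \<le> u i \<and> u i \<le> v i \<and> v i \<le> b"
      and disj: "disjoint_family_on (\<lambda>i. {u i<..<v i}) {..<n}"
      and small: "(\<Sum>i<n. v i - u i) < min d1 d2"
    have le: "cmod (f t * g t - f s * g s) \<le> M * (cmod (f t - f s) + cmod (g t - g s))"
      if "s \<in> {a..b}" "t \<in> {a..b}" for s t
    proof -
      have "f t * g t - f s * g s = (f t - f s) * g t + f s * (g t - g s)" by (simp add: algebra_simps)
      also have "cmod \<dots> \<le> cmod (f t - f s) * cmod (g t) + cmod (f s) * cmod (g t - g s)"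
        by (metis norm_mult norm_triangle_ineq)
      also have "\<dots> \<le> cmod (f t - f s) * M + M * cmod (g t - g s)"
        using M fM gM that by (intro add_mono mult_mono) auto
      finally show ?thesis by (simp add: algebra_simps)
    qed
    have "(\<Sum>i<n. cmod (f (v i) * g (v i) - f (u i) * g (u i)))
        \<le> (\<Sum>i<n. M * (cmod (f (v i) - f (u i)) + cmod (g (v i) - g (u i))))"
      using uv by (intro sum_mono le) force+
    also have "\<dots> = M * ((\<Sum>i<n. cmod (f (v i) - f (u i))) + (\<Sum>i<n. cmod (g (v i) - g (u i))))"
      by (simp add: sum.distrib sum_distrib_left distrib_left)
    also have "\<dots> < M * (e / (2 * M) + e / (2 * M))"
      using d1(2)[OF uv disj] d2(2)[OF uv disj] small M by (intro mult_strict_left_mono add_strict_mono) auto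
    also have "\<dots> = e" using M by simp
    finally show "(\<Sum>i<n. cmod (f (v i) * g (v i) - f (u i) * g (u i))) < e" .
  qed (use d1 d2 in auto)
qed

lemma integral_ge_on_interval:
  fixes u :: "real \<Rightarrow> real"
  assumes u: "integrable lebesgue u" and "\<And>t. 0 \<le> u t" and "AE t in lebesgue. t \<in> {a..b} \<longrightarrow> \<eta> \<le> u t"
    and "a \<le> b"
  shows "\<eta> * (b - a) \<le> (LINT t|lebesgue. u t)"
proof -
  have "(LINT t|lebesgue. \<eta> * indicator {a..b} t) \<le> (LINT t|lebesgue. u t)"
  proof (rule integral_mono_AE)
    show "integrable lebesgue (\<lambda>t. \<eta> * indicat_real {a..b} t)"
      by (intro integrable_mult_right integrable_real_indicator) (auto simp: emeasure_lborel_Icc_eq)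
    show "AE t in lebesgue. \<eta> * indicator {a..b} t \<le> u t"
      using assms(3) by eventually_elim (auto simp: assms(2) split: split_indicator)
  qed (rule u)
  then show ?thesis using \<open>a \<le> b\<close> by simp
qed

text \<open>Together with monotonicity, unboundedness makes the set of points locally finite. It is
  extracted from the positive infimum of the gaps.\<close>

locale interaction_points =
  fixes x :: "nat \<Rightarrow> real"
  assumes mono_x: "strict_mono_on {1..} x" and unbounded_x: "\<And>b. \<exists>k\<ge>1. b < x k"
begin

definition X :: "real set" where "X = x ` {1..}"

section \<open>Local finiteness of the interaction points\<close>

lemma x_less_iff: "1 \<le> j \<Longrightarrow> 1 \<le> k \<Longrightarrow> x j < x k \<longleftrightarrow> j < k"
  using strict_mono_on_less[OF mono_x, of j k] by simp

lemma x_eq_iff: "1 \<le> j \<Longrightarrow> 1 \<le> k \<Longrightarrow> x j = x k \<longleftrightarrow> j = k"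
  using x_less_iff[of j k] x_less_iff[of k j] by (metis less_irrefl linorder_neqE_nat)

lemma finite_X_atMost: "finite (X \<inter> {..b})"
proof -
  obtain n where n: "n \<ge> 1" "b < x n" using unbounded_x by blast
  have "X \<inter> {..b} \<subseteq> x ` {..n}"
  proof
    fix t assume "t \<in> X \<inter> {..b}"
    then obtain k where k: "k \<ge> 1" "t = x k" "x k \<le> b" by (auto simp: X_def)
    then have "k < n" using x_less_iff[of k n] n by simp
    then show "t \<in> x ` {..n}" using k by auto
  qed
  then show ?thesis by (rule finite_subset) simp
qed

lemma X_isolated:
  obtains e where "e > 0" "\<And>s. s \<noteq> t \<Longrightarrow> \<bar>s - t\<bar> < e \<Longrightarrow> s \<notin> X"
proof -
  obtain d where d: "d > 0 \<and> (\<forall>s\<in>X \<inter> {..t + 1}. s \<noteq> t \<longrightarrow> d \<le> dist t s)"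
    using finite_set_avoid[OF finite_X_atMost] by (rule exE)
  show ?thesis
  proof (rule that[of "min d 1"])
    fix s assume s: "s \<noteq> t" "\<bar>s - t\<bar> < min d 1"
    show "s \<notin> X"
    proof
      assume "s \<in> X"
      then have "s \<in> X \<inter> {..t + 1}" using s by auto
      then have "d \<le> dist t s" using d s by blast
      then show False using s by (simp add: dist_real_def abs_minus_commute)
    qed
  qed (use d in auto)
qed

lemma open_Compl_X: "open (- X)"
  unfolding open_dist
proof
  fix t assume t: "t \<in> - X"
  obtain e where "e > 0" "\<And>s. s \<noteq> t \<Longrightarrow> \<bar>s - t\<bar> < e \<Longrightarrow> s \<notin> X"
    using X_isolated[of t] by blast
  then show "\<exists>e>0. \<forall>s. dist s t < e \<longrightarrow> s \<in> - X"
    using t by (metis ComplI ComplD dist_real_def)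
qed

lemma AE_not_X: "AE t in lebesgue. t \<notin> X"
proof -
  have "countable X" by (simp add: X_def)
  then have "X \<in> null_sets lebesgue" 
    using countable_imp_null_set_lborel null_sets_completionI by blast
  then show ?thesis by (rule AE_not_in)
qed

lemma not_X_between: "a < b \<Longrightarrow> \<exists>t. a < t \<and> t < b \<and> t \<notin> X"
proof -
  assume "a < b"
  obtain e where "e > 0" "\<And>s. s \<noteq> a \<Longrightarrow> \<bar>s - a\<bar> < e \<Longrightarrow> s \<notin> X"
    using X_isolated[of a] by blast
  then show ?thesis
    using \<open>a < b\<close> by (intro exI[of _ "a + min (e/2) ((b - a)/2)"]) (auto simp: min_def field_simps)
qed

lemma eventually_right_not_X: "\<forall>\<^sub>F s in at_right t. s \<notin> X"
  and eventually_left_not_X: "\<forall>\<^sub>F s in at_left t. s \<notin> X"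
proof -
  obtain e where e: "e > 0" "\<And>s. s \<noteq> t \<Longrightarrow> \<bar>s - t\<bar> < e \<Longrightarrow> s \<notin> X"
    using X_isolated[of t] by blast
  have "\<forall>\<^sub>F s in at t. s \<notin> X"
    unfolding eventually_at using e by (intro exI[of _ e]) (auto simp: dist_real_def)
  then show "\<forall>\<^sub>F s in at_right t. s \<notin> X" "\<forall>\<^sub>F s in at_left t. s \<notin> X"
    by (simp_all add: eventually_at_split)
qed

text \<open>A function that increases between the points of \<open>X\<close> and jumps upwards at
  them increases; the proof inserts one point of \<open>X\<close> at a time. Only one-sided limits
  at \<open>X\<close> are seen, which suits functions whose values on \<open>X\<close> are
  arbitrary. Each estimate below is an instance for a suitable \<open>G\<close>.\<close>

lemma mono_off_X:
  fixes G :: "real \<Rightarrow> real"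
  assumes "a \<le> b" "a \<notin> X" "b \<notin> X"
    and pieces: "\<And>u v. u \<le> v \<Longrightarrow> {u..v} \<subseteq> - X \<Longrightarrow> {u..v} \<subseteq> {a..b} \<Longrightarrow> G u \<le> G v"
    and jumps: "\<And>k. k \<ge> 1 \<Longrightarrow> a < x k \<Longrightarrow> x k < b \<Longrightarrow>
      \<exists>l r. (G \<longlongrightarrow> l) (at_left (x k)) \<and> (G \<longlongrightarrow> r) (at_right (x k)) \<and> l \<le> r"
  shows "G a \<le> G b"
  using assms
proof (induction "card (X \<inter> {a..b})" arbitrary: a b rule: less_induct)
  case less
  have fin: "finite (X \<inter> {a..b})"
    by (rule finite_subset[OF _ finite_X_atMost[of b]]) auto
  show ?case
  proof (cases "X \<inter> {a..b} = {}")
    case True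
    then show ?thesis using less.prems(1) by (intro less.prems(4)) auto
  next
    case False
    then obtain p where pX: "p \<in> X" and pab: "p \<in> {a..b}" by blast
    then obtain k where k: "k \<ge> 1" "p = x k" unfolding X_def by auto
    have "a \<noteq> p" "b \<noteq> p" using pX less.prems(2,3) by metis+
    then have p: "a < p" "p < b" using pab by auto
    obtain l r where lr: "(G \<longlongrightarrow> l) (at_left p)" "(G \<longlongrightarrow> r) (at_right p)" "l \<le> r"
      using less.prems(5)[of k] k p by blast
    obtain e where e: "e > 0" "\<And>s. s \<noteq> p \<Longrightarrow> \<bar>s - p\<bar> < e \<Longrightarrow> s \<notin> X"
      using X_isolated[of p] by blast
    \<comment> \<open>Small enough to keep other points of \<open>X\<close> away from
      \<open>p\<close> and to stay strictly inside the interval. On both sides of \<open>p\<close>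
      there remain fewer points of \<open>X\<close>, and the two limits at \<open>p\<close> link the
      halves.\<close>
    define e' where "e' = min (e/2) (min ((p - a)/2) ((b - p)/2))"
    have e': "e' > 0" "e' < e" "a < p - e'" "p + e' < b"
      using e p by (auto simp: e'_def min_def field_simps)
    define u v where "u = p - e'" and "v = p + e'"
    have uX: "s \<notin> X" if "u \<le> s" "s < p" for s
      using that e' by (intro e(2)) (auto simp: u_def)
    have vX: "s \<notin> X" if "p < s" "s \<le> v" for s
      using that e' by (intro e(2)) (auto simp: v_def)
    have pin: "p \<in> X \<inter> {a..b}" using pX pab by simp
    have "G u \<le> l"
    proof (rule tendsto_lowerbound[OF lr(1)])
      have "\<forall>\<^sub>F t in at_left p. t \<in> {u<..<p}"
        using e' by (intro eventually_at_leftI[of u]) (auto simp: u_def)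
      then show "\<forall>\<^sub>F t in at_left p. G u \<le> G t"
      proof eventually_elim
        case (elim t)
        then show ?case using uX e' p by (intro less.prems(4)) (auto simp: u_def subset_iff)
      qed
    qed simp
    moreover have "r \<le> G v"
    proof (rule tendsto_upperbound[OF lr(2)])
      have "\<forall>\<^sub>F t in at_right p. t \<in> {p<..<v}"
        using e' by (intro eventually_at_rightI[of _ v]) (auto simp: v_def)
      then show "\<forall>\<^sub>F t in at_right p. G t \<le> G v"
      proof eventually_elim
        case (elim t)
        then show ?case using vX e' p by (intro less.prems(4)) (auto simp: v_def subset_iff)
      qed
    qed simp
    moreover have "G a \<le> G u"
    proof (rule less.hyps)
      show "card (X \<inter> {a..u}) < card (X \<inter> {a..b})"
      proof (rule psubset_card_mono[OF fin])
        have "X \<inter> {a..u} \<subseteq> X \<inter> {a..b}" "p \<notin> X \<inter> {a..u}" using e' by (auto simp: u_def)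
        then show "X \<inter> {a..u} \<subset> X \<inter> {a..b}" using pin by blast
      qed
      show "u \<notin> X" by (rule uX) (use e' in \<open>auto simp: u_def\<close>)
      show "G s \<le> G t" if "s \<le> t" "{s..t} \<subseteq> - X" "{s..t} \<subseteq> {a..u}" for s t
        using that p e' by (intro less.prems(4)) (auto simp: u_def)
      show "\<exists>l r. (G \<longlongrightarrow> l) (at_left (x j)) \<and> (G \<longlongrightarrow> r) (at_right (x j)) \<and> l \<le> r"
        if "j \<ge> 1" "a < x j" "x j < u" for j
        using that p e' by (intro less.prems(5)) (auto simp: u_def)
    qed (use less.prems(1-3) e' in \<open>auto simp: u_def\<close>)
    moreover have "G v \<le> G b"
    proof (rule less.hyps)
      show "card (X \<inter> {v..b}) < card (X \<inter> {a..b})"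
      proof (rule psubset_card_mono[OF fin])
        have "X \<inter> {v..b} \<subseteq> X \<inter> {a..b}" "p \<notin> X \<inter> {v..b}" using e' by (auto simp: v_def)
        then show "X \<inter> {v..b} \<subset> X \<inter> {a..b}" using pin by blast
      qed
      show "v \<notin> X" by (rule vX) (use e' in \<open>auto simp: v_def\<close>)
      show "G s \<le> G t" if "s \<le> t" "{s..t} \<subseteq> - X" "{s..t} \<subseteq> {v..b}" for s t
        using that p e' by (intro less.prems(4)) (auto simp: v_def)
      show "\<exists>l r. (G \<longlongrightarrow> l) (at_left (x j)) \<and> (G \<longlongrightarrow> r) (at_right (x j)) \<and> l \<le> r"
        if "j \<ge> 1" "v < x j" "x j < b" for j
        using that p e' by (intro less.prems(5)) (auto simp: v_def)
    qed (use less.prems(1-3) e' in \<open>auto simp: v_def\<close>)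
    ultimately show ?thesis using lr(3) by linarith
  qed
qed

text \<open>The common one-sided limits are carried along as the sequence \<open>c\<close>, because
  the value of \<open>f\<close> at \<open>x k\<close> itself is arbitrary. They depend linearly on
  \<open>f\<close>, and the point conditions of the counting argument are linear equations in
  them.\<close>

definition delta_dom :: "(nat \<Rightarrow> real) \<Rightarrow> (real \<Rightarrow> complex) \<Rightarrow> (nat \<Rightarrow> complex) \<Rightarrow> bool" where
  "delta_dom \<alpha> f c \<longleftrightarrow> f \<in> W22 X \<and> (\<forall>k\<ge>1. \<exists>p q.
     (f \<longlongrightarrow> c k) (at_right (x k)) \<and> (f \<longlongrightarrow> c k) (at_left (x k)) \<and>
     (derivative f \<longlongrightarrow> p) (at_right (x k)) \<and> (derivative f \<longlongrightarrow> q) (at_left (x k)) \<and>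
     p - q = of_real (\<alpha> k) * c k)"

lemma delta_operator_iff:
  "delta_operator x \<alpha> =
     {(abs_L2 f, abs_L2 (\<lambda>t. - derivative (derivative f) t)) | f. \<exists>c. delta_dom \<alpha> f c}"
proof -
  define J where "J f k c \<longleftrightarrow> (\<exists>p q. (f \<longlongrightarrow> c) (at_right (x k)) \<and> (f \<longlongrightarrow> c) (at_left (x k)) \<and>
     (derivative f \<longlongrightarrow> p) (at_right (x k)) \<and> (derivative f \<longlongrightarrow> q) (at_left (x k)) \<and>
     p - q = of_real (\<alpha> k) * c)" for f k c
  have "delta_jump_conditions x \<alpha> f \<longleftrightarrow> (\<forall>k\<ge>1. \<exists>c. J f k c)" for f
    unfolding delta_jump_conditions_def J_def ..
  moreover have "delta_dom \<alpha> f c \<longleftrightarrow> f \<in> W22 X \<and> (\<forall>k\<ge>1. J f k (c k))" for f c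
    unfolding delta_dom_def J_def ..
  moreover have "(\<forall>k\<ge>1. \<exists>c. J f k c) \<longleftrightarrow> (\<exists>c. \<forall>k\<ge>1. J f k (c k))" for f
    by metis
  ultimately have "f \<in> W22 (x ` {1..}) \<and> delta_jump_conditions x \<alpha> f \<longleftrightarrow> (\<exists>c. delta_dom \<alpha> f c)" for f
    by (simp add: X_def)
  then show ?thesis unfolding delta_operator_def by simp
qed

section \<open>Linearity of the domain\<close>

lemma W22_D:
  assumes "f \<in> W22 X"
  shows "square_integrable f" "AC_loc (- X) f" "AC_loc (- X) (derivative f)"
    "square_integrable (derivative (derivative f))"
    "AE t in lebesgue. derivative f differentiable (at t)"
    "\<And>t. t \<notin> X \<Longrightarrow> (f has_vector_derivative derivative f t) (at t)"
  using assms by (auto simp: W22_def vector_derivative_works)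

lemma second_derivative_AE:
  assumes f: "f \<in> W22 X"
  shows "AE t in lebesgue. t \<notin> X \<and> (derivative f has_vector_derivative derivative (derivative f) t) (at t)"
  using AE_not_X W22_D(5)[OF f] by eventually_elim (simp add: vector_derivative_works)

text \<open>\<open>derivative\<close> is total and uncontrolled on \<open>X\<close>, so linearity is
  stated off \<open>X\<close> only. That set is open, hence the identity of first derivatives may be
  differentiated once more, at almost every point.\<close>

lemma derivative_combination:
  fixes f g :: "real \<Rightarrow> complex" and a b :: complex
  assumes "f \<in> W22 X" "g \<in> W22 X"
  defines "h \<equiv> \<lambda>t. a * f t + b * g t"
  shows "\<And>t. t \<notin> X \<Longrightarrow> (h has_vector_derivative a * derivative f t + b * derivative g t) (at t)"
    and "\<And>t. t \<notin> X \<Longrightarrow> derivative h t = a * derivative f t + b * derivative g t"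
    and "AE t in lebesgue. (derivative h has_vector_derivative
           a * derivative (derivative f) t + b * derivative (derivative g) t) (at t)"
proof -
  show 1: "(h has_vector_derivative a * derivative f t + b * derivative g t) (at t)" if "t \<notin> X" for t
    unfolding h_def
    using W22_D(6)[OF assms(1) that] W22_D(6)[OF assms(2) that]
    by (auto intro!: derivative_eq_intros)
  then show 2: "derivative h t = a * derivative f t + b * derivative g t" if "t \<notin> X" for t
    using that by (simp add: vector_derivative_at)
  show "AE t in lebesgue. (derivative h has_vector_derivative
           a * derivative (derivative f) t + b * derivative (derivative g) t) (at t)"
    using second_derivative_AE[OF assms(1)] second_derivative_AE[OF assms(2)]
  proof eventually_elim
    case (elim t)
    have "((\<lambda>s. a * derivative f s + b * derivative g s) has_vector_derivative
           a * derivative (derivative f) t + b * derivative (derivative g) t) (at t)"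
      using elim by (auto intro!: derivative_eq_intros)
    then show ?case
      by (rule has_vector_derivative_transform_within_open[OF _ open_Compl_X]) (use elim 2 in auto)
  qed
qed

lemma W22_combination:
  assumes f: "f \<in> W22 X" and g: "g \<in> W22 X"
  shows "(\<lambda>t. a * f t + b * g t) \<in> W22 X"
proof -
  define h where "h = (\<lambda>t. a * f t + b * g t)"
  note d = derivative_combination[OF f g, where a = a and b = b, folded h_def]
  have scale: "absolutely_continuous_on s t (\<lambda>y. k * F y)" if "absolutely_continuous_on s t F" for s t F and k :: complex
    by (rule absolutely_continuous_on_bound[OF that, of "cmod k + 1"])
       (auto simp: norm_mult mult_right_mono add_nonneg_pos simp flip: right_diff_distrib)
  have ac: "AC_loc (- X) (\<lambda>t. a * F t + b * G t)" if "AC_loc (- X) F" "AC_loc (- X) G" for F G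
    unfolding AC_loc_def
    by (intro allI impI absolutely_continuous_on_add scale) (use that in \<open>simp_all add: AC_loc_def\<close>)
  have "AC_loc (- X) (derivative h)"
    unfolding AC_loc_def
  proof (intro allI impI)
    fix s t assume st: "{s..t} \<subseteq> - X"
    have "absolutely_continuous_on s t (\<lambda>t. a * derivative f t + b * derivative g t)"
      using ac[OF W22_D(3)[OF f] W22_D(3)[OF g]] st by (auto simp: AC_loc_def)
    then show "absolutely_continuous_on s t (derivative h)"
    proof (rule absolutely_continuous_on_bound[of _ _ _ 1])
      fix p q assume "p \<in> {s..t}" "q \<in> {s..t}"
      then have "p \<notin> X" "q \<notin> X" using st by auto
      then show "cmod (derivative h p - derivative h q) \<le>
          1 * cmod (a * derivative f p + b * derivative g p - (a * derivative f q + b * derivative g q))"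
        by (simp add: d(2))
    qed simp
  qed
  moreover have "square_integrable (derivative (derivative h))"
  proof (rule square_integrable_cong_AE)
    show "square_integrable (\<lambda>t. a * derivative (derivative f) t + b * derivative (derivative g) t)"
      by (intro square_integrable_add square_integrable_scale W22_D f g)
    show "AE t in lebesgue. a * derivative (derivative f) t + b * derivative (derivative g) t = derivative (derivative h) t"
      using d(3) by eventually_elim (simp add: vector_derivative_at)
  qed
  moreover have "AE t in lebesgue. derivative h differentiable (at t)"
    using d(3) by eventually_elim (rule differentiableI_vector)
  moreover have "square_integrable h"
    unfolding h_def by (intro square_integrable_add square_integrable_scale W22_D f g)
  moreover have "AC_loc (- X) h"
    unfolding h_def by (intro ac W22_D f g)
  moreover have "h differentiable (at t)" if "t \<in> - X" for t
    using d(1)[of t] that by (auto intro: differentiableI_vector)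
  ultimately show ?thesis unfolding W22_def h_def[symmetric] by simp
qed

lemma delta_dom_combination:
  assumes f: "delta_dom \<alpha> f c" and g: "delta_dom \<alpha> g d"
  shows "delta_dom \<alpha> (\<lambda>t. a * f t + b * g t) (\<lambda>k. a * c k + b * d k)"
proof -
  have W: "f \<in> W22 X" "g \<in> W22 X" using f g by (auto simp: delta_dom_def)
  note dc = derivative_combination(2)[OF W, where a = a and b = b]
  show ?thesis
    unfolding delta_dom_def
  proof (intro conjI allI impI W22_combination W)
    fix k :: nat assume k: "k \<ge> 1"
    obtain p q where 1: "(f \<longlongrightarrow> c k) (at_right (x k))" "(f \<longlongrightarrow> c k) (at_left (x k))"
        "(derivative f \<longlongrightarrow> p) (at_right (x k))" "(derivative f \<longlongrightarrow> q) (at_left (x k))"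
        "p - q = of_real (\<alpha> k) * c k"
      using f k unfolding delta_dom_def by blast
    obtain p' q' where 2: "(g \<longlongrightarrow> d k) (at_right (x k))" "(g \<longlongrightarrow> d k) (at_left (x k))"
        "(derivative g \<longlongrightarrow> p') (at_right (x k))" "(derivative g \<longlongrightarrow> q') (at_left (x k))"
        "p' - q' = of_real (\<alpha> k) * d k"
      using g k unfolding delta_dom_def by blast
    have "(derivative (\<lambda>t. a * f t + b * g t) \<longlongrightarrow> a * p + b * p') (at_right (x k))"
    proof (rule Lim_transform_eventually)
      show "((\<lambda>t. a * derivative f t + b * derivative g t) \<longlongrightarrow> a * p + b * p') (at_right (x k))"
        by (intro tendsto_intros 1 2)
      show "\<forall>\<^sub>F t in at_right (x k). a * derivative f t + b * derivative g t = derivative (\<lambda>t. a * f t + b * g t) t"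
        using eventually_right_not_X by eventually_elim (simp add: dc)
    qed
    moreover have "(derivative (\<lambda>t. a * f t + b * g t) \<longlongrightarrow> a * q + b * q') (at_left (x k))"
    proof (rule Lim_transform_eventually)
      show "((\<lambda>t. a * derivative f t + b * derivative g t) \<longlongrightarrow> a * q + b * q') (at_left (x k))"
        by (intro tendsto_intros 1 2)
      show "\<forall>\<^sub>F t in at_left (x k). a * derivative f t + b * derivative g t = derivative (\<lambda>t. a * f t + b * g t) t"
        using eventually_left_not_X by eventually_elim (simp add: dc)
    qed
    moreover have "((\<lambda>t. a * f t + b * g t) \<longlongrightarrow> a * c k + b * d k) (at_right (x k))"
        "((\<lambda>t. a * f t + b * g t) \<longlongrightarrow> a * c k + b * d k) (at_left (x k))"
      by (intro tendsto_intros 1 2)+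
    moreover have "a * p + b * p' - (a * q + b * q') = of_real (\<alpha> k) * (a * c k + b * d k)"
    proof -
      have "a * p + b * p' - (a * q + b * q') = a * (p - q) + b * (p' - q')" by (simp add: algebra_simps)
      then show ?thesis by (simp add: 1 2 algebra_simps)
    qed
    ultimately show "\<exists>p q. ((\<lambda>t. a * f t + b * g t) \<longlongrightarrow> a * c k + b * d k) (at_right (x k)) \<and>
       ((\<lambda>t. a * f t + b * g t) \<longlongrightarrow> a * c k + b * d k) (at_left (x k)) \<and>
       (derivative (\<lambda>t. a * f t + b * g t) \<longlongrightarrow> p) (at_right (x k)) \<and>
       (derivative (\<lambda>t. a * f t + b * g t) \<longlongrightarrow> q) (at_left (x k)) \<and>
       p - q = of_real (\<alpha> k) * (a * c k + b * d k)"
      by blast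
  qed
qed

lemma delta_dom_zero: "delta_dom \<alpha> (\<lambda>_. 0) (\<lambda>_. 0)"
proof -
  have d: "derivative (\<lambda>_. 0 :: complex) = (\<lambda>_. 0)"
    by (rule ext) (rule vector_derivative_at, rule has_vector_derivative_const)
  have ac: "absolutely_continuous_on s t (\<lambda>_. 0)" for s t
    by (rule absolutely_continuous_on_Lipschitz[of 1]) auto
  have "(\<lambda>_. 0) \<in> W22 X"
    unfolding W22_def by (simp add: d ac AC_loc_def square_integrable_zero)
  then show ?thesis unfolding delta_dom_def by (auto simp: d)
qed

lemma delta_dom_sum:
  assumes "\<And>i. i \<in> I \<Longrightarrow> delta_dom \<alpha> (f i) (c i)"
  shows "delta_dom \<alpha> (\<lambda>t. \<Sum>i\<in>I. a i * f i t) (\<lambda>k. \<Sum>i\<in>I. a i * c i k)"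
  using assms
proof (induction I rule: infinite_finite_induct)
  case (insert i I)
  then show ?case
    using delta_dom_combination[of \<alpha> "f i" "c i" "\<lambda>t. \<Sum>i\<in>I. a i * f i t" "\<lambda>k. \<Sum>i\<in>I. a i * c i k" "a i" 1]
    by simp
qed (simp_all add: delta_dom_zero)

section \<open>Growth off \<open>X\<close> and jumps at \<open>X\<close> of the function W\<close>

definition boundary_term :: "(real \<Rightarrow> complex) \<Rightarrow> real \<Rightarrow> real" where
  "boundary_term f t = Re (derivative f t * cnj (f t))"

text \<open>Mind the sign: the operator is minus the second derivative, so the integral of this
  density is minus the real part of its form.\<close>

definition form_density :: "(real \<Rightarrow> complex) \<Rightarrow> real \<Rightarrow> real" where
  "form_density f t = Re (derivative (derivative f) t * cnj (f t))"

lemma integrable_form_density: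
  assumes "f \<in> W22 X"
  shows "integrable lebesgue (form_density f)"
  unfolding form_density_def
  using integrable_mult_cnj[OF W22_D(4)[OF assms] W22_D(1)[OF assms]] by (rule integrable_Re)

lemma form_density_integrable_on:
  assumes "f \<in> W22 X"
  shows "form_density f integrable_on {a..b}"
proof -
  have "form_density f absolutely_integrable_on UNIV"
    using integrable_form_density[OF assms] by (simp add: set_integrable_def)
  then have "form_density f integrable_on UNIV" "form_density f absolutely_integrable_on {a..b}"
    using set_lebesgue_integral_eq_integral(1) absolutely_integrable_on_subinterval
    by (blast, metis box_real(2) set_integrable_subset sets_completionI_sets sets_lborel lborelD subset_UNIV atLeastAtMost_borel)
  then show ?thesis using set_lebesgue_integral_eq_integral(1) by blast
qed

text \<open>The second derivative exists almost everywhere only, so the product f' cnj f calls for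
  the fundamental theorem for absolutely continuous functions.\<close>

lemma boundary_term_diff:
  assumes f: "f \<in> W22 X" and ab: "a \<le> b" "{a..b} \<subseteq> - X"
  shows "((\<lambda>t. form_density f t + (cmod (derivative f t))\<^sup>2) has_integral
           (boundary_term f b - boundary_term f a)) {a..b}"
proof -
  define N where "N = {t. \<not> (t \<notin> X \<and> (derivative f has_vector_derivative derivative (derivative f) t) (at t))}"
  have N: "negligible N"
    using second_derivative_AE[OF f]
    unfolding N_def negligible_iff_null_sets completion.AE_iff_null_sets
    by (simp only: space_completion space_lborel space_borel UNIV_I simp_thms)
  have "absolutely_continuous_on a b (\<lambda>t. derivative f t * cnj (f t))"
  proof (rule absolutely_continuous_on_mult)
    show "absolutely_continuous_on a b (derivative f)"
      using W22_D(3)[OF f] ab by (auto simp: AC_loc_def)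
    have "absolutely_continuous_on a b f"
      using W22_D(2)[OF f] ab by (auto simp: AC_loc_def)
    then show "absolutely_continuous_on a b (\<lambda>t. cnj (f t))"
      by (rule absolutely_continuous_on_bound[of _ _ _ 1]) (auto simp flip: complex_cnj_diff)
  qed
  then have "((\<lambda>t. derivative f t * cnj (derivative f t) + derivative (derivative f) t * cnj (f t)) has_integral
       (derivative f b * cnj (f b) - derivative f a * cnj (f a))) {a..b}"
  proof (rule fundamental_theorem_of_calculus_AC[OF ab(1) _ N])
    fix t assume "t \<in> {a..b} - N"
    then have "t \<notin> X" "(derivative f has_vector_derivative derivative (derivative f) t) (at t)"
      by (auto simp: N_def)
    with W22_D(6)[OF f, of t]
    have "((\<lambda>t. derivative f t * cnj (f t)) has_vector_derivative
       derivative f t * cnj (derivative f t) + derivative (derivative f) t * cnj (f t)) (at t)"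
      by (intro has_vector_derivative_mult has_vector_derivative_cnj)
    then show "((\<lambda>t. derivative f t * cnj (f t)) has_vector_derivative
       derivative f t * cnj (derivative f t) + derivative (derivative f) t * cnj (f t)) (at t within {a..b})"
      by (rule has_vector_derivative_at_within)
  qed
  from has_integral_linear[OF this bounded_linear_Re]
  show ?thesis
    by (simp add: o_def boundary_term_def form_density_def add.commute flip: complex_norm_square)
qed

lemma boundary_term_jump:
  assumes f: "delta_dom \<alpha> f c" and k: "k \<ge> 1"
  obtains l r where "(boundary_term f \<longlongrightarrow> l) (at_left (x k))" "(boundary_term f \<longlongrightarrow> r) (at_right (x k))"
    "r - l = \<alpha> k * (cmod (c k))\<^sup>2"
proof -
  obtain p q where 1: "(f \<longlongrightarrow> c k) (at_right (x k))" "(f \<longlongrightarrow> c k) (at_left (x k))"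
      "(derivative f \<longlongrightarrow> p) (at_right (x k))" "(derivative f \<longlongrightarrow> q) (at_left (x k))"
      "p - q = of_real (\<alpha> k) * c k"
    using f k unfolding delta_dom_def by blast
  show ?thesis
  proof (rule that)
    show "(boundary_term f \<longlongrightarrow> Re (q * cnj (c k))) (at_left (x k))"
        "(boundary_term f \<longlongrightarrow> Re (p * cnj (c k))) (at_right (x k))"
      unfolding boundary_term_def by (intro tendsto_intros 1)+
    have "Re (p * cnj (c k)) - Re (q * cnj (c k)) = Re ((p - q) * cnj (c k))"
      by (simp only: left_diff_distrib minus_complex.sel)
    also have "\<dots> = \<alpha> k * (cmod (c k))\<^sup>2"
      unfolding 1(5) mult.assoc complex_norm_square[symmetric] by simp
    finally show "Re (p * cnj (c k)) - Re (q * cnj (c k)) = \<alpha> k * (cmod (c k))\<^sup>2" .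
  qed
qed

lemma integral_tendsto:
  fixes \<phi> :: "real \<Rightarrow> real"
  assumes "\<phi> integrable_on {a..b}" "a < p" "p < b"
  shows "((\<lambda>t. integral {a..t} \<phi>) \<longlongrightarrow> integral {a..p} \<phi>) (at_left p)"
    and "((\<lambda>t. integral {a..t} \<phi>) \<longlongrightarrow> integral {a..p} \<phi>) (at_right p)"
proof -
  have "continuous_on {a<..<b} (\<lambda>t. integral {a..t} \<phi>)"
    by (rule continuous_on_subset[OF indefinite_integral_continuous_1[OF assms(1)]]) auto
  then have "isCont (\<lambda>t. integral {a..t} \<phi>) p"
    using assms by (auto simp: continuous_on_eq_continuous_at)
  then have "((\<lambda>t. integral {a..t} \<phi>) \<longlongrightarrow> integral {a..p} \<phi>) (at p)"
    by (simp add: isCont_def)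
  then show "((\<lambda>t. integral {a..t} \<phi>) \<longlongrightarrow> integral {a..p} \<phi>) (at_left p)"
      "((\<lambda>t. integral {a..t} \<phi>) \<longlongrightarrow> integral {a..p} \<phi>) (at_right p)"
    by (simp_all add: filterlim_at_split)
qed

lemma boundary_term_mono:
  assumes f: "delta_dom \<alpha> f c" and pos: "\<And>k. k \<ge> 1 \<Longrightarrow> 0 \<le> \<alpha> k * (cmod (c k))\<^sup>2"
    and ab: "a \<le> b" "a \<notin> X" "b \<notin> X"
  shows "integral {a..b} (form_density f) \<le> boundary_term f b - boundary_term f a"
proof -
  have W: "f \<in> W22 X" using f by (simp add: delta_dom_def)
  \<comment> \<open>Off \<open>X\<close> this function grows at the rate |f'|^2, and at
    \<open>X\<close> it has the jumps of \<open>boundary_term\<close>, since the integral is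
    continuous.\<close>
  let ?G = "\<lambda>t. boundary_term f t - integral {a..t} (form_density f)"
  have "?G a \<le> ?G b"
  proof (rule mono_off_X[OF ab])
    fix u v assume uv: "u \<le> v" "{u..v} \<subseteq> - X" "{u..v} \<subseteq> {a..b}"
    have "integral {u..v} (form_density f) \<le> boundary_term f v - boundary_term f u"
      by (rule has_integral_le[OF integrable_integral[OF form_density_integrable_on[OF W]]
            boundary_term_diff[OF W uv(1,2)]]) simp
    moreover have "integral {a..u} (form_density f) + integral {u..v} (form_density f) = integral {a..v} (form_density f)"
      using uv by (intro Henstock_Kurzweil_Integration.integral_combine form_density_integrable_on[OF W]) auto
    ultimately show "?G u \<le> ?G v" by linarith
  next
    fix k :: nat assume k: "k \<ge> 1" "a < x k" "x k < b"
    obtain l r where lr: "(boundary_term f \<longlongrightarrow> l) (at_left (x k))" "(boundary_term f \<longlongrightarrow> r) (at_right (x k))"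
        "r - l = \<alpha> k * (cmod (c k))\<^sup>2"
      using boundary_term_jump[OF f k(1)] by blast
    note i = integral_tendsto[OF form_density_integrable_on[OF W] k(2,3)]
    have "(?G \<longlongrightarrow> l - integral {a..x k} (form_density f)) (at_left (x k))"
        "(?G \<longlongrightarrow> r - integral {a..x k} (form_density f)) (at_right (x k))"
      by (intro tendsto_intros lr i)+
    moreover have "l - integral {a..x k} (form_density f) \<le> r - integral {a..x k} (form_density f)"
      using lr(3) pos[OF k(1)] by simp
    ultimately show "\<exists>l r. (?G \<longlongrightarrow> l) (at_left (x k)) \<and> (?G \<longlongrightarrow> r) (at_right (x k)) \<and> l \<le> r"
      by blast
  qed
  then show ?thesis by simp
qed

section \<open>The squared modulus towards both ends of the line\<close>

lemma power2_cmod_diff: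
  assumes f: "f \<in> W22 X" and ab: "a \<le> b" "{a..b} \<subseteq> - X"
  shows "((\<lambda>t. 2 * boundary_term f t) has_integral ((cmod (f b))\<^sup>2 - (cmod (f a))\<^sup>2)) {a..b}"
proof (rule fundamental_theorem_of_calculus[OF ab(1)])
  fix t assume "t \<in> {a..b}"
  then have "(f has_vector_derivative derivative f t) (at t)"
    using W22_D(6)[OF f] ab by blast
  then have "((\<lambda>t. f t * cnj (f t)) has_vector_derivative f t * cnj (derivative f t) + derivative f t * cnj (f t)) (at t)"
    by (intro has_vector_derivative_mult has_vector_derivative_cnj)
  from bounded_linear.has_vector_derivative[OF bounded_linear_Re this]
  have "((\<lambda>t. Re (f t * cnj (f t))) has_vector_derivative 2 * boundary_term f t) (at t)"
    by (simp add: boundary_term_def algebra_simps)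
  moreover have "Re (z * cnj z) = (cmod z)\<^sup>2" for z
    unfolding complex_norm_square[symmetric] by simp
  ultimately show "((\<lambda>t. (cmod (f t))\<^sup>2) has_vector_derivative 2 * boundary_term f t) (at t within {a..b})"
    by (simp add: has_vector_derivative_at_within)
qed

text \<open>The squared modulus has equal one-sided limits at each \<open>x k\<close>, so only the
  sign of its derivative matters. The factor \<open>s\<close> is 1 for growth to the right and -1
  for growth to the left.\<close>

lemma power2_cmod_mono:
  assumes f: "delta_dom \<alpha> f c" and ab: "a \<le> b" "a \<notin> X" "b \<notin> X"
    and s: "\<And>t. a \<le> t \<Longrightarrow> t \<le> b \<Longrightarrow> t \<notin> X \<Longrightarrow> 0 \<le> s * boundary_term f t"
  shows "s * (cmod (f a))\<^sup>2 \<le> s * (cmod (f b))\<^sup>2"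
proof (rule mono_off_X[OF ab])
  have W: "f \<in> W22 X" using f by (simp add: delta_dom_def)
  fix u v assume uv: "u \<le> v" "{u..v} \<subseteq> - X" "{u..v} \<subseteq> {a..b}"
  have "0 \<le> s * ((cmod (f v))\<^sup>2 - (cmod (f u))\<^sup>2)"
  proof (rule has_integral_nonneg)
    show "((\<lambda>t. s * (2 * boundary_term f t)) has_integral s * ((cmod (f v))\<^sup>2 - (cmod (f u))\<^sup>2)) {u..v}"
      by (intro has_integral_mult_right power2_cmod_diff[OF W uv(1,2)])
    fix t assume "t \<in> {u..v}"
    then have "t \<notin> X" "a \<le> t" "t \<le> b" using uv by auto
    then show "0 \<le> s * (2 * boundary_term f t)" using s[of t] by simp
  qed
  then show "s * (cmod (f u))\<^sup>2 \<le> s * (cmod (f v))\<^sup>2" by (simp add: right_diff_distrib)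
next
  fix k :: nat assume k: "k \<ge> 1"
  then have "(f \<longlongrightarrow> c k) (at_right (x k))" "(f \<longlongrightarrow> c k) (at_left (x k))"
    using f unfolding delta_dom_def by blast+
  then have "((\<lambda>t. s * (cmod (f t))\<^sup>2) \<longlongrightarrow> s * (cmod (c k))\<^sup>2) (at_left (x k))"
      "((\<lambda>t. s * (cmod (f t))\<^sup>2) \<longlongrightarrow> s * (cmod (c k))\<^sup>2) (at_right (x k))"
    by (auto intro!: tendsto_intros)
  then show "\<exists>l r. ((\<lambda>t. s * (cmod (f t))\<^sup>2) \<longlongrightarrow> l) (at_left (x k)) \<and>
      ((\<lambda>t. s * (cmod (f t))\<^sup>2) \<longlongrightarrow> r) (at_right (x k)) \<and> l \<le> r"
    by blast
qed

text \<open>A positive lower bound on arbitrarily long intervals contradicts integrability. The left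
  endpoint may move with \<open>n\<close>, because at the left end of the line the intervals are
  those of length \<open>n\<close> that stop at a fixed point.\<close>

lemma power2_cmod_not_bounded_below:
  assumes f: "square_integrable f" and "\<eta> > 0"
    and ge: "\<And>n::nat. AE t in lebesgue. t \<in> {a n..a n + real n} \<longrightarrow> \<eta> \<le> (cmod (f t))\<^sup>2"
  shows False
proof -
  have int: "integrable lebesgue (\<lambda>t. (cmod (f t))\<^sup>2)" using f by (simp add: square_integrable_def)
  have "\<eta> * real n \<le> (LINT t|lebesgue. (cmod (f t))\<^sup>2)" for n
    using integral_ge_on_interval[OF int _ ge[of n]] by simp
  moreover obtain n where "(LINT t|lebesgue. (cmod (f t))\<^sup>2) < real n * \<eta>"
    using ex_less_of_nat_mult[OF \<open>\<eta> > 0\<close>] by blast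
  ultimately show False by (metis mult.commute not_less)
qed

text \<open>If W stayed positive beyond \<open>T\<close>, the squared modulus would increase there
  from a value that is positive because W is nonzero at that point. Nothing is claimed about a limit
  of W; one point with a good sign beyond every \<open>T\<close> suffices.\<close>

lemma boundary_term_nonpos_right:
  assumes f: "delta_dom \<alpha> f c"
  shows "\<exists>b\<ge>T. b \<notin> X \<and> boundary_term f b \<le> 0"
proof (rule ccontr)
  assume "\<not> ?thesis"
  then have pos: "boundary_term f t > 0" if "t \<ge> T" "t \<notin> X" for t
    using that by (meson not_le)
  obtain a where a: "a > T" "a \<notin> X" using not_X_between[of T "T + 1"] by auto
  have "f a \<noteq> 0" using pos[of a] a by (auto simp: boundary_term_def)
  show False
  proof (rule power2_cmod_not_bounded_below[of f "(cmod (f a))\<^sup>2" "\<lambda>_. a"])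
    show "square_integrable f" using f by (simp add: delta_dom_def W22_D)
    show "AE t in lebesgue. t \<in> {a..a + real n} \<longrightarrow> (cmod (f a))\<^sup>2 \<le> (cmod (f t))\<^sup>2" for n
      using AE_not_X
    proof eventually_elim
      case t: (elim t)
      show ?case
      proof
        assume t': "t \<in> {a..a + real n}"
        show "(cmod (f a))\<^sup>2 \<le> (cmod (f t))\<^sup>2"
          using power2_cmod_mono[OF f, of a t 1] pos t t' a by (force intro: less_imp_le)
      qed
    qed
  qed (use \<open>f a \<noteq> 0\<close> in simp)
qed

lemma boundary_term_nonneg_left:
  assumes f: "delta_dom \<alpha> f c"
  shows "\<exists>a\<le>T. a \<notin> X \<and> 0 \<le> boundary_term f a"
proof (rule ccontr)
  assume "\<not> ?thesis"
  then have neg: "boundary_term f t < 0" if "t \<le> T" "t \<notin> X" for t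
    using that by (meson not_le)
  obtain a where a: "a < T" "a \<notin> X" using not_X_between[of "T - 1" T] by auto
  have "f a \<noteq> 0" using neg[of a] a by (auto simp: boundary_term_def)
  show False
  proof (rule power2_cmod_not_bounded_below[of f "(cmod (f a))\<^sup>2" "\<lambda>n. a - real n"])
    show "square_integrable f" using f by (simp add: delta_dom_def W22_D)
    show "AE t in lebesgue. t \<in> {a - real n..a - real n + real n} \<longrightarrow> (cmod (f a))\<^sup>2 \<le> (cmod (f t))\<^sup>2" for n
      using AE_not_X
    proof eventually_elim
      case t: (elim t)
      show ?case
      proof
        assume t': "t \<in> {a - real n..a - real n + real n}"
        show "(cmod (f a))\<^sup>2 \<le> (cmod (f t))\<^sup>2"
          using power2_cmod_mono[OF f, of t a "-1"] neg t t' a by (force intro: less_imp_le)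
      qed
    qed
  qed (use \<open>f a \<noteq> 0\<close> in simp)
qed

text \<open>On the intervals between a point \<open>a n\<close> with W nonnegative and a point
  \<open>b n\<close> with W nonpositive the increment of W is at most 0, and it bounds the integral
  of the density from above. These intervals exhaust the line, and dominated convergence
  finishes.\<close>

lemma delta_form_nonneg:
  assumes f: "delta_dom \<alpha> f c" and pos: "\<And>k. k \<ge> 1 \<Longrightarrow> 0 \<le> \<alpha> k * (cmod (c k))\<^sup>2"
  shows "(LINT t|lebesgue. form_density f t) \<le> 0"
proof -
  have W: "f \<in> W22 X" using f by (simp add: delta_dom_def)
  note int = integrable_form_density[OF W]
  have "\<forall>n. \<exists>b\<ge>real n. b \<notin> X \<and> boundary_term f b \<le> 0"
    using boundary_term_nonpos_right[OF f] by blast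
  then obtain b where b: "\<And>n. b n \<ge> real n" "\<And>n. b n \<notin> X" "\<And>n. boundary_term f (b n) \<le> 0"
    by metis
  have "\<forall>n. \<exists>a\<le>- real n. a \<notin> X \<and> 0 \<le> boundary_term f a"
    using boundary_term_nonneg_left[OF f] by blast
  then obtain a where a: "\<And>n. a n \<le> - real n" "\<And>n. a n \<notin> X" "\<And>n. 0 \<le> boundary_term f (a n)"
    by metis
  have ab: "a n \<le> b n" for n using a(1)[of n] b(1)[of n] by linarith
  have "(LINT t|lebesgue. indicator {a n..b n} t *\<^sub>R form_density f t) \<le> 0" for n
  proof -
    have "set_integrable lebesgue {a n..b n} (form_density f)"
      unfolding set_integrable_def by (rule integrable_mult_indicator[OF _ int]) simp
    then have "(LINT t|lebesgue. indicator {a n..b n} t *\<^sub>R form_density f t) = integral {a n..b n} (form_density f)"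
      using set_lebesgue_integral_eq_integral(2) unfolding set_lebesgue_integral_def by blast
    also have "\<dots> \<le> boundary_term f (b n) - boundary_term f (a n)"
      by (rule boundary_term_mono[OF f pos ab a(2) b(2)])
    also have "\<dots> \<le> 0" using a(3)[of n] b(3)[of n] by linarith
    finally show ?thesis .
  qed
  moreover have "(\<lambda>n. LINT t|lebesgue. indicator {a n..b n} t *\<^sub>R form_density f t) \<longlonglongrightarrow> (LINT t|lebesgue. form_density f t)"
  proof (rule integral_dominated_convergence[where w = "\<lambda>t. norm (form_density f t)"])
    show "AE t in lebesgue. (\<lambda>n. indicator {a n..b n} t *\<^sub>R form_density f t) \<longlonglongrightarrow> form_density f t"
    proof (rule AE_I2)
      fix t
      have "\<forall>\<^sub>F n in sequentially. indicator {a n..b n} t *\<^sub>R form_density f t = form_density f t"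
        using eventually_ge_at_top[of "nat \<lceil>\<bar>t\<bar>\<rceil>"]
      proof eventually_elim
        case (elim n)
        then have "\<bar>t\<bar> \<le> real n" by linarith
        then have "t \<in> {a n..b n}" using a(1)[of n] b(1)[of n] by auto
        then show ?case by simp
      qed
      then show "(\<lambda>n. indicator {a n..b n} t *\<^sub>R form_density f t) \<longlonglongrightarrow> form_density f t"
        by (rule tendsto_eventually)
    qed
    show "AE t in lebesgue. norm (indicator {a n..b n} t *\<^sub>R form_density f t) \<le> norm (form_density f t)" for n
      by (rule AE_I2) (auto split: split_indicator)
    show "(\<lambda>t. indicator {a n..b n} t *\<^sub>R form_density f t) \<in> borel_measurable lebesgue" for n
      using integrable_mult_indicator[OF _ int, of "{a n..b n}"] by auto
  qed (use int in auto)
  ultimately show ?thesis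
    by (intro LIMSEQ_le_const2) auto
qed

text \<open>Compact support makes W vanish at both ends of a large interval, so its growth and its
  jumps balance. The energy enters through a majorant \<psi> of |f'|^2, since for a sum of
  overlapping bumps only a majorant is convenient.\<close>

lemma delta_form_le:
  assumes f: "delta_dom \<alpha> f c" and K: "finite K" "K \<subseteq> {1..}" "\<And>k. k \<ge> 1 \<Longrightarrow> k \<notin> K \<Longrightarrow> c k = 0"
    and supp: "\<And>t. t \<notin> {A..B} \<Longrightarrow> f t = 0"
    and \<psi>: "integrable lebesgue \<psi>" "\<And>t. 0 \<le> \<psi> t" "\<And>t. t \<notin> X \<Longrightarrow> (cmod (derivative f t))\<^sup>2 \<le> \<psi> t"
  shows "- (LINT t|lebesgue. form_density f t) \<le>
    (LINT t|lebesgue. \<psi> t) + (\<Sum>k\<in>K. \<alpha> k * (cmod (c k))\<^sup>2)"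
proof -
  have W: "f \<in> W22 X" using f by (simp add: delta_dom_def)
  \<comment> \<open>The interval has to contain the support, so that W vanishes at its ends, and all
    points \<open>x k\<close> with \<open>k\<close> in \<open>K\<close>, so that \<open>S\<close>
    runs from 0 to the full sum.\<close>
  define a' where "a' = Min (insert A (insert B (x ` K)))"
  define b' where "b' = Max (insert A (insert B (x ` K)))"
  obtain a where a: "a < a'" "a \<notin> X" using not_X_between[of "a' - 1" a'] by auto
  obtain b where b: "b' < b" "b \<notin> X" using not_X_between[of b' "b' + 1"] by auto
  have fin: "finite (insert A (insert B (x ` K)))" using K(1) by simp
  have a_less: "a < s" if "s \<in> insert A (insert B (x ` K))" for s
    using a(1) Min_le[OF fin that] unfolding a'_def by (rule order.strict_trans2)
  have b_gr: "s < b" if "s \<in> insert A (insert B (x ` K))" for s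
    using Max_ge[OF fin that] b(1) unfolding b'_def by (rule order.strict_trans1)
  have ab: "a \<le> b" using a_less[of A] b_gr[of A] by simp
  have fab: "f t = 0" if "t \<notin> {a..b}" for t
    using supp[of t] that a_less[of A] b_gr[of B] by auto
  have bt0: "boundary_term f a = 0" "boundary_term f b = 0"
    using supp[of a] supp[of b] a_less[of A] b_gr[of B] by (auto simp: boundary_term_def)
  have \<phi>_int: "form_density f integrable_on {u..v}" for u v by (rule form_density_integrable_on[OF W])
  have \<psi>_set: "set_integrable lebesgue {u..v} \<psi>" for u v
    unfolding set_integrable_def by (rule integrable_mult_indicator[OF _ \<psi>(1)]) simp
  then have \<psi>_int: "\<psi> integrable_on {u..v}" for u v
    using set_lebesgue_integral_eq_integral(1) by blast
  define \<rho> where "\<rho> t = form_density f t + \<psi> t" for t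
  have \<rho>_int: "\<rho> integrable_on {u..v}" for u v
    unfolding \<rho>_def by (intro integrable_add \<phi>_int \<psi>_int)
  \<comment> \<open>A step function with the jumps of W. By the strict inequality its left limit at
    \<open>x j\<close> leaves out the index \<open>j\<close> and its right limit includes
    it.\<close>
  define S where "S t = (\<Sum>k\<in>K. \<alpha> k * (cmod (c k))\<^sup>2 * (if x k < t then 1 else 0))" for t
  let ?G = "\<lambda>t. integral {a..t} \<rho> + S t - boundary_term f t"
  have "?G a \<le> ?G b"
  proof (rule mono_off_X[OF ab a(2) b(2)])
    fix u v assume uv: "u \<le> v" "{u..v} \<subseteq> - X" "{u..v} \<subseteq> {a..b}"
    have "boundary_term f v - boundary_term f u \<le> integral {u..v} \<rho>"
    proof (rule has_integral_le[OF boundary_term_diff[OF W uv(1,2)] integrable_integral[OF \<rho>_int]])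
      fix t assume "t \<in> {u..v}"
      then show "form_density f t + (cmod (derivative f t))\<^sup>2 \<le> \<rho> t"
        using uv \<psi>(3)[of t] by (auto simp: \<rho>_def)
    qed
    moreover have "integral {a..u} \<rho> + integral {u..v} \<rho> = integral {a..v} \<rho>"
      using uv by (intro Henstock_Kurzweil_Integration.integral_combine \<rho>_int) auto
    moreover have "S u = S v"
      unfolding S_def
    proof (rule sum.cong[OF refl])
      fix k assume "k \<in> K"
      then have "x k \<in> X" using K by (auto simp: X_def)
      then have "x k \<notin> {u..v}" using uv(2) by blast
      then have "x k < u \<longleftrightarrow> x k < v" using uv(1) by auto
      then show "\<alpha> k * (cmod (c k))\<^sup>2 * (if x k < u then 1 else 0) = \<alpha> k * (cmod (c k))\<^sup>2 * (if x k < v then 1 else 0)"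
        by simp
    qed
    ultimately show "?G u \<le> ?G v" by linarith
  next
    fix j :: nat assume j: "j \<ge> 1" "a < x j" "x j < b"
    obtain l r where lr: "(boundary_term f \<longlongrightarrow> l) (at_left (x j))" "(boundary_term f \<longlongrightarrow> r) (at_right (x j))"
        "r - l = \<alpha> j * (cmod (c j))\<^sup>2"
      using boundary_term_jump[OF f j(1)] by blast
    note i = integral_tendsto[OF \<rho>_int j(2,3)]
    define Sl where "Sl = (\<Sum>k\<in>K. \<alpha> k * (cmod (c k))\<^sup>2 * (if x k < x j then 1 else 0))"
    define Sr where "Sr = (\<Sum>k\<in>K. \<alpha> k * (cmod (c k))\<^sup>2 * (if x k \<le> x j then 1 else 0))"
    have "((\<lambda>t. if x k < t then 1 else 0 :: real) \<longlongrightarrow> (if x k < x j then 1 else 0)) (at_left (x j))" for k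
    proof (rule tendsto_eventually)
      show "\<forall>\<^sub>F t in at_left (x j). (if x k < t then 1 else 0 :: real) = (if x k < x j then 1 else 0)"
        unfolding eventually_at_left_field
        by (intro exI[of _ "if x k < x j then x k else x j - 1"]) auto
    qed
    then have Sl: "(S \<longlongrightarrow> Sl) (at_left (x j))"
      unfolding S_def Sl_def by (intro tendsto_intros)
    have "((\<lambda>t. if x k < t then 1 else 0 :: real) \<longlongrightarrow> (if x k \<le> x j then 1 else 0)) (at_right (x j))" for k
    proof (rule tendsto_eventually)
      show "\<forall>\<^sub>F t in at_right (x j). (if x k < t then 1 else 0 :: real) = (if x k \<le> x j then 1 else 0)"
        unfolding eventually_at_right_field
        by (intro exI[of _ "if x k \<le> x j then x j + 1 else x k"]) auto
    qed
    then have Sr: "(S \<longlongrightarrow> Sr) (at_right (x j))"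
      unfolding S_def Sr_def by (intro tendsto_intros)
    have "Sr - Sl = (\<Sum>k\<in>K. if k = j then \<alpha> k * (cmod (c k))\<^sup>2 else 0)"
      unfolding Sr_def Sl_def sum_subtractf[symmetric]
    proof (rule sum.cong[OF refl])
      fix k assume "k \<in> K"
      then have "x k = x j \<longleftrightarrow> k = j" using K(2) j(1) x_eq_iff by auto
      then show "\<alpha> k * (cmod (c k))\<^sup>2 * (if x k \<le> x j then 1 else 0) - \<alpha> k * (cmod (c k))\<^sup>2 * (if x k < x j then 1 else 0)
          = (if k = j then \<alpha> k * (cmod (c k))\<^sup>2 else 0)"
        by auto
    qed
    also have "\<dots> = \<alpha> j * (cmod (c j))\<^sup>2"
      using K(1) K(3)[OF j(1)] by (simp add: sum.delta)
    finally have jump: "Sr - Sl = r - l" using lr(3) by simp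
    have "(?G \<longlongrightarrow> integral {a..x j} \<rho> + Sl - l) (at_left (x j))"
        "(?G \<longlongrightarrow> integral {a..x j} \<rho> + Sr - r) (at_right (x j))"
      by (intro tendsto_intros lr i Sl Sr)+
    moreover have "integral {a..x j} \<rho> + Sl - l \<le> integral {a..x j} \<rho> + Sr - r"
      using jump by linarith
    ultimately show "\<exists>l r. (?G \<longlongrightarrow> l) (at_left (x j)) \<and> (?G \<longlongrightarrow> r) (at_right (x j)) \<and> l \<le> r"
      by blast
  qed
  moreover have "S a = 0"
    unfolding S_def
  proof (rule sum.neutral, rule ballI)
    fix k assume "k \<in> K"
    then have "a < x k" by (intro a_less) simp
    then show "\<alpha> k * (cmod (c k))\<^sup>2 * (if x k < a then 1 else 0) = 0" by simp
  qed
  moreover have "S b = (\<Sum>k\<in>K. \<alpha> k * (cmod (c k))\<^sup>2)"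
    unfolding S_def using b_gr by (intro sum.cong) auto
  ultimately have "0 \<le> integral {a..b} \<rho> + (\<Sum>k\<in>K. \<alpha> k * (cmod (c k))\<^sup>2)"
    using bt0 by simp
  moreover have "integral {a..b} \<rho> = integral {a..b} (form_density f) + integral {a..b} \<psi>"
    unfolding \<rho>_def by (rule Henstock_Kurzweil_Integration.integral_add[OF \<phi>_int \<psi>_int])
  moreover have "integral {a..b} (form_density f) = (LINT t|lebesgue. form_density f t)"
  proof -
    have "set_integrable lebesgue {a..b} (form_density f)"
      unfolding set_integrable_def by (rule integrable_mult_indicator[OF _ integrable_form_density[OF W]]) simp
    then have "integral {a..b} (form_density f) = (LINT t|lebesgue. indicator {a..b} t *\<^sub>R form_density f t)"
      using set_lebesgue_integral_eq_integral(2) unfolding set_lebesgue_integral_def by metis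
    also have "\<dots> = (LINT t|lebesgue. form_density f t)"
      by (intro Bochner_Integration.integral_cong) (use fab in \<open>auto simp: form_density_def split: split_indicator\<close>)
    finally show ?thesis .
  qed
  moreover have "integral {a..b} \<psi> \<le> (LINT t|lebesgue. \<psi> t)"
  proof -
    have "integral {a..b} \<psi> = (LINT t|lebesgue. indicator {a..b} t *\<^sub>R \<psi> t)"
      using set_lebesgue_integral_eq_integral(2)[OF \<psi>_set] unfolding set_lebesgue_integral_def by metis
    also have "\<dots> \<le> (LINT t|lebesgue. \<psi> t)"
      using \<psi>_set[of a b] unfolding set_integrable_def
      by (intro integral_mono \<psi>) (auto simp: \<psi>(2) split: split_indicator)
    finally show ?thesis .
  qed
  ultimately show ?thesis by linarith
qed

end

section \<open>Bumps of almost minimal energy\<close>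

text \<open>The derivative of the profile is \<open>A + B (1 - t/d) ^ n + C (t/d) ^ n\<close>; as \<open>n\<close> grows, the two
  boundary layers that adjust the slopes at \<open>0\<close> and \<open>d\<close> disappear in the energy, whose infimum
  \<open>1/d\<close> belongs to the linear function.\<close>

lemma profile_exists:
  fixes d s \<eta> :: real
  assumes d: "d > 0" and \<eta>: "1 / d < \<eta>"
  obtains P v v' :: "real \<Rightarrow> real" where
    "P 0 = 1" "P d = 0" "v 0 = s" "v d = 0"
    "\<And>t. (P has_real_derivative v t) (at t)" "\<And>t. (v has_real_derivative v' t) (at t)"
    "continuous_on UNIV v'" "integral {0..d} (\<lambda>t. (v t)\<^sup>2) < \<eta>"
proof -
  \<comment> \<open>With \<open>e = 1/(n+1)\<close> each boundary layer has integral
    \<open>d * e\<close> times its height. The heights \<open>s - A\<close> and \<open>- A\<close>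
    give the slopes \<open>s\<close> and 0 at the ends, and \<open>A\<close> solves the condition
    that the slope has integral -1.\<close>
  define A where "A e = (- 1 / d - s * e) / (1 - 2 * e)" for e :: real
  \<comment> \<open>A majorant of the energy, exact to evaluate: the square of the sum of the two
    layers is at most twice the sum of their squares, and y^2 is at most y for the layer functions.
    At \<open>e = 0\<close> it equals 1/d.\<close>
  define R where "R e = d * ((A e)\<^sup>2 + e * (2 * A e * (s - A e) + 2 * (s - A e)\<^sup>2 + 2 * A e * (- A e) + 2 * (- A e)\<^sup>2))" for e
  have lim: "(\<lambda>n. inverse (real (Suc n))) \<longlonglongrightarrow> 0" by (rule LIMSEQ_inverse_real_of_nat)
  have "(\<lambda>n. A (inverse (real (Suc n)))) \<longlonglongrightarrow> (- 1 / d - s * 0) / (1 - 2 * 0)"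
    unfolding A_def by (intro tendsto_intros lim) simp
  then have "(\<lambda>n. A (inverse (real (Suc n)))) \<longlonglongrightarrow> - 1 / d" by simp
  then have "(\<lambda>n. R (inverse (real (Suc n)))) \<longlonglongrightarrow> d * ((- 1 / d)\<^sup>2 + 0 * (2 * (- 1 / d) * (s - (- 1 / d)) + 2 * (s - (- 1 / d))\<^sup>2 + 2 * (- 1 / d) * (- (- 1 / d)) + 2 * (- (- 1 / d))\<^sup>2))"
    unfolding R_def by (intro tendsto_intros lim)
  moreover have "d * ((- 1 / d)\<^sup>2 + 0 * (2 * (- 1 / d) * (s - (- 1 / d)) + 2 * (s - (- 1 / d))\<^sup>2 + 2 * (- 1 / d) * (- (- 1 / d)) + 2 * (- (- 1 / d))\<^sup>2)) = 1 / d"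
    using d by (simp add: power2_eq_square)
  ultimately have "\<forall>\<^sub>F n in sequentially. R (inverse (real (Suc n))) < \<eta>"
    using \<eta> by (metis order_tendstoD(2))
  \<comment> \<open>From \<open>n \<ge> 2\<close> one gets \<open>1 - 2 * e > 0\<close>, so that
    \<open>A e\<close> is well defined, and a predecessor \<open>m\<close> of \<open>n\<close> for
    the second derivative.\<close>
  then have "\<forall>\<^sub>F n in sequentially. R (inverse (real (Suc n))) < \<eta> \<and> n \<ge> 2"
    using eventually_ge_at_top[of 2] by (rule eventually_conj)
  then obtain n :: nat where n: "R (inverse (real (Suc n))) < \<eta>" "n \<ge> 2"
    by (auto dest: eventually_happens)
  obtain m where m: "n = Suc m" using n(2) by (cases n) auto
  define e where "e = inverse (real (Suc n))"
  have e: "e * real (Suc n) = 1" by (simp add: e_def)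
  have "1 - 2 * e > 0" using n(2) by (simp add: e_def field_simps)
  then have Ae: "A e * (1 - 2 * e) = - 1 / d - s * e" by (simp add: A_def)
  define a b c where "a = A e" and "b = s - A e" and "c = - A e"
  have total: "a * d + (b + c) * d * e = - 1"
  proof -
    have "a * d + (b + c) * d * e = d * (A e * (1 - 2 * e)) + d * s * e"
      by (simp add: a_def b_def c_def algebra_simps)
    also have "\<dots> = - 1" unfolding Ae using d by (simp add: algebra_simps)
    finally show ?thesis .
  qed
  define p where "p k t = (1 - t / d) ^ k" for k t
  define q where "q k t = (t / d) ^ k" for k t
  have dp: "(p (Suc k) has_real_derivative - (real (Suc k) / d) * p k t) (at t)" for t k
  proof -
    have "((\<lambda>t. 1 - t / d) has_real_derivative - (1 / d)) (at t)"
      using d by (auto intro!: derivative_eq_intros)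
    from DERIV_power[OF this, of "Suc k"] show ?thesis
      unfolding p_def by (simp del: power_Suc of_nat_Suc)
  qed
  have dq: "(q (Suc k) has_real_derivative real (Suc k) / d * q k t) (at t)" for t k
  proof -
    have "((\<lambda>t. t / d) has_real_derivative 1 / d) (at t)"
      using d by (auto intro!: derivative_eq_intros)
    from DERIV_power[OF this, of "Suc k"] show ?thesis
      unfolding q_def by (simp del: power_Suc of_nat_Suc)
  qed
  have cont_pq: "continuous_on S (p k)" "continuous_on S (q k)" for S k
    unfolding p_def q_def by (intro continuous_intros; use d in simp)+
  have pq0: "p (Suc k) d = 0" "q (Suc k) 0 = 0" "p k 0 = 1" "q k d = 1" for k
    using d by (simp_all add: p_def q_def)
  define v where "v t = a + b * p n t + c * q n t" for t
  define v' where "v' t = b * (- (real n / d) * p m t) + c * (real n / d * q m t)" for t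
  define P where "P t = 1 + a * t + b * d * e * (1 - p (Suc n) t) + c * d * e * q (Suc n) t" for t
  define r where "r = real (Suc n) / d"
  have de: "d * (e * r) = 1" using d e by (simp add: r_def field_simps)
  have dp': "(p (Suc n) has_real_derivative - r * p n t) (at t)"
    and dq': "(q (Suc n) has_real_derivative r * q n t) (at t)" for t
    using dp[of n t] dq[of n t] by (simp_all only: r_def)
  have cancel: "b' * d * e * (r * y) = b' * y" for b' y
  proof -
    have "b' * d * e * (r * y) = b' * (d * (e * r)) * y" by (simp only: mult_ac)
    then show ?thesis by (simp add: de)
  qed
  have dP: "(P has_real_derivative v t) (at t)" for t
  proof -
    have "(P has_real_derivative 0 + a * 1 + b * d * e * (0 - - r * p n t) + c * d * e * (r * q n t)) (at t)"
      unfolding P_def by (intro DERIV_add DERIV_cmult DERIV_diff DERIV_const DERIV_ident dp' dq')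
    then show ?thesis by (simp add: cancel v_def)
  qed
  have dv: "(v has_real_derivative v' t) (at t)" for t
  proof -
    have "(v has_real_derivative 0 + b * (- (real (Suc m) / d) * p m t) + c * (real (Suc m) / d * q m t)) (at t)"
      unfolding v_def m by (intro DERIV_add DERIV_cmult DERIV_const dp dq)
    then show ?thesis unfolding v'_def m by simp
  qed
  have "integral {0..d} (\<lambda>t. (v t)\<^sup>2) \<le> R e"
  proof (rule has_integral_le)
    have "continuous_on {0..d} (\<lambda>t. (v t)\<^sup>2)"
      unfolding v_def by (intro continuous_intros cont_pq)
    then show "((\<lambda>t. (v t)\<^sup>2) has_integral integral {0..d} (\<lambda>t. (v t)\<^sup>2)) {0..d}"
      by (intro integrable_integral integrable_continuous_interval)
    define b2 c2 where "b2 = 2 * a * b + 2 * b\<^sup>2" and "c2 = 2 * a * c + 2 * c\<^sup>2"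
    define \<beta> where "\<beta> t = a\<^sup>2 * t - b2 * d * e * p (Suc n) t + c2 * d * e * q (Suc n) t" for t
    define \<gamma> where "\<gamma> t = a\<^sup>2 + b2 * p n t + c2 * q n t" for t
    have "(\<beta> has_real_derivative \<gamma> t) (at t)" for t
    proof -
      have "(\<beta> has_real_derivative a\<^sup>2 * 1 - b2 * d * e * (- r * p n t) + c2 * d * e * (r * q n t)) (at t)"
        unfolding \<beta>_def by (intro DERIV_add DERIV_cmult DERIV_diff DERIV_ident dp' dq')
      then show ?thesis by (simp add: cancel \<gamma>_def)
    qed
    then have "(\<gamma> has_integral \<beta> d - \<beta> 0) {0..d}"
      using d by (intro fundamental_theorem_of_calculus)
        (auto simp flip: has_real_derivative_iff_has_vector_derivative intro: has_field_derivative_at_within)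
    moreover have "\<beta> d - \<beta> 0 = R e"
    proof -
      have "R e = d * (a\<^sup>2 + e * (2 * a * b + 2 * b\<^sup>2 + 2 * a * c + 2 * c\<^sup>2))"
        unfolding R_def a_def b_def c_def ..
      then show ?thesis by (simp add: \<beta>_def b2_def c2_def pq0 algebra_simps)
    qed
    ultimately show "(\<gamma> has_integral R e) {0..d}" by simp
    fix t assume "t \<in> {0..d}"
    define y z where "y = p n t" and "z = q n t"
    have "0 \<le> t / d" "t / d \<le> 1" using \<open>t \<in> {0..d}\<close> d by auto
    then have y: "0 \<le> y" "y \<le> 1" and z: "0 \<le> z" "z \<le> 1"
      unfolding y_def z_def p_def q_def by (auto intro!: power_le_one zero_le_power)
    have "(b * y + c * z)\<^sup>2 \<le> 2 * (b\<^sup>2 * y\<^sup>2) + 2 * (c\<^sup>2 * z\<^sup>2)"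
      using zero_le_power2[of "b * y - c * z"] by (simp add: power2_eq_square algebra_simps)
    also have "\<dots> \<le> 2 * (b\<^sup>2 * y) + 2 * (c\<^sup>2 * z)"
    proof -
      have "y\<^sup>2 \<le> y" "z\<^sup>2 \<le> z" using y z by (auto simp: power2_eq_square mult_left_le)
      then show ?thesis by (intro add_mono mult_left_mono) auto
    qed
    finally have le: "(b * y + c * z)\<^sup>2 \<le> 2 * (b\<^sup>2 * y) + 2 * (c\<^sup>2 * z)" .
    have "(v t)\<^sup>2 = a\<^sup>2 + 2 * a * (b * y + c * z) + (b * y + c * z)\<^sup>2"
      by (simp add: v_def y_def z_def power2_eq_square algebra_simps)
    also have "\<dots> \<le> a\<^sup>2 + 2 * a * (b * y + c * z) + (2 * (b\<^sup>2 * y) + 2 * (c\<^sup>2 * z))"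
      using le by simp
    also have "\<dots> = \<gamma> t" by (simp add: \<gamma>_def y_def z_def b2_def c2_def algebra_simps)
    finally show "(v t)\<^sup>2 \<le> \<gamma> t" .
  qed
  then have energy: "integral {0..d} (\<lambda>t. (v t)\<^sup>2) < \<eta>" using n(1) by (simp add: e_def)
  have vals: "P 0 = 1" "v 0 = s" "v d = 0"
    by (simp_all add: P_def v_def m pq0) (simp_all add: a_def b_def c_def)
  have Pd: "P d = 0"
    using total by (simp add: P_def pq0 algebra_simps)
  have "continuous_on UNIV v'"
    unfolding v'_def by (intro continuous_intros cont_pq)
  then show ?thesis
    using that[OF vals(1) Pd vals(2,3) dP dv] energy by blast
qed

text \<open>One side of a bump as a function of the distance from its centre, with slope
  \<open>s\<close> there. At \<open>d\<close> the function \<open>w1\<close> may have a corner,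
  which is why \<open>w2\<close> is its derivative elsewhere only; the bounds are confined to
  nonnegative arguments because the polynomial profile is not controlled to the left of 0.\<close>

definition half_bump :: "real \<Rightarrow> real \<Rightarrow> real \<Rightarrow> (real \<Rightarrow> real) \<Rightarrow> (real \<Rightarrow> real) \<Rightarrow> (real \<Rightarrow> real) \<Rightarrow> bool" where
  "half_bump d s L w w1 w2 \<longleftrightarrow> w 0 = 1 \<and> w1 0 = s \<and> (\<forall>t\<ge>d. w t = 0 \<and> w1 t = 0 \<and> w2 t = 0) \<and>
     (\<forall>t. (w has_real_derivative w1 t) (at t)) \<and> (\<forall>t. t \<noteq> d \<longrightarrow> (w1 has_real_derivative w2 t) (at t)) \<and>
     continuous_on UNIV w1 \<and> w2 \<in> borel_measurable borel \<and> L > 0 \<and>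
     (\<forall>t\<ge>0. \<bar>w t\<bar> \<le> L \<and> \<bar>w1 t\<bar> \<le> L \<and> \<bar>w2 t\<bar> \<le> L) \<and>
     (\<forall>s\<ge>0. \<forall>t\<ge>0. \<bar>w s - w t\<bar> \<le> L * \<bar>s - t\<bar> \<and> \<bar>w1 s - w1 t\<bar> \<le> L * \<bar>s - t\<bar>)"

text \<open>Freezing the argument at \<open>d\<close> creates no corner because the slope vanishes
  there; this is what lets a profile be continued by a constant.\<close>

lemma has_real_derivative_stopped:
  fixes P v :: "real \<Rightarrow> real"
  assumes dP: "\<And>t. (P has_real_derivative v t) (at t)" and vd: "v d = 0"
  shows "((\<lambda>t. P (min t d)) has_real_derivative v (min t d)) (at t)"
proof (cases t d rule: linorder_cases)
  case less
  have "(P has_real_derivative v t) (at t)" by (rule dP)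
  then have "((\<lambda>t. P (min t d)) has_real_derivative v t) (at t)"
    by (rule has_field_derivative_transform_within_open[of _ _ _ "{..<d}"]) (use less in auto)
  then show ?thesis using less by simp
next
  case greater
  have "((\<lambda>t. P d) has_real_derivative 0) (at t)" by simp
  then have "((\<lambda>t. P (min t d)) has_real_derivative 0) (at t)"
    by (rule has_field_derivative_transform_within_open[of _ _ _ "{d<..}"]) (use greater in auto)
  then show ?thesis using greater vd by simp
next
  case equal
  have "(P has_real_derivative 0) (at d within {..d})"
    using dP[of d] vd by (auto intro: has_field_derivative_at_within)
  then have l: "((\<lambda>t. P (min t d)) has_real_derivative 0) (at d within {..d})"
    by (rule has_field_derivative_transform_within[OF _ zero_less_one]) auto
  have "((\<lambda>t. P d) has_real_derivative 0) (at d within {d..})" by simp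
  then have r: "((\<lambda>t. P (min t d)) has_real_derivative 0) (at d within {d..})"
    by (rule has_field_derivative_transform_within[OF _ zero_less_one]) auto
  have "((\<lambda>t. P (min t d)) has_real_derivative 0) (at d within {..d} \<union> {d..})"
    using l r unfolding has_field_derivative_iff by (rule Lim_Un)
  moreover have "{..d} \<union> {d..} = UNIV" by auto
  ultimately show ?thesis using equal vd by simp
qed

lemma half_bump_exists:
  fixes d s \<eta> :: real
  assumes d: "d > 0" and \<eta>: "1 / d < \<eta>"
  obtains L w w1 w2 where "half_bump d s L w w1 w2"
    "integrable lborel (\<lambda>t. indicator {0<..} t * (w1 t)\<^sup>2)"
    "(LINT t|lborel. indicator {0<..} t * (w1 t)\<^sup>2) < \<eta>"
proof -
  obtain P v v' where P: "P 0 = 1" "P d = 0" "v 0 = s" "v d = 0"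
    "\<And>t. (P has_real_derivative v t) (at t)" "\<And>t. (v has_real_derivative v' t) (at t)"
    "continuous_on UNIV v'" "integral {0..d} (\<lambda>t. (v t)\<^sup>2) < \<eta>"
    by (rule profile_exists[OF assms, of s]) (rule that)
  have contP: "continuous_on S P" for S
    by (intro continuous_at_imp_continuous_on ballI) (rule DERIV_isCont[OF P(5)])
  have contv: "continuous_on S v" for S
    by (intro continuous_at_imp_continuous_on ballI) (rule DERIV_isCont[OF P(6)])
  have contv': "continuous_on S v'" for S using P(7) by (rule continuous_on_subset) simp
  have "compact (P ` {0..d} \<union> v ` {0..d} \<union> v' ` {0..d})"
    by (intro compact_Un compact_continuous_image contP contv contv') auto
  then have "bounded (P ` {0..d} \<union> v ` {0..d} \<union> v' ` {0..d})"
    by (rule compact_imp_bounded)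
  then obtain L where L: "L > 0" "\<forall>y\<in>P ` {0..d} \<union> v ` {0..d} \<union> v' ` {0..d}. \<bar>y\<bar> \<le> L"
    unfolding bounded_pos real_norm_def by blast
  have bound: "\<bar>P t\<bar> \<le> L" "\<bar>v t\<bar> \<le> L" "\<bar>v' t\<bar> \<le> L" if "t \<in> {0..d}" for t
    using that L(2) by auto
  have mvt: "\<bar>F s - F t\<bar> \<le> L * \<bar>s - t\<bar>"
    if F: "\<And>t. (F has_real_derivative F' t) (at t)" and F': "\<And>t. t \<in> {0..d} \<Longrightarrow> \<bar>F' t\<bar> \<le> L"
      and "s \<in> {0..d}" "t \<in> {0..d}" for F F' :: "real \<Rightarrow> real" and s t
  proof -
    have "norm (F s - F t) \<le> L * norm (s - t)"
      by (rule field_differentiable_bound[of "{0..d}" F F'])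
         (use that in \<open>auto intro: has_field_derivative_at_within\<close>)
    then show ?thesis by simp
  qed
  have min_in: "min t d \<in> {0..d}" if "t \<ge> 0" for t using that d by auto
  define w where "w t = P (min t d)" for t
  define w1 where "w1 t = v (min t d)" for t
  define w2 where "w2 t = (if t < d then v' t else 0)" for t
  have lip: "\<bar>w s - w t\<bar> \<le> L * \<bar>s - t\<bar>" "\<bar>w1 s - w1 t\<bar> \<le> L * \<bar>s - t\<bar>" if "s \<ge> 0" "t \<ge> 0" for s t
  proof -
    have le: "L * \<bar>min s d - min t d\<bar> \<le> L * \<bar>s - t\<bar>"
      using L(1) by (intro mult_left_mono) (auto simp: min_def)
    show "\<bar>w s - w t\<bar> \<le> L * \<bar>s - t\<bar>"
      using mvt[OF P(5) bound(2) min_in[OF that(1)] min_in[OF that(2)]] le by (simp add: w_def)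
    show "\<bar>w1 s - w1 t\<bar> \<le> L * \<bar>s - t\<bar>"
      using mvt[OF P(6) bound(3) min_in[OF that(1)] min_in[OF that(2)]] le by (simp add: w1_def)
  qed
  have dw1: "(w1 has_real_derivative w2 t) (at t)" if "t \<noteq> d" for t
  proof (cases "t < d")
    case True
    have "(v has_real_derivative v' t) (at t)" by (rule P(6))
    then have "(w1 has_real_derivative v' t) (at t)"
      by (rule has_field_derivative_transform_within_open[of _ _ _ "{..<d}"]) (use True in \<open>auto simp: w1_def\<close>)
    then show ?thesis using True by (simp add: w2_def)
  next
    case False
    then have "t > d" using that by simp
    have "((\<lambda>t. v d) has_real_derivative 0) (at t)" by simp
    then have "(w1 has_real_derivative 0) (at t)"
      by (rule has_field_derivative_transform_within_open[of _ _ _ "{d<..}"]) (use \<open>t > d\<close> in \<open>auto simp: w1_def\<close>)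
    then show ?thesis using False by (simp add: w2_def)
  qed
  have hb: "half_bump d s L w w1 w2"
    unfolding half_bump_def
  proof (intro conjI allI impI)
    show "(w has_real_derivative w1 t) (at t)" for t
      unfolding w_def w1_def by (rule has_real_derivative_stopped[OF P(5,4)])
    show "continuous_on UNIV w1"
      unfolding w1_def by (rule continuous_on_compose2[OF contv[of UNIV]]) (auto intro: continuous_intros)
    show "w2 \<in> borel_measurable borel"
      unfolding w2_def using borel_measurable_continuous_onI[OF P(7)] by measurable
    show "\<bar>w t\<bar> \<le> L" "\<bar>w1 t\<bar> \<le> L" if "t \<ge> 0" for t
      using bound min_in[OF that] by (auto simp: w_def w1_def)
    show "\<bar>w2 t\<bar> \<le> L" if "t \<ge> 0" for t
      using bound(3)[of t] that L(1) by (auto simp: w2_def)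
  qed (use P d L lip dw1 in \<open>auto simp: w_def w1_def w2_def min_def\<close>)
  \<comment> \<open>The energy beyond \<open>d\<close> is zero since the slope vanishes from
    \<open>d\<close> on. The open end at 0 keeps the two halves of a bump disjoint when they are
    added.\<close>
  have eq: "indicator {0<..} t * (w1 t)\<^sup>2 = indicat_real {0<..d} t * (v t)\<^sup>2" for t
    using P(4) by (auto simp: w1_def min_def split: split_indicator)
  have "set_integrable lborel {0..d} (\<lambda>t. (v t)\<^sup>2)"
    by (intro borel_integrable_atLeastAtMost' continuous_intros contv)
  then have int: "integrable lborel (\<lambda>t. indicator {0..d} t * (v t)\<^sup>2)"
    and val: "(LINT t|lborel. indicator {0..d} t * (v t)\<^sup>2) = integral {0..d} (\<lambda>t. (v t)\<^sup>2)"
    using set_borel_integral_eq_integral(2)[of "{0..d}" "\<lambda>t. (v t)\<^sup>2"]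
    by (simp_all add: set_integrable_def set_lebesgue_integral_def)
  have int': "integrable lborel (\<lambda>t. indicator {0<..d} t * (v t)\<^sup>2)"
    using borel_measurable_continuous_onI[OF contv]
    by (intro Bochner_Integration.integrable_bound[OF int])
       (measurable, auto intro!: AE_I2 split: split_indicator)
  have "(LINT t|lborel. indicator {0<..d} t * (v t)\<^sup>2) \<le> (LINT t|lborel. indicator {0..d} t * (v t)\<^sup>2)"
    by (rule integral_mono[OF int' int]) (auto split: split_indicator)
  then show ?thesis
    using that[OF hb] int' val P(8) by (simp add: eq)
qed

section \<open>Gluing two half bumps into an element of the domain\<close>

lemma square_integrable_bounded_support:
  fixes g :: "real \<Rightarrow> real"
  assumes [measurable]: "g \<in> borel_measurable borel"
    and le: "\<And>t. \<bar>g t\<bar> \<le> M" and supp: "\<And>t. t \<notin> {a..b} \<Longrightarrow> g t = 0"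
  shows "square_integrable (\<lambda>t. complex_of_real (g t))"
proof -
  have m: "(\<lambda>t. complex_of_real (g t)) \<in> borel_measurable lebesgue"
    by (rule measurable_completion) measurable
  have "integrable lebesgue (\<lambda>t. M\<^sup>2 * indicat_real {a..b} t)"
    by (intro integrable_mult_right integrable_real_indicator) (auto simp: emeasure_lborel_Icc_eq)
  then have "integrable lebesgue (\<lambda>t. (cmod (complex_of_real (g t)))\<^sup>2)"
  proof (rule Bochner_Integration.integrable_bound)
    show "(\<lambda>t. (cmod (complex_of_real (g t)))\<^sup>2) \<in> borel_measurable lebesgue"
      by (rule measurable_completion) measurable
    have "(g t)\<^sup>2 \<le> M\<^sup>2" for t using le[of t] by (metis abs_le_square_iff abs_of_nonneg order_trans abs_ge_zero)
    then show "AE t in lebesgue. norm ((cmod (complex_of_real (g t)))\<^sup>2) \<le> norm (M\<^sup>2 * indicat_real {a..b} t)"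
      by (intro AE_I2) (auto simp: supp split: split_indicator)
  qed
  then show ?thesis using m by (simp add: square_integrable_def)
qed

lemma isCont_shift_reflect:
  fixes h :: "real \<Rightarrow> real"
  shows "isCont h (c - p) \<Longrightarrow> isCont (\<lambda>t. h (t - p)) c"
    and "isCont h (p - c) \<Longrightarrow> isCont (\<lambda>t. h (p - t)) c"
proof -
  have s: "isCont (\<lambda>t. t - p) c" and r: "isCont (\<lambda>t. p - t) c" by (intro continuous_intros)+
  show "isCont (\<lambda>t. h (t - p)) c" if "isCont h (c - p)" using s that by (rule isCont_o2)
  show "isCont (\<lambda>t. h (p - t)) c" if "isCont h (p - c)" using r that by (rule isCont_o2)
qed

context interaction_points
begin

text \<open>Both halves leave the centre with outward slope \<alpha>/2, so the derivative jumps by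
  \<alpha> where the value is 1. At the ends of the support value and slope vanish, hence the
  conditions at all other points hold with limits 0, even if a neighbour is exactly such an
  end.\<close>

lemma bump_exists:
  assumes k: "k \<ge> 1" and dl: "dl > 0" and dr: "dr > 0"
    and left: "\<And>j. 1 \<le> j \<Longrightarrow> j < k \<Longrightarrow> x j \<le> x k - dl" and right: "\<And>j. k < j \<Longrightarrow> x k + dr \<le> x j"
    and energy: "2 * (1 / dl + 1 / dr) + \<alpha> k < 0"
  obtains f where "delta_dom \<alpha> f (\<lambda>j. if j = k then 1 else 0)"
    "\<And>t. t \<notin> {x k - dl..x k + dr} \<Longrightarrow> f t = 0"
    "\<And>t. t \<notin> {x k - dl..x k + dr} \<Longrightarrow> derivative f t = 0"
    "integrable lebesgue (\<lambda>t. (cmod (derivative f t))\<^sup>2)"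
    "2 * (LINT t|lebesgue. (cmod (derivative f t))\<^sup>2) + \<alpha> k < 0"
proof -
  define p where "p = x k"
  have pX: "p \<in> X" using k by (auto simp: p_def X_def)
  \<comment> \<open>Each half may exceed its minimal energy by \<epsilon>, which costs 4 times
    \<epsilon> in the doubled sum; one eighth of the slack therefore spends only half of it.\<close>
  define \<epsilon> where "\<epsilon> = - (2 * (1 / dl + 1 / dr) + \<alpha> k) / 8"
  have \<epsilon>: "\<epsilon> > 0" using energy by (simp add: \<epsilon>_def)
  have less_add_pos: "r < r + \<epsilon>" for r using \<epsilon> by simp
  obtain Lr wr wr1 wr2 where hr: "half_bump dr (\<alpha> k / 2) Lr wr wr1 wr2"
    and ir: "integrable lborel (\<lambda>t. indicator {0<..} t * (wr1 t)\<^sup>2)"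
    and er: "(LINT t|lborel. indicator {0<..} t * (wr1 t)\<^sup>2) < 1 / dr + \<epsilon>"
    by (rule half_bump_exists[OF dr less_add_pos[of "1 / dr"], of "\<alpha> k / 2"]) (rule that)
  obtain Ll wl wl1 wl2 where hl: "half_bump dl (\<alpha> k / 2) Ll wl wl1 wl2"
    and il: "integrable lborel (\<lambda>t. indicator {0<..} t * (wl1 t)\<^sup>2)"
    and el: "(LINT t|lborel. indicator {0<..} t * (wl1 t)\<^sup>2) < 1 / dl + \<epsilon>"
    by (rule half_bump_exists[OF dl less_add_pos[of "1 / dl"], of "\<alpha> k / 2"]) (rule that)
  note hr = hr[unfolded half_bump_def] and hl = hl[unfolded half_bump_def]
  define M where "M = Lr + Ll"
  have M: "M > 0" "Lr \<le> M" "Ll \<le> M" using hr hl by (auto simp: M_def)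
  define u where "u t = (if p \<le> t then wr (t - p) else wl (p - t))" for t
  define u1 where "u1 t = (if p < t then wr1 (t - p) else - wl1 (p - t))" for t
  define u2 where "u2 t = (if p < t then wr2 (t - p) else wl2 (p - t))" for t
  have dwr: "(wr has_real_derivative wr1 t) (at t)" and dwl: "(wl has_real_derivative wl1 t) (at t)" for t
    using hr hl by simp_all
  have dwr1: "(wr1 has_real_derivative wr2 t) (at t)" if "t \<noteq> dr" for t using hr that by simp
  have dwl1: "(wl1 has_real_derivative wl2 t) (at t)" if "t \<noteq> dl" for t using hl that by simp
  have [measurable]: "wr2 \<in> borel_measurable borel" "wl2 \<in> borel_measurable borel"
    using hr hl by simp_all
  have cont_w1: "isCont wr1 t" "isCont wl1 t" for t
    using hr hl by (simp_all add: continuous_on_eq_continuous_at)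
  have cont_w: "isCont wr t" "isCont wl t" for t
    using dwr dwl by (blast intro: DERIV_isCont)+
  have [measurable]: "wr \<in> borel_measurable borel" "wl \<in> borel_measurable borel"
      "wr1 \<in> borel_measurable borel" "wl1 \<in> borel_measurable borel"
    using cont_w cont_w1 by (auto intro!: borel_measurable_continuous_onI continuous_at_imp_continuous_on)
  have du: "(u has_real_derivative u1 t) (at t)" if "t \<noteq> p" for t
  proof (cases "p < t")
    case True
    have "((\<lambda>t. wr (t - p)) has_real_derivative wr1 (t - p) * (1 - 0)) (at t)"
      by (rule DERIV_chain2[OF dwr]) (intro DERIV_diff DERIV_ident DERIV_const)
    then have "(u has_real_derivative wr1 (t - p) * (1 - 0)) (at t)"
      by (rule has_field_derivative_transform_within_open[of _ _ _ "{p<..}"]) (use True in \<open>auto simp: u_def\<close>)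
    then show ?thesis using True by (simp add: u1_def)
  next
    case False
    then have "t < p" using that by simp
    have "((\<lambda>t. wl (p - t)) has_real_derivative wl1 (p - t) * (0 - 1)) (at t)"
      by (rule DERIV_chain2[OF dwl]) (intro DERIV_diff DERIV_ident DERIV_const)
    then have "(u has_real_derivative wl1 (p - t) * (0 - 1)) (at t)"
      by (rule has_field_derivative_transform_within_open[of _ _ _ "{..<p}"]) (use \<open>t < p\<close> in \<open>auto simp: u_def\<close>)
    then show ?thesis using False by (simp add: u1_def)
  qed
  have du1: "(u1 has_real_derivative u2 t) (at t)" if "t \<noteq> p" "t \<noteq> p + dr" "t \<noteq> p - dl" for t
  proof (cases "p < t")
    case True
    have "((\<lambda>t. wr1 (t - p)) has_real_derivative wr2 (t - p) * (1 - 0)) (at t)"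
      by (rule DERIV_chain2[OF dwr1]) (use that in \<open>auto intro!: derivative_eq_intros\<close>)
    then have "(u1 has_real_derivative wr2 (t - p) * (1 - 0)) (at t)"
      by (rule has_field_derivative_transform_within_open[of _ _ _ "{p<..}"]) (use True in \<open>auto simp: u1_def\<close>)
    then show ?thesis using True by (simp add: u2_def)
  next
    case False
    then have "t < p" using that by simp
    have "((\<lambda>t. wl1 (p - t)) has_real_derivative wl2 (p - t) * (0 - 1)) (at t)"
      by (rule DERIV_chain2[OF dwl1]) (use that in \<open>auto intro!: derivative_eq_intros\<close>)
    then have "((\<lambda>t. - wl1 (p - t)) has_real_derivative - (wl2 (p - t) * (0 - 1))) (at t)"
      by (rule DERIV_minus)
    then have "(u1 has_real_derivative - (wl2 (p - t) * (0 - 1))) (at t)"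
      by (rule has_field_derivative_transform_within_open[of _ _ _ "{..<p}"]) (use \<open>t < p\<close> in \<open>auto simp: u1_def\<close>)
    then show ?thesis using False by (simp add: u2_def)
  qed
  have out: "u t = 0" "u1 t = 0" "u2 t = 0" if "t \<ge> p + dr \<or> t \<le> p - dl" for t
    using that hr hl dl dr by (auto simp: u_def u1_def u2_def)
  define F where "F t = complex_of_real (u t)" for t
  have of_real_deriv: "((\<lambda>t. complex_of_real (h t)) has_vector_derivative of_real h') (at t)"
    if "(h has_real_derivative h') (at t)" for h h' t
    using bounded_linear.has_vector_derivative[OF bounded_linear_of_real] that
    by (simp add: has_real_derivative_iff_has_vector_derivative)
  have dF: "(F has_vector_derivative of_real (u1 t)) (at t)" if "t \<noteq> p" for t
    unfolding F_def by (rule of_real_deriv[OF du[OF that]])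
  then have dF': "derivative F t = of_real (u1 t)" if "t \<noteq> p" for t
    using that by (simp add: vector_derivative_at)
  have ddF: "(derivative F has_vector_derivative of_real (u2 t)) (at t)" if "t \<noteq> p" "t \<noteq> p + dr" "t \<noteq> p - dl" for t
    using of_real_deriv[OF du1[OF that]]
    by (rule has_vector_derivative_transform_within_open[of _ _ _ "- {p}"]) (use that dF' in auto)
  have AE3: "AE t in lebesgue. t \<noteq> p \<and> t \<noteq> p + dr \<and> t \<noteq> p - dl"
  proof -
    have "{p, p + dr, p - dl} \<in> null_sets lborel" by (intro countable_imp_null_set_lborel) auto
    then have "AE t in lebesgue. t \<notin> {p, p + dr, p - dl}"
      by (intro AE_not_in null_sets_completionI)
    then show ?thesis by eventually_elim simp
  qed
  have bnd: "\<bar>u t\<bar> \<le> M" "\<bar>u2 t\<bar> \<le> M" for t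
  proof -
    have "\<bar>wr s\<bar> \<le> M \<and> \<bar>wr2 s\<bar> \<le> M \<and> \<bar>wl s\<bar> \<le> M \<and> \<bar>wl2 s\<bar> \<le> M" if "s \<ge> 0" for s
      using hr hl M that by (meson order_trans)
    then show "\<bar>u t\<bar> \<le> M" "\<bar>u2 t\<bar> \<le> M" by (auto simp: u_def u2_def)
  qed
  have sqF: "square_integrable F"
    unfolding F_def
  proof (rule square_integrable_bounded_support[of _ M "p - dl" "p + dr"])
    show "u \<in> borel_measurable borel" unfolding u_def by measurable
    show "u t = 0" if "t \<notin> {p - dl..p + dr}" for t using that by (intro out) auto
  qed (rule bnd)
  have sq2: "square_integrable (derivative (derivative F))"
  proof (rule square_integrable_cong_AE)
    show "square_integrable (\<lambda>t. complex_of_real (u2 t))"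
    proof (rule square_integrable_bounded_support[of _ M "p - dl" "p + dr"])
      show "u2 \<in> borel_measurable borel" unfolding u2_def by measurable
      show "u2 t = 0" if "t \<notin> {p - dl..p + dr}" for t using that by (intro out) auto
    qed (rule bnd)
    show "AE t in lebesgue. complex_of_real (u2 t) = derivative (derivative F) t"
      using AE3 by eventually_elim (simp add: vector_derivative_at[OF ddF])
  qed
  have lip: "\<bar>u s - u t\<bar> \<le> M * \<bar>s - t\<bar> \<and> \<bar>u1 s - u1 t\<bar> \<le> M * \<bar>s - t\<bar>"
    if "p < s \<and> p < t \<or> s < p \<and> t < p" for s t
  proof -
    have le: "Lr * \<bar>s - t\<bar> \<le> M * \<bar>s - t\<bar>" "Ll * \<bar>s - t\<bar> \<le> M * \<bar>s - t\<bar>"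
      using M by (auto intro: mult_right_mono)
    have lr: "\<bar>wr a - wr b\<bar> \<le> Lr * \<bar>a - b\<bar>" "\<bar>wr1 a - wr1 b\<bar> \<le> Lr * \<bar>a - b\<bar>" if "0 \<le> a" "0 \<le> b" for a b
      using hr that by blast+
    have ll: "\<bar>wl a - wl b\<bar> \<le> Ll * \<bar>a - b\<bar>" "\<bar>wl1 a - wl1 b\<bar> \<le> Ll * \<bar>a - b\<bar>" if "0 \<le> a" "0 \<le> b" for a b
      using hl that by blast+
    show ?thesis
      using that
    proof
      assume st: "p < s \<and> p < t"
      then show ?thesis
        using lr[of "s - p" "t - p"] le by (simp add: u_def u1_def)
    next
      assume st: "s < p \<and> t < p"
      then show ?thesis
        using ll[of "p - s" "p - t"] le by (simp add: u_def u1_def abs_minus_commute)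
    qed
  qed
  \<comment> \<open>An interval off \<open>X\<close> avoids \<open>p\<close> and lies on one side of
    it, where a single half bump supplies the Lipschitz bound.\<close>
  have side: "p < s \<and> p < t \<or> s < p \<and> t < p" if "{a..b} \<subseteq> - X" "s \<in> {a..b}" "t \<in> {a..b}" for a b s t
  proof -
    have "p \<notin> {a..b}" using that(1) pX by blast
    then show ?thesis using that by auto
  qed
  have "AC_loc (- X) F"
    unfolding AC_loc_def
  proof (intro allI impI absolutely_continuous_on_Lipschitz[OF M(1)])
    fix a b s t assume "{a..b} \<subseteq> - X" "s \<in> {a..b}" "t \<in> {a..b}"
    then show "cmod (F s - F t) \<le> M * \<bar>s - t\<bar>"
      using lip[OF side] by (simp add: F_def flip: of_real_diff)
  qed
  moreover have "AC_loc (- X) (derivative F)"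
    unfolding AC_loc_def
  proof (intro allI impI absolutely_continuous_on_Lipschitz[OF M(1)])
    fix a b s t assume st: "{a..b} \<subseteq> - X" "s \<in> {a..b}" "t \<in> {a..b}"
    then have "s \<noteq> p" "t \<noteq> p" using side[OF st] by auto
    then show "cmod (derivative F s - derivative F t) \<le> M * \<bar>s - t\<bar>"
      using lip[OF side[OF st]] by (simp add: dF' flip: of_real_diff)
  qed
  moreover have "\<forall>t\<in>- X. F differentiable (at t)"
    using dF pX by (metis ComplD differentiableI_vector)
  moreover have "AE t in lebesgue. derivative F differentiable (at t)"
    using AE3 by eventually_elim (use ddF in \<open>blast intro: differentiableI_vector\<close>)
  ultimately have W: "F \<in> W22 X" using sqF sq2 by (simp add: W22_def)
  have "\<exists>a b. (F \<longlongrightarrow> (if j = k then 1 else 0)) (at_right (x j)) \<and> (F \<longlongrightarrow> (if j = k then 1 else 0)) (at_left (x j)) \<and>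
     (derivative F \<longlongrightarrow> a) (at_right (x j)) \<and> (derivative F \<longlongrightarrow> b) (at_left (x j)) \<and>
     a - b = of_real (\<alpha> j) * (if j = k then 1 else 0)" if j: "j \<ge> 1" for j
  proof (cases "j = k")
    case True
    have tr: "((\<lambda>t. complex_of_real (h (t - p))) \<longlongrightarrow> of_real (h 0)) (at_right p)" if "isCont h 0" for h :: "real \<Rightarrow> real"
    proof -
      have "isCont (\<lambda>t. h (t - p)) p"
        by (rule isCont_shift_reflect) (use that in simp)
      then have "((\<lambda>t. h (t - p)) \<longlongrightarrow> h 0) (at_right p)"
        by (simp add: isCont_def filterlim_at_split)
      then show ?thesis by (rule tendsto_of_real)
    qed
    have tl: "((\<lambda>t. complex_of_real (h (p - t))) \<longlongrightarrow> of_real (h 0)) (at_left p)" if "isCont h 0" for h :: "real \<Rightarrow> real"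
    proof -
      have "isCont (\<lambda>t. h (p - t)) p"
        by (rule isCont_shift_reflect) (use that in simp)
      then have "((\<lambda>t. h (p - t)) \<longlongrightarrow> h 0) (at_left p)"
        by (simp add: isCont_def filterlim_at_split)
      then show ?thesis by (rule tendsto_of_real)
    qed
    have evr: "\<forall>\<^sub>F t in at_right p. p < t" by (rule eventually_at_right_less)
    have evl: "\<forall>\<^sub>F t in at_left p. t < p" by (simp add: eventually_at_filter)
    have "(F \<longlongrightarrow> of_real (wr 0)) (at_right p)"
      by (rule Lim_transform_eventually[OF tr[OF cont_w(1)]])
         (use evr in eventually_elim, simp add: F_def u_def)
    moreover have "(F \<longlongrightarrow> of_real (wl 0)) (at_left p)"
      by (rule Lim_transform_eventually[OF tl[OF cont_w(2)]])
         (use evl in eventually_elim, simp add: F_def u_def)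
    moreover have "(derivative F \<longlongrightarrow> of_real (wr1 0)) (at_right p)"
      by (rule Lim_transform_eventually[OF tr[OF cont_w1(1)]])
         (use evr in eventually_elim, simp add: dF' u1_def)
    moreover have "(derivative F \<longlongrightarrow> - of_real (wl1 0)) (at_left p)"
      by (rule Lim_transform_eventually[OF tendsto_minus[OF tl[OF cont_w1(2)]]])
         (use evl in eventually_elim, simp add: dF' u1_def)
    moreover have "complex_of_real (wr1 0) - (- of_real (wl1 0)) = of_real (\<alpha> k)"
      using hr hl by (simp flip: of_real_add)
    moreover have "wr 0 = 1" "wl 0 = 1" using hr hl by simp_all
    ultimately have "(F \<longlongrightarrow> 1) (at_right (x k)) \<and> (F \<longlongrightarrow> 1) (at_left (x k)) \<and>
        (derivative F \<longlongrightarrow> of_real (wr1 0)) (at_right (x k)) \<and> (derivative F \<longlongrightarrow> (- of_real (wl1 0))) (at_left (x k)) \<and>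
        of_real (wr1 0) - (- of_real (wl1 0)) = complex_of_real (\<alpha> k)"
      unfolding p_def by simp
    then have "\<exists>a b. (F \<longlongrightarrow> 1) (at_right (x k)) \<and> (F \<longlongrightarrow> 1) (at_left (x k)) \<and>
        (derivative F \<longlongrightarrow> a) (at_right (x k)) \<and> (derivative F \<longlongrightarrow> b) (at_left (x k)) \<and>
        a - b = complex_of_real (\<alpha> k)"
      by (intro exI)
    then show ?thesis by (simp add: True)
  next
    case False
    have far: "x j \<ge> p + dr \<or> x j \<le> p - dl"
      using left[of j] right[of j] j False by (cases "j < k") (auto simp: p_def)
    then have ne: "x j \<noteq> p" using dl dr by auto
    have "isCont F (x j)" by (rule has_vector_derivative_continuous[OF dF[OF ne]])
    then have "(F \<longlongrightarrow> 0) (at (x j))" using out(1)[OF far] by (simp add: isCont_def F_def)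
    moreover have "(derivative F \<longlongrightarrow> 0) (at (x j))"
    proof -
      have "isCont u1 (x j)"
      proof (cases "p < x j")
        case True
        have "isCont (\<lambda>t. wr1 (t - p)) (x j)"
          by (rule isCont_shift_reflect(1)[OF cont_w1(1)])
        moreover have "\<forall>\<^sub>F t in nhds (x j). u1 t = wr1 (t - p)"
          unfolding eventually_nhds by (rule exI[of _ "{p<..}"]) (use True in \<open>auto simp: u1_def\<close>)
        ultimately show ?thesis by (simp add: isCont_cong)
      next
        case False
        have "isCont (\<lambda>t. - wl1 (p - t)) (x j)"
          by (rule continuous_minus[OF isCont_shift_reflect(2)[OF cont_w1(2)]])
        moreover have "\<forall>\<^sub>F t in nhds (x j). u1 t = - wl1 (p - t)"
          unfolding eventually_nhds by (rule exI[of _ "{..<p}"]) (use False ne in \<open>auto simp: u1_def\<close>)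
        ultimately show ?thesis by (simp add: isCont_cong)
      qed
      then have "((\<lambda>t. complex_of_real (u1 t)) \<longlongrightarrow> of_real (u1 (x j))) (at (x j))"
        by (intro tendsto_of_real) (simp add: isCont_def)
      moreover have "\<forall>\<^sub>F t in at (x j). complex_of_real (u1 t) = derivative F t"
        unfolding eventually_at_topological
        by (rule exI[of _ "- {p}"]) (use ne in \<open>auto simp: dF'\<close>)
      ultimately have "(derivative F \<longlongrightarrow> of_real (u1 (x j))) (at (x j))"
        by (rule Lim_transform_eventually)
      then show ?thesis using out(2)[OF far] by simp
    qed
    ultimately show ?thesis
      using False by (intro exI[of _ 0]) (simp add: filterlim_at_split)
  qed
  then have dd: "delta_dom \<alpha> F (\<lambda>j. if j = k then 1 else 0)"
    using W unfolding delta_dom_def by blast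
  \<comment> \<open>The square of the derivative away from \<open>p\<close>, with the reflected half
    first brought into the affine form that the change of variables expects.\<close>
  define h where "h t = indicator {0<..} (- p + 1 * t) * (wr1 (- p + 1 * t))\<^sup>2 + indicator {0<..} (p + (- 1) * t) * (wl1 (p + (- 1) * t))\<^sup>2" for t
  have h_int: "integrable lborel h"
    unfolding h_def by (intro Bochner_Integration.integrable_add lborel_integrable_real_affine[OF ir] lborel_integrable_real_affine[OF il]) auto
  have h_val: "(LINT t|lborel. h t) = (LINT t|lborel. indicator {0<..} t * (wr1 t)\<^sup>2) + (LINT t|lborel. indicator {0<..} t * (wl1 t)\<^sup>2)"
    unfolding h_def
    using lborel_integral_real_affine[of 1 "\<lambda>t. indicator {0<..} t * (wr1 t)\<^sup>2" "- p"]
      lborel_integral_real_affine[of "- 1" "\<lambda>t. indicator {0<..} t * (wl1 t)\<^sup>2" p]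
    by (subst Bochner_Integration.integral_add)
       (auto intro: lborel_integrable_real_affine[OF ir, of 1 "- p", simplified] lborel_integrable_real_affine[OF il, of "- 1" p, simplified])
  have h_eq: "h t = (cmod (derivative F t))\<^sup>2" if "t \<noteq> p" for t
    using that by (auto simp: h_def dF' u1_def split: split_indicator)
  have AEh: "AE t in lebesgue. h t = (cmod (derivative F t))\<^sup>2"
    using AE3 by eventually_elim (simp add: h_eq)
  have [measurable]: "h \<in> borel_measurable lborel" using h_int by auto
  have h_int': "integrable lebesgue h" using h_int by (simp add: integrable_completion)
  have mF: "(\<lambda>t. (cmod (derivative F t))\<^sup>2) \<in> borel_measurable lebesgue"
    by (rule borel_measurable_AE[OF _ AEh]) (use h_int' in auto)
  have F_int: "integrable lebesgue (\<lambda>t. (cmod (derivative F t))\<^sup>2)"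
    by (rule integrable_cong_AE_imp[OF h_int' mF AEh])
  have "(LINT t|lebesgue. (cmod (derivative F t))\<^sup>2) = (LINT t|lebesgue. h t)"
    by (rule integral_cong_AE) (use mF h_int' AEh in auto)
  also have "\<dots> = (LINT t|lborel. h t)" by (simp add: integral_completion)
  also have "\<dots> < 1 / dr + \<epsilon> + (1 / dl + \<epsilon>)" unfolding h_val using er el by simp
  finally have "2 * (LINT t|lebesgue. (cmod (derivative F t))\<^sup>2) + \<alpha> k < 2 * (1 / dl + 1 / dr) + 4 * \<epsilon> + \<alpha> k"
    by simp
  also have "\<dots> < 0" using energy unfolding \<epsilon>_def by (simp add: field_simps)
  finally have en: "2 * (LINT t|lebesgue. (cmod (derivative F t))\<^sup>2) + \<alpha> k < 0" .
  show ?thesis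
  proof (rule that[OF dd _ _ F_int en])
    fix t assume t: "t \<notin> {x k - dl..x k + dr}"
    then have "t \<ge> p + dr \<or> t \<le> p - dl" "t \<noteq> p" using dl dr by (auto simp: p_def)
    then show "F t = 0" "derivative F t = 0" using out by (simp_all add: F_def dF')
  qed
qed

end

section \<open>Counting negative squares\<close>

lemma square_integrable_sum:
  assumes "\<And>i. i \<in> I \<Longrightarrow> square_integrable (f i)"
  shows "square_integrable (\<lambda>t. \<Sum>i\<in>I. a i * f i t)"
  using assms
proof (induction I rule: infinite_finite_induct)
  case (insert i I)
  then show ?case
    using square_integrable_add[OF square_integrable_scale[of "f i" "a i"] insert.IH] by simp
qed (simp_all add: square_integrable_zero)

lemma abs_L2_sum:
  assumes "\<And>i. i \<in> I \<Longrightarrow> square_integrable (f i)"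
  shows "abs_L2 (\<lambda>t. \<Sum>i\<in>I. a i * f i t) = (\<Sum>i\<in>I. scaleC (a i) (abs_L2 (f i)))"
  using assms
proof (induction I rule: infinite_finite_induct)
  case (insert i I)
  have sq: "square_integrable (f i)" "square_integrable (\<lambda>t. \<Sum>i\<in>I. a i * f i t)"
    using insert.prems by (auto intro: square_integrable_sum)
  have IH: "abs_L2 (\<lambda>t. \<Sum>i\<in>I. a i * f i t) = (\<Sum>i\<in>I. scaleC (a i) (abs_L2 (f i)))"
    by (rule insert.IH) (use insert.prems in auto)
  have "abs_L2 (\<lambda>t. \<Sum>i\<in>insert i I. a i * f i t)
      = abs_L2 (\<lambda>t. a i * f i t) + abs_L2 (\<lambda>t. \<Sum>i\<in>I. a i * f i t)"
    using insert.hyps sq by (simp add: plus_abs_L2 square_integrable_scale)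
  then show ?case
    unfolding IH scaleC_abs_L2[OF sq(1), symmetric] using insert.hyps by simp
qed (simp_all add: zero_L2_def)

context projection_measure
begin

section \<open>Exhausting the negative half-line by windows\<close>

lemma subspace_range_E:
  assumes "B \<in> sets borel"
  shows "L2_complex.subspace (range (E B))"
proof (rule L2_complex.subspaceI)
  show "0 \<in> range (E B)" using E_zero[OF assms] by (metis rangeI)
  show "v + w \<in> range (E B)" if vw: "v \<in> range (E B)" "w \<in> range (E B)" for v w
  proof -
    obtain p q where "v = E B p" "w = E B q" using vw by blast
    then have "v + w = E B (p + q)" by (simp add: E_add assms)
    then show ?thesis by blast
  qed
  show "scaleC c v \<in> range (E B)" if v: "v \<in> range (E B)" for c v
  proof -
    obtain p where "v = E B p" using v by blast
    then have "scaleC c v = E B (scaleC c p)" by (simp add: E_scaleC assms)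
    then show ?thesis by blast
  qed
qed

lemma range_E_iff: "B \<in> sets borel \<Longrightarrow> v \<in> range (E B) \<longleftrightarrow> E B v = v"
  using E_idem by (metis rangeE rangeI)

text \<open>Staying away from minus infinity puts the range of \<open>E\<close> on the window into
  the domain; staying away from 0 makes the form negative definite on it.\<close>

definition negative_window :: "nat \<Rightarrow> real set" where
  "negative_window n = {- real (Suc n)..- (1 / real (Suc n))}"

lemma negative_window_borel: "negative_window n \<in> sets borel"
  by (simp add: negative_window_def)

lemma negative_window_mono: "m \<le> n \<Longrightarrow> negative_window m \<subseteq> negative_window n"
  unfolding negative_window_def by (auto intro: order_trans[OF _ le_imp_neg_le] simp: frac_le)

lemma UN_negative_window: "(\<Union>n. negative_window n) = {..<0}"
proof
  have "- (1 / real (Suc n)) < 0" for n by simp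
  then show "(\<Union>n. negative_window n) \<subseteq> {..<0}"
    unfolding negative_window_def by (force intro: le_less_trans)
  show "{..<0} \<subseteq> (\<Union>n. negative_window n)"
  proof
    fix s :: real assume "s \<in> {..<0}"
    then have s: "s < 0" by simp
    obtain n1 :: nat where n1: "- s < real n1" using reals_Archimedean2 by blast
    obtain n2 :: nat where n2: "1 / (- s) < real n2" using reals_Archimedean2 by blast
    define n where "n = max n1 n2"
    have "- s \<le> real (Suc n)" "1 / (- s) \<le> real (Suc n)" using n1 n2 by (auto simp: n_def)
    then have "- real (Suc n) \<le> s" "1 / real (Suc n) \<le> - s"
      using s by (auto simp: field_simps)
    then have "s \<in> negative_window n" unfolding negative_window_def by simp
    then show "s \<in> (\<Union>n. negative_window n)" by blast
  qed
qed

text \<open>The ranges of \<open>E\<close> on the windows increase, so a common bound for their dimensions makes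
  them eventually constant, and by \<open>\<sigma>\<close>-additivity equal to the range of \<open>E {..<0}\<close>.\<close>

lemma complex_dim_negative_le:
  assumes bound: "\<And>n S. finite S \<Longrightarrow> S \<subseteq> range (E (negative_window n)) \<Longrightarrow> L2_complex.independent S \<Longrightarrow> card S \<le> m"
  shows "complex_dim (range (E {..<0})) \<le> enat m"
proof -
  \<comment> \<open>The sizes of independent families inside some window. They are bounded by
    \<open>m\<close>, so a largest one exists.\<close>
  define good where "good j \<longleftrightarrow> (\<exists>n S. finite S \<and> S \<subseteq> range (E (negative_window n)) \<and> L2_complex.independent S \<and> card S = j)" for j
  have good0: "good 0"
    unfolding good_def by (intro exI[of _ 0] exI[of _ "{}"]) (simp add: L2_complex.independent_empty)
  have "j \<le> m" if "good j" for j
    using that bound unfolding good_def by blast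
  then obtain j where j: "good j" "\<And>i. good i \<Longrightarrow> i \<le> j"
    using ex_has_greatest_nat[of good 0 id "Suc m"] good0 by (auto simp: less_Suc_eq_le)
  obtain n S where S: "finite S" "S \<subseteq> range (E (negative_window n))" "L2_complex.independent S" "card S = j"
    using j(1) unfolding good_def by blast
  let ?C = negative_window
  note C = negative_window_borel
  \<comment> \<open>Maximality of \<open>j\<close>: a vector of a later window outside the span of
    \<open>S\<close> would enlarge \<open>S\<close> to an independent family of \<open>j + 1\<close>
    elements.\<close>
  have fix_n: "E (?C n) v = v" if "n \<le> n'" "E (?C n') v = v" for n' v
  proof -
    have sub: "range (E (?C n)) \<subseteq> range (E (?C n'))"
    proof
      fix w assume "w \<in> range (E (?C n))"
      then have w: "E (?C n) w = w" by (simp add: range_E_iff C)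
      have "?C n' \<inter> ?C n = ?C n" using negative_window_mono[OF that(1)] by blast
      then have "E (?C n') w = w" using E_Int[OF C C, of n' n w] w by simp
      then show "w \<in> range (E (?C n'))" by (simp add: range_E_iff C)
    qed
    have "v \<in> L2_complex.span S"
    proof (rule ccontr)
      assume v: "v \<notin> L2_complex.span S"
      then have "v \<notin> S" using L2_complex.span_base by blast
      have "L2_complex.independent (insert v S)"
        using v S(3) \<open>v \<notin> S\<close> by (simp add: L2_complex.independent_insert)
      moreover have "v \<in> range (E (?C n'))" using that(2) by (simp add: range_E_iff C)
      ultimately have "good (Suc j)"
        unfolding good_def using S sub \<open>v \<notin> S\<close>
        by (intro exI[of _ n'] exI[of _ "insert v S"]) auto
      then show False using j(2)[of "Suc j"] by simp
    qed
    then have "v \<in> range (E (?C n))"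
      using L2_complex.span_minimal[OF S(2) subspace_range_E[OF C]] by blast
    then show ?thesis by (simp add: range_E_iff C)
  qed
  have all: "range (E {..<0}) \<subseteq> range (E (?C n))"
  proof
    fix v assume "v \<in> range (E {..<0})"
    then have v: "E {..<0} v = v" by (simp add: range_E_iff)
    interpret finite_measure "\<mu> v" by (rule finite_measure_scalar_measure)
    \<comment> \<open>Continuity from below of the scalar measure, whose values on the windows are
      constant from \<open>n\<close> on. So the rest of the negative half-line is null for
      \<open>v\<close>, and the projection of \<open>v\<close> to it is 0.\<close>
    have "(\<lambda>i. measure (\<mu> v) (?C i)) \<longlonglongrightarrow> measure (\<mu> v) (\<Union>i. ?C i)"
      by (rule finite_Lim_measure_incseq) (auto simp: C intro!: incseq_SucI negative_window_mono)
    moreover have "measure (\<mu> v) (?C i) = measure (\<mu> v) (?C n)" if "n \<le> i" for i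
    proof -
      have "?C n \<inter> ?C i = ?C n" using negative_window_mono[OF that] by blast
      moreover have "E (?C n) (E (?C i) v) = E (?C i) v"
        by (rule fix_n[OF that]) (rule E_idem[OF C])
      ultimately have "E (?C i) v = E (?C n) v" using E_Int[OF C C, of n i v] by simp
      then show ?thesis by (simp add: measure_scalar_measure C)
    qed
    then have "(\<lambda>i. measure (\<mu> v) (?C i)) \<longlonglongrightarrow> measure (\<mu> v) (?C n)"
      by (intro tendsto_eventually eventually_sequentiallyI)
    ultimately have "measure (\<mu> v) {..<0} = measure (\<mu> v) (?C n)"
      using LIMSEQ_unique unfolding UN_negative_window by blast
    moreover have sub: "?C n \<subseteq> {..<0}" using UN_negative_window by blast
    ultimately have "measure (\<mu> v) ({..<0} - ?C n) = 0"
      by (subst finite_measure_Diff) (auto simp: C)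
    then have "E ({..<0} - ?C n) v = 0"
      using C by (simp add: measure_scalar_measure)
    moreover have "E (?C n \<union> ({..<0} - ?C n)) v = E (?C n) v + E ({..<0} - ?C n) v"
      by (rule E_disjoint_Un) (use C in auto)
    moreover have "?C n \<union> ({..<0} - ?C n) = {..<0}" using sub by blast
    ultimately have "E (?C n) v = v" using v by simp
    then show "v \<in> range (E (?C n))" by (simp add: range_E_iff C)
  qed
  show ?thesis
    by (rule complex_dim_le) (rule bound, use all in auto)
qed

end

context interaction_points
begin

section \<open>The lower and the upper bound of the count\<close>

lemma delta_dom_W22: "delta_dom \<alpha> f c \<Longrightarrow> f \<in> W22 X"
  by (simp add: delta_dom_def)

lemma delta_dom_square_integrable: "delta_dom \<alpha> f c \<Longrightarrow> square_integrable f"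
  using W22_D(1)[OF delta_dom_W22] .

lemma delta_operator_form:
  assumes f: "delta_dom \<alpha> f c"
  obtains g where "(abs_L2 f, g) \<in> delta_operator x \<alpha>"
    "Re (cinner g (abs_L2 f)) = - (LINT t|lebesgue. form_density f t)"
proof
  let ?g = "\<lambda>t. - derivative (derivative f) t"
  have W: "f \<in> W22 X" using f by (rule delta_dom_W22)
  show "(abs_L2 f, abs_L2 ?g) \<in> delta_operator x \<alpha>"
    unfolding delta_operator_iff using f by blast
  have sq: "square_integrable ?g" "square_integrable f"
    using W22_D(1,4)[OF W] square_integrable_uminus by auto
  have "Re (cinner (abs_L2 ?g) (abs_L2 f)) = Re (LINT t|lebesgue. ?g t * cnj (f t))"
    by (simp add: cinner_abs_L2 sq)
  also have "\<dots> = (LINT t|lebesgue. Re (?g t * cnj (f t)))"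
    by (rule integral_Re[symmetric]) (rule integrable_mult_cnj[OF sq])
  also have "\<dots> = (LINT t|lebesgue. - form_density f t)"
    by (simp add: form_density_def)
  finally show "Re (cinner (abs_L2 ?g) (abs_L2 f)) = - (LINT t|lebesgue. form_density f t)"
    by simp
qed

lemma derivative_sum:
  assumes "\<And>i. i \<in> I \<Longrightarrow> f i \<in> W22 X" "t \<notin> X"
  shows "derivative (\<lambda>t. \<Sum>i\<in>I. a i * f i t) t = (\<Sum>i\<in>I. a i * derivative (f i) t)"
proof (rule vector_derivative_at)
  show "((\<lambda>t. \<Sum>i\<in>I. a i * f i t) has_vector_derivative (\<Sum>i\<in>I. a i * derivative (f i) t)) (at t)"
    by (intro has_vector_derivative_sum has_vector_derivative_mult_right W22_D(6) assms)
qed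

lemma x_gap: "1 \<le> k \<Longrightarrow> x k + gap x k = x (Suc k)" and gap_pos: "1 \<le> k \<Longrightarrow> 0 < gap x k"
  using x_less_iff[of k "Suc k"] by (simp_all add: gap_def)

lemma x_le: "1 \<le> j \<Longrightarrow> j \<le> k \<Longrightarrow> x j \<le> x k"
  using x_less_iff[of j k] by (cases "j = k") auto

text \<open>For \<open>k > 1\<close> the bump extends exactly to the neighbours of
  \<open>x k\<close>. For \<open>k = 1\<close> no neighbour limits it to the left, and a
  sufficiently wide left half makes its energy negligible.\<close>

lemma bump_for_index:
  assumes k: "k \<ge> 1" and \<alpha>: "\<alpha> k < - 2 * (inverse_gap x (k - 1) + inverse_gap x k)"
  shows "\<exists>f a b. delta_dom \<alpha> f (\<lambda>j. if j = k then 1 else 0) \<and>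
    (\<forall>j. 1 \<le> j \<and> j < k \<longrightarrow> x j \<le> a) \<and> (\<forall>j>k. b \<le> x j) \<and>
    (\<forall>t. t \<notin> {a..b} \<longrightarrow> f t = 0 \<and> derivative f t = 0) \<and>
    integrable lebesgue (\<lambda>t. (cmod (derivative f t))\<^sup>2) \<and>
    2 * (LINT t|lebesgue. (cmod (derivative f t))\<^sup>2) + \<alpha> k < 0"
proof -
  have dr: "gap x k > 0" by (rule gap_pos[OF k])
  have "\<exists>dl>0. (\<forall>j. 1 \<le> j \<and> j < k \<longrightarrow> x j \<le> x k - dl) \<and> 2 * (1 / dl + 1 / gap x k) + \<alpha> k < 0"
  proof (cases "k = 1")
    case True
    \<comment> \<open>The slack in the hypothesis. With the left width \<open>4 / r\<close> the
      doubled energy of the left half costs \<open>r / 2\<close>, half of it.\<close>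
    define r where "r = - (\<alpha> k + 2 / gap x k)"
    have r: "r > 0" using \<alpha> True by (simp add: r_def inverse_gap_def)
    have "2 * (1 / (4 / r) + 1 / gap x k) + \<alpha> k = r / 2 + 2 / gap x k + \<alpha> k"
      by (simp add: distrib_left)
    also have "\<dots> = - r / 2" using r_def by linarith
    finally have "2 * (1 / (4 / r) + 1 / gap x k) + \<alpha> k = - r / 2" .
    then show ?thesis using r True by (intro exI[of _ "4 / r"]) auto
  next
    case False
    then have k1: "1 \<le> k - 1" using k by simp
    have xk: "x k - gap x (k - 1) = x (k - 1)" using x_gap[OF k1] k by simp
    have "2 * (1 / gap x (k - 1) + 1 / gap x k) + \<alpha> k < 0"
      using \<alpha> k False by (simp add: inverse_gap_def)
    moreover have "x j \<le> x (k - 1)" if "1 \<le> j" "j < k" for j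
      using that by (intro x_le) auto
    ultimately show ?thesis using gap_pos[OF k1] xk by (intro exI[of _ "gap x (k - 1)"]) auto
  qed
  then obtain dl where dl: "dl > 0" "\<And>j. 1 \<le> j \<Longrightarrow> j < k \<Longrightarrow> x j \<le> x k - dl"
      "2 * (1 / dl + 1 / gap x k) + \<alpha> k < 0"
    by blast
  have right: "x k + gap x k \<le> x j" if "k < j" for j
    unfolding x_gap[OF k] using that by (intro x_le) auto
  show ?thesis
  proof (rule bump_exists[of k dl "gap x k" \<alpha>, OF k dl(1) dr dl(2) right dl(3)])
    fix f
    assume f: "delta_dom \<alpha> f (\<lambda>j. if j = k then 1 else 0)"
      "\<And>t. t \<notin> {x k - dl..x k + gap x k} \<Longrightarrow> f t = 0"
      "\<And>t. t \<notin> {x k - dl..x k + gap x k} \<Longrightarrow> derivative f t = 0"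
      "integrable lebesgue (\<lambda>t. (cmod (derivative f t))\<^sup>2)"
      "2 * (LINT t|lebesgue. (cmod (derivative f t))\<^sup>2) + \<alpha> k < 0"
    show ?thesis
      by (intro exI[of _ f] exI[of _ "x k - dl"] exI[of _ "x k + gap x k"] conjI allI impI)
         (use f dl right in auto)
  qed
qed

lemma negative_squares_ge:
  assumes E: "is_spectral_measure_of E (delta_operator x \<alpha>)" and K: "finite K" "K \<subseteq> {1..}"
    and \<alpha>: "\<And>k. k \<in> K \<Longrightarrow> \<alpha> k < - 2 * (inverse_gap x (k - 1) + inverse_gap x k)"
  shows "enat (card K) \<le> negative_squares E"
proof -
  interpret projection_measure E
    using E by unfold_locales (simp add: is_spectral_measure_of_def)
  have T: "delta_operator x \<alpha> = spectral_integral E" using E by (simp add: is_spectral_measure_of_def)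
  define bump where "bump k f a b \<longleftrightarrow> delta_dom \<alpha> f (\<lambda>j. if j = k then 1 else 0) \<and>
    (\<forall>j. 1 \<le> j \<and> j < k \<longrightarrow> x j \<le> a) \<and> (\<forall>j>k. b \<le> x j) \<and>
    (\<forall>t. t \<notin> {a..b} \<longrightarrow> f t = 0 \<and> derivative f t = 0) \<and>
    integrable lebesgue (\<lambda>t. (cmod (derivative f t))\<^sup>2) \<and>
    2 * (LINT t|lebesgue. (cmod (derivative f t))\<^sup>2) + \<alpha> k < 0" for k f and a b :: real
  have "\<exists>f a b. bump k f a b" if "k \<in> K" for k
    unfolding bump_def using K that by (intro bump_for_index \<alpha>) auto
  then obtain f a b where "\<And>k. k \<in> K \<Longrightarrow> bump k (f k) (a k) (b k)"
    by metis
  note fk = this[unfolded bump_def]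
  have dom: "delta_dom \<alpha> (f k) (\<lambda>j. if j = k then 1 else 0)" if "k \<in> K" for k
    using fk[OF that] by blast
  have W: "f k \<in> W22 X" if "k \<in> K" for k using delta_dom_W22[OF dom[OF that]] .
  have sq: "square_integrable (f k)" if "k \<in> K" for k using W22_D(1)[OF W[OF that]] .
  have int: "integrable lebesgue (\<lambda>t. (cmod (derivative (f k) t))\<^sup>2)" if "k \<in> K" for k
    using fk[OF that] by blast
  have energy: "2 * (LINT t|lebesgue. (cmod (derivative (f k) t))\<^sup>2) + \<alpha> k < 0" if "k \<in> K" for k
    using fk[OF that] by blast
  have supp: "t \<in> {a k..b k}" if "k \<in> K" "f k t \<noteq> 0 \<or> derivative (f k) t \<noteq> 0" for k t
    using fk[OF that(1)] that(2) by blast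
  \<comment> \<open>If the indices differ by more than 1, the supports meet at most in the point
    \<open>x (Suc k)\<close>, which belongs to \<open>X\<close>. So at a point off \<open>X\<close>
    only the smallest active index and its successor can occur.\<close>
  have overlap: "card {k \<in> K. derivative (f k) t \<noteq> 0} \<le> 2" if "t \<notin> X" for t
  proof (cases "{k \<in> K. derivative (f k) t \<noteq> 0} = {}")
    case True
    show ?thesis unfolding True by simp
  next
    case False
    define A where "A = {k \<in> K. derivative (f k) t \<noteq> 0}"
    have A: "finite A" "A \<noteq> {}" "A \<subseteq> K" using K False by (auto simp: A_def)
    define k where "k = Min A"
    have kA: "k \<in> A" unfolding k_def by (rule Min_in[OF A(1,2)])
    have "A \<subseteq> {k, Suc k}"
    proof
      fix l assume l: "l \<in> A"
      have "k \<le> l" unfolding k_def by (rule Min_le[OF A(1) l])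
      show "l \<in> {k, Suc k}"
      proof (rule ccontr)
        assume "l \<notin> {k, Suc k}"
        then have kl: "Suc k < l" using \<open>k \<le> l\<close> by auto
        have k1: "1 \<le> k" using kA A(3) K(2) by auto
        have "t \<in> {a k..b k}" "t \<in> {a l..b l}"
          using supp[of k t] supp[of l t] kA l by (auto simp: A_def)
        moreover have "b k \<le> x (Suc k)" using fk[of k] kA A(3) by blast
        moreover have "x (Suc k) \<le> a l" using fk[of l] l A(3) kl by fastforce
        ultimately have "t = x (Suc k)" by auto
        then show False using \<open>t \<notin> X\<close> by (auto simp: X_def)
      qed
    qed
    then have "card A \<le> card {k, Suc k}" by (rule card_mono[rotated]) simp
    then show ?thesis by (simp add: A_def)
  qed
  show ?thesis
    unfolding negative_squares_def
  proof (rule complex_dim_ge)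
    show "L2_complex.subspace (range (E {..<0}))" by (rule subspace_range_E) simp
    fix B assume B: "finite B" "card B < card K" "range (E {..<0}) \<subseteq> L2_complex.span B"
    have "\<exists>r. E {..<0} (abs_L2 (f k)) = (\<Sum>w\<in>B. scaleC (r w) w)" for k
    proof -
      have "E {..<0} (abs_L2 (f k)) \<in> L2_complex.span B" using B(3) by blast
      then show ?thesis unfolding L2_complex.span_finite[OF B(1)] by blast
    qed
    then obtain r where r: "\<And>k. E {..<0} (abs_L2 (f k)) = (\<Sum>w\<in>B. scaleC (r k w) w)" by metis
    \<comment> \<open>One equation for each element of the supposed spanning set \<open>B\<close>: a
      solution gives a combination of bumps that \<open>E {..<0}\<close> maps to 0.\<close>
    obtain c where c: "\<exists>k\<in>K. c k \<noteq> 0" "\<forall>w\<in>B. (\<Sum>k\<in>K. c k * r k w) = 0"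
      using homogeneous_system_nontrivial[OF B(1) K(1) B(2), of r] by blast
    define F where "F = (\<lambda>t. \<Sum>k\<in>K. c k * f k t)"
    define C where "C j = (\<Sum>k\<in>K. c k * (if j = k then 1 else 0))" for j
    have F: "delta_dom \<alpha> F C" unfolding F_def C_def by (rule delta_dom_sum[OF dom])
    have C: "C j = (if j \<in> K then c j else 0)" for j
    proof -
      have "C j = (\<Sum>k\<in>K. if j = k then c k else 0)"
        unfolding C_def by (intro sum.cong) auto
      then show ?thesis using K(1) by simp
    qed
    have "E {..<0} (abs_L2 F) = (\<Sum>k\<in>K. scaleC (c k) (E {..<0} (abs_L2 (f k))))"
      unfolding F_def by (subst abs_L2_sum) (simp_all add: sq E_sum E_scaleC)
    also have "\<dots> = (\<Sum>k\<in>K. \<Sum>w\<in>B. scaleC (c k * r k w) w)"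
      by (simp add: r L2_complex.scale_sum_right scaleC_scaleC)
    also have "\<dots> = (\<Sum>w\<in>B. scaleC (\<Sum>k\<in>K. c k * r k w) w)"
      by (subst sum.swap) (simp add: L2_complex.scale_sum_left)
    also have "\<dots> = 0" using c(2) by (simp add: L2_complex.scale_zero_left)
    finally have E0: "E {..<0} (abs_L2 F) = 0" .
    obtain g where g: "(abs_L2 F, g) \<in> delta_operator x \<alpha>"
        "Re (cinner g (abs_L2 F)) = - (LINT t|lebesgue. form_density F t)"
      using delta_operator_form[OF F] by blast
    have nonneg: "0 \<le> - (LINT t|lebesgue. form_density F t)"
      using spectral_integral_nonneg[OF _ E0, of g] g unfolding T by simp
    \<comment> \<open>By Cauchy-Schwarz the squared modulus of a sum is at most the number of its
      nonzero terms times the sum of their squares; that number is at most 2 off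
      \<open>X\<close>.\<close>
    define \<psi> where "\<psi> t = (\<Sum>k\<in>K. 2 * (cmod (c k))\<^sup>2 * (cmod (derivative (f k) t))\<^sup>2)" for t
    have "- (LINT t|lebesgue. form_density F t) \<le> (LINT t|lebesgue. \<psi> t) + (\<Sum>k\<in>K. \<alpha> k * (cmod (C k))\<^sup>2)"
    proof (rule delta_form_le[OF F K(1,2)])
      show "C k = 0" if "k \<notin> K" for k using that by (simp add: C)
      show "integrable lebesgue \<psi>"
        unfolding \<psi>_def by (intro Bochner_Integration.integrable_sum integrable_mult_right int)
      show "0 \<le> \<psi> t" for t unfolding \<psi>_def by (intro sum_nonneg) simp
      show "F t = 0" if "t \<notin> {Min (insert 0 (a ` K))..Max (insert 0 (b ` K))}" for t
        unfolding F_def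
      proof (rule sum.neutral, rule ballI)
        fix k assume k: "k \<in> K"
        have "Min (insert 0 (a ` K)) \<le> a k" "b k \<le> Max (insert 0 (b ` K))"
          using K(1) k by (auto intro: Min_le Max_ge)
        then have "t \<notin> {a k..b k}" using that by auto
        then show "c k * f k t = 0" using supp[OF k, of t] by auto
      qed
      show "(cmod (derivative F t))\<^sup>2 \<le> \<psi> t" if t: "t \<notin> X" for t
      proof -
        define A where "A = {k \<in> K. derivative (f k) t \<noteq> 0}"
        have A: "A \<subseteq> K" "finite A" using K(1) by (auto simp: A_def)
        have "derivative F t = (\<Sum>k\<in>K. c k * derivative (f k) t)"
          unfolding F_def by (rule derivative_sum[OF W t])
        also have "\<dots> = (\<Sum>k\<in>A. c k * derivative (f k) t)"
          by (rule sum.mono_neutral_right[OF K(1) A(1)]) (auto simp: A_def)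
        finally have "cmod (derivative F t) \<le> (\<Sum>k\<in>A. cmod (c k * derivative (f k) t))"
          by (simp add: norm_sum)
        then have "(cmod (derivative F t))\<^sup>2 \<le> (\<Sum>k\<in>A. cmod (c k * derivative (f k) t))\<^sup>2"
          by (intro power_mono) auto
        also have "\<dots> \<le> (\<Sum>k\<in>A. (cmod (c k * derivative (f k) t))\<^sup>2) * real (card A)"
          by (rule sum_squared_le_sum_of_squares)
        also have "\<dots> \<le> (\<Sum>k\<in>A. (cmod (c k * derivative (f k) t))\<^sup>2) * 2"
          using overlap[OF t] by (intro mult_left_mono sum_nonneg) (auto simp: A_def)
        also have "\<dots> = (\<Sum>k\<in>A. 2 * (cmod (c k))\<^sup>2 * (cmod (derivative (f k) t))\<^sup>2)"
          unfolding sum_distrib_right by (intro sum.cong) (simp_all add: norm_mult power_mult_distrib)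
        also have "\<dots> \<le> \<psi> t"
          unfolding \<psi>_def by (rule sum_mono2[OF K(1) A(1)]) simp
        finally show ?thesis .
      qed
    qed
    also have "\<dots> = (\<Sum>k\<in>K. (cmod (c k))\<^sup>2 * (2 * (LINT t|lebesgue. (cmod (derivative (f k) t))\<^sup>2) + \<alpha> k))"
    proof -
      have "(LINT t|lebesgue. \<psi> t) = (\<Sum>k\<in>K. 2 * (cmod (c k))\<^sup>2 * (LINT t|lebesgue. (cmod (derivative (f k) t))\<^sup>2))"
        unfolding \<psi>_def by (subst Bochner_Integration.integral_sum) (auto intro: int)
      then show ?thesis by (simp add: C sum.distrib[symmetric] algebra_simps)
    qed
    also have "\<dots> < 0"
    proof -
      obtain k where k: "k \<in> K" "c k \<noteq> 0" using c(1) by blast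
      have "(\<Sum>k\<in>K. (cmod (c k))\<^sup>2 * (2 * (LINT t|lebesgue. (cmod (derivative (f k) t))\<^sup>2) + \<alpha> k)) < (\<Sum>k\<in>K. 0)"
      proof (rule sum_strict_mono_ex1[OF K(1)])
        show "\<forall>k\<in>K. (cmod (c k))\<^sup>2 * (2 * (LINT t|lebesgue. (cmod (derivative (f k) t))\<^sup>2) + \<alpha> k) \<le> 0"
        proof
          fix k assume "k \<in> K"
          then show "(cmod (c k))\<^sup>2 * (2 * (LINT t|lebesgue. (cmod (derivative (f k) t))\<^sup>2) + \<alpha> k) \<le> 0"
            using energy[of k] by (intro mult_nonneg_nonpos) auto
        qed
        show "\<exists>k\<in>K. (cmod (c k))\<^sup>2 * (2 * (LINT t|lebesgue. (cmod (derivative (f k) t))\<^sup>2) + \<alpha> k) < 0"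
          using k energy[OF k(1)] by (intro bexI[of _ k] mult_pos_neg) auto
      qed
      then show ?thesis by simp
    qed
    finally show False using nonneg by simp
  qed
qed

lemma negative_squares_le:
  assumes E: "is_spectral_measure_of E (delta_operator x \<alpha>)" and K: "finite K"
    and \<alpha>: "\<And>i. i \<ge> 1 \<Longrightarrow> i \<notin> K \<Longrightarrow> \<alpha> i > 0"
  shows "negative_squares E \<le> enat (card K)"
proof -
  interpret projection_measure E
    using E by unfold_locales (simp add: is_spectral_measure_of_def)
  have T: "delta_operator x \<alpha> = spectral_integral E" using E by (simp add: is_spectral_measure_of_def)
  show ?thesis
    unfolding negative_squares_def
  proof (rule complex_dim_negative_le)
    fix n S assume S: "finite S" "S \<subseteq> range (E (negative_window n))" "L2_complex.independent S"
    let ?C = "negative_window n" and ?e = "1 / real (Suc n)"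
    have sub: "?C \<subseteq> {- real (Suc n)..real (Suc n)}" unfolding negative_window_def by auto (smt (verit) of_nat_0_le_iff divide_nonneg_nonneg)
    show "card S \<le> card K"
    proof (rule ccontr)
      assume "\<not> card S \<le> card K"
      then have less: "card K < card S" by simp
      have "\<exists>f c. delta_dom \<alpha> f c \<and> v = abs_L2 f" if "v \<in> S" for v
      proof -
        have "E ?C v = v" using S(2) that by (simp add: range_E_iff[symmetric] negative_window_borel subset_iff)
        then obtain g where "(v, g) \<in> delta_operator x \<alpha>"
          using E_bounded_in_domain[OF negative_window_borel sub] T by auto
        then show ?thesis unfolding delta_operator_iff by blast
      qed
      then obtain f c where fc: "\<And>v. v \<in> S \<Longrightarrow> delta_dom \<alpha> (f v) (c v)" "\<And>v. v \<in> S \<Longrightarrow> v = abs_L2 (f v)"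
        by metis
      \<comment> \<open>One equation for each index in \<open>K\<close>: the combination gets the
        limit 0 at these points, which removes all jumps that might be negative.\<close>
      obtain d where d: "\<exists>v\<in>S. d v \<noteq> 0" "\<forall>k\<in>K. (\<Sum>v\<in>S. d v * c v k) = 0"
        using homogeneous_system_nontrivial[OF K S(1) less, of c] by blast
      define F where "F = (\<lambda>t. \<Sum>v\<in>S. d v * f v t)"
      define y where "y = abs_L2 F"
      have F: "delta_dom \<alpha> F (\<lambda>k. \<Sum>v\<in>S. d v * c v k)"
        unfolding F_def by (rule delta_dom_sum[OF fc(1)])
      have "y = (\<Sum>v\<in>S. scaleC (d v) (abs_L2 (f v)))"
        unfolding y_def F_def by (rule abs_L2_sum) (rule delta_dom_square_integrable[OF fc(1)])
      also have "\<dots> = (\<Sum>v\<in>S. scaleC (d v) v)"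
        by (intro sum.cong refl) (simp flip: fc(2))
      finally have y: "y = (\<Sum>v\<in>S. scaleC (d v) v)" .
      have "y \<noteq> 0"
        using independent_sum_eq_0[OF S(3,1)] d(1) y by metis
      have "y \<in> range (E ?C)"
        unfolding y using S(2) L2_complex.subspace_sum[OF subspace_range_E[OF negative_window_borel]]
          L2_complex.subspace_scale[OF subspace_range_E[OF negative_window_borel]]
        by (metis (no_types, lifting) subsetD)
      then have Ey: "E ?C y = y" by (simp add: range_E_iff negative_window_borel)
      obtain g where g: "(y, g) \<in> delta_operator x \<alpha>"
          "Re (cinner g y) = - (LINT t|lebesgue. form_density F t)"
        using delta_operator_form[OF F] unfolding y_def by blast
      have "Re (cinner g y) \<le> - ?e * (norm y)\<^sup>2"
      proof (rule spectral_integral_negative[OF _ negative_window_borel _ Ey])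
        show "(y, g) \<in> spectral_integral E" using g(1) T by simp
        show "?C \<subseteq> {- real (Suc n)..- ?e}" unfolding negative_window_def ..
      qed
      moreover have "- ?e * (norm y)\<^sup>2 < 0" using \<open>y \<noteq> 0\<close> by simp
      moreover have "(LINT t|lebesgue. form_density F t) \<le> 0"
      proof (rule delta_form_nonneg[OF F])
        fix k :: nat assume "k \<ge> 1"
        then show "0 \<le> \<alpha> k * (cmod (\<Sum>v\<in>S. d v * c v k))\<^sup>2"
          using d(2) \<alpha>[of k] by (cases "k \<in> K") auto
      qed
      ultimately show False using g(2) by linarith
    qed
  qed
qed

end

theorem theorem3p3:
  fixes x \<alpha> :: "nat \<Rightarrow> real" and m :: nat and K :: "nat set"
    and E :: "real set \<Rightarrow> L2 \<Rightarrow> L2"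
  assumes "strict_mono_on {1..} x"
    and "(INF k\<in>{1..}. gap x k) > 0" and "bdd_above (gap x ` {1..})"
    and "is_spectral_measure_of E (delta_operator x \<alpha>)"
    and "m \<ge> 1" and "finite K" and "K \<subseteq> {1..}" and "card K = m"
    and "\<forall>k\<in>K. \<alpha> k < - 2 * (inverse_gap x (k - 1) + inverse_gap x k)"
  shows "negative_squares E \<ge> enat m \<and>
         ((\<forall>i\<in>{1..} - K. \<alpha> i > 0) \<longrightarrow> negative_squares E = enat m)"
proof -
  define \<delta> where "\<delta> = (INF k\<in>{1..}. gap x k)"
  \<comment> \<open>A real infimum is a lower bound only for a set that is bounded below, here by
    0.\<close>
  have "bdd_below (gap x ` {1..})"
  proof (rule bdd_belowI2)
    fix k :: nat assume "k \<in> {1..}"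
    then have "x k < x (k + 1)" using strict_mono_onD[OF assms(1), of k "k + 1"] by simp
    then show "0 \<le> gap x k" by (simp add: gap_def)
  qed
  then have step: "\<delta> \<le> x (Suc k) - x k" if "k \<ge> 1" for k
    using cINF_lower[of "gap x" "{1..}" k] that by (simp add: \<delta>_def gap_def)
  \<comment> \<open>The positive infimum of the gaps forces at least linear growth, hence the
    unboundedness that the locale asks for.\<close>
  have growth: "x 1 + real n * \<delta> \<le> x (Suc n)" for n
  proof (induction n)
    case (Suc n)
    then show ?case using step[of "Suc n"] by (simp add: algebra_simps)
  qed simp
  interpret interaction_points x
  proof
    show "\<exists>k\<ge>1. b < x k" for b
    proof -
      obtain n where "b - x 1 < real n * \<delta>"
        using ex_less_of_nat_mult assms(2) \<delta>_def by blast
      then have "b < x (Suc n)" using growth[of n] by linarith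
      then show ?thesis by (intro exI[of _ "Suc n"]) simp
    qed
  qed (rule assms)
  have "enat m \<le> negative_squares E"
    using negative_squares_ge[OF assms(4,6,7)] assms(8,9) by simp
  moreover have "negative_squares E \<le> enat m" if "\<forall>i\<in>{1..} - K. \<alpha> i > 0"
    using negative_squares_le[OF assms(4,6)] that assms(8) by simp
  ultimately show ?thesis by (auto intro: antisym)
qed

end
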